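(* Let $n\ge 3$, $L>0$ and $M=[0,L]\times\mathbb{S}^{n-1}$. Define $$B_n(L) := \min\left\{ \frac{(n-2)\left(1+L/2\right)^{n-2}}{\left(1+L/2\right)^{n-2}-1},\ \frac{(n-1)\left(\left(1+L/2\right)^n-1\right)}{\left(1+L/2\right)^n+n-1}\right\}.$$ Then for every metric of revolution $g$ on $M$, $$\sigma_1(M,g) < B_n(L).$$ Moreover, this bound is sharp: for each $\varepsilon>0$ there exists a metric of revolution $g_\varepsilon$ on $M$ such that $\sigma_1(M,g_\varepsilon) > B_n(L)-\varepsilon$.
   Context: Metric of revolution: for $L>0$ and $M=[0,L]\times\mathbb{S}^{n-1}$, a metric of revolution on $M$ is a Riemannian metric of the form $g(r,p) = dr^2 + h^2(r) g_0(p)$, $(r,p)\in[0,L]\times\mathbb{S}^{n-1}$, where $g_0$ is the canonical metric of the unit $(n-1)$-sphere and $h:[0,L]\to(0,\infty)$ is a smooth function satisfying (1) $|h'(r)|\le 1$ for all $r\in[0,L]$ and (2) $h(0)=h(L)=1$. One says $g$ is induced by $h$; $(M,g)$ is called a hypersurface of revolution (in Euclidean space, with two boundary components each isometric to $\mathbb{S}^{n-1}$), and $L$ is its meridian length. Steklov eigenvalues: for a smooth compact connected Riemannian manifold $(M,g)$ with smooth boundary $\Sigma$, these are the real numbers $\sigma$ for which there is a nonzero harmonic function $f:M\to\mathbb{R}$ with $\partial_\nu f = \sigma f$ on $\Sigma$ ($\nu$ the outward unit normal). They form a sequence $0=\sigma_0(M,g)<\sigma_1(M,g)\le\sigma_2(M,g)\le\dots\nearrow\infty$,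 repeated according to multiplicity. *)

theory Defs
  imports "HOL-Analysis.Analysis"
begin

primrec Ck_on :: "nat \<Rightarrow> 'a::euclidean_space set \<Rightarrow> ('a \<Rightarrow> real) \<Rightarrow> bool" where
  "Ck_on 0 U f \<longleftrightarrow> continuous_on U f"
| "Ck_on (Suc k) U f \<longleftrightarrow> (\<forall>x\<in>U. f differentiable at x) \<and>
     (\<forall>b\<in>Basis. Ck_on k U (\<lambda>x. frechet_derivative f (at x) b))"

text \<open>On a set with boundary, smoothness means smoothness on some open neighbourhood.
  A smooth function on such a set is represented by any of its smooth extensions; all notions
  below depend only on its values on the set itself.\<close>

definition smooth_near :: "'a::euclidean_space set \<Rightarrow> ('a \<Rightarrow> real) \<Rightarrow> bool" where
  "smooth_near S f \<longleftrightarrow> (\<exists>U. open U \<and> S \<subseteq> U \<and> (\<forall>k. Ck_on k U f))"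

text \<open>The manifold \<open>[0,L] \<times> S\<^sup>n\<^sup>-\<^sup>1\<close> sits in \<open>\<real> \<times> \<real>\<^sup>n\<close>, where \<open>n = CARD('n)\<close>. Tangent vectors
  are vectors of the ambient space, and a field of bilinear forms \<open>g x v w\<close> is only relevant
  for \<open>x\<close> in the manifold and \<open>v\<close>, \<open>w\<close> tangent at \<open>x\<close>.\<close>

type_synonym 'n point = "real \<times> (real^'n)"
type_synonym 'n form_field = "'n point \<Rightarrow> 'n point \<Rightarrow> 'n point \<Rightarrow> real"

definition cyl :: "real \<Rightarrow> 'n::finite point set" where
  "cyl L = {0..L} \<times> sphere 0 1"

definition cyl_boundary :: "real \<Rightarrow> 'n::finite point set" where
  "cyl_boundary L = {0, L} \<times> sphere 0 1"

definition tangent_cyl :: "'n::finite point \<Rightarrow> 'n point set" where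
  "tangent_cyl x = {v. snd v \<bullet> snd x = 0}"

definition tangent_boundary :: "'n::finite point \<Rightarrow> 'n point set" where
  "tangent_boundary x = {v \<in> tangent_cyl x. fst v = 0}"

text \<open>The canonical metric of the unit sphere is the restriction of the Euclidean inner
  product to its tangent spaces.\<close>

definition metric_of_revolution :: "real \<Rightarrow> 'n::finite form_field \<Rightarrow> bool" where
  "metric_of_revolution L g \<longleftrightarrow>
     (\<exists>h :: real \<Rightarrow> real. smooth_near {0..L} h \<and> (\<forall>r\<in>{0..L}. h r > 0) \<and>
        (\<forall>r\<in>{0..L}. \<bar>deriv h r\<bar> \<le> 1) \<and> h 0 = 1 \<and> h L = 1 \<and>
        (\<forall>x\<in>cyl L. \<forall>v\<in>tangent_cyl x. \<forall>w\<in>tangent_cyl x.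
           g x v w = fst v * fst w + (h (fst x))\<^sup>2 * (snd v \<bullet> snd w)))"

definition partial_deriv :: "'n::finite \<Rightarrow> (real^'n \<Rightarrow> 'b::real_normed_vector) \<Rightarrow> real^'n \<Rightarrow> 'b" where
  "partial_deriv i F u = frechet_derivative F (at u) (axis i 1)"

definition gram_matrix ::
  "('e::real_normed_vector \<Rightarrow> 'e \<Rightarrow> 'e \<Rightarrow> real) \<Rightarrow> (real^'n::finite \<Rightarrow> 'e) \<Rightarrow> real^'n \<Rightarrow> real^'n^'n" where
  "gram_matrix g \<phi> u = (\<chi> i j. g (\<phi> u) (partial_deriv i \<phi> u) (partial_deriv j \<phi> u))"

text \<open>The Laplace--Beltrami operator (divergence of the gradient) of \<open>f\<close> at the point \<open>\<phi> u\<close>,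
  written in the coordinates given by a local parametrization \<open>\<phi>\<close>.\<close>

definition laplace_beltrami ::
  "('e::real_normed_vector \<Rightarrow> 'e \<Rightarrow> 'e \<Rightarrow> real) \<Rightarrow> (real^'n::finite \<Rightarrow> 'e) \<Rightarrow> ('e \<Rightarrow> real) \<Rightarrow> real^'n \<Rightarrow> real"
  where
  "laplace_beltrami g \<phi> f u =
     (\<Sum>i\<in>UNIV. partial_deriv i
        (\<lambda>v. sqrt (det (gram_matrix g \<phi> v)) *
             (\<Sum>j\<in>UNIV. matrix_inv (gram_matrix g \<phi> v) $ i $ j * partial_deriv j (f \<circ> \<phi>) v)) u)
     / sqrt (det (gram_matrix g \<phi> u))"

text \<open>One parametrization covers the whole manifold: it maps the closed shell
  \<open>1 \<le> norm u \<le> 1 + L\<close> of \<open>\<real>\<^sup>n\<close> diffeomorphically onto \<open>cyl L\<close>, with inverse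
  \<open>(r, p) \<mapsto> (1 + r) p\<close>. The Laplacian does not depend on the choice of coordinates.\<close>

definition polar :: "real^'n::finite \<Rightarrow> 'n point" where
  "polar u = (norm u - 1, u /\<^sub>R norm u)"

lemma polar_bij_betw_interior:
  "bij_betw polar {u :: real^'n::finite. 1 < norm u \<and> norm u < 1 + L} ({0<..<L} \<times> sphere 0 1)"
proof (rule bij_betwI[where g = "\<lambda>(r, p). (1 + r) *\<^sub>R p"])
  have *: "inverse t * t = 1" "t * inverse t = 1" if "1 < t" for t :: real
    using that by auto
  show "polar \<in> {u :: real^'n. 1 < norm u \<and> norm u < 1 + L} \<rightarrow> {0<..<L} \<times> sphere 0 1"
    by (auto simp: polar_def *)
  show "(\<lambda>(r, p). (1 + r) *\<^sub>R p) (polar u) = u"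
    if "u \<in> {u :: real^'n. 1 < norm u \<and> norm u < 1 + L}" for u
    using that by (auto simp: polar_def *)
qed (auto simp: polar_def)

text \<open>It suffices to require the equation at interior points: the functions considered are
  smooth up to the boundary.\<close>

definition harmonic_cyl :: "real \<Rightarrow> 'n::finite form_field \<Rightarrow> ('n point \<Rightarrow> real) \<Rightarrow> bool" where
  "harmonic_cyl L g f \<longleftrightarrow> smooth_near (cyl L) f \<and>
     (\<forall>u. 1 < norm u \<and> norm u < 1 + L \<longrightarrow> laplace_beltrami g polar f u = 0)"

definition outward_unit_normal ::
  "real \<Rightarrow> 'n::finite form_field \<Rightarrow> 'n point \<Rightarrow> 'n point \<Rightarrow> bool" where
  "outward_unit_normal L g x \<nu> \<longleftrightarrow> \<nu> \<in> tangent_cyl x \<and> g x \<nu> \<nu> = 1 \<and>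
     (\<forall>w\<in>tangent_boundary x. g x \<nu> w = 0) \<and>
     (if fst x = 0 then fst \<nu> < 0 else fst \<nu> > 0)"

text \<open>The zero function is allowed here; the eigenspace belonging to \<open>\<sigma>\<close> consists of the
  restrictions to \<open>cyl L\<close> of these functions.\<close>

definition steklov_eigenfunction ::
  "real \<Rightarrow> 'n::finite form_field \<Rightarrow> real \<Rightarrow> ('n point \<Rightarrow> real) \<Rightarrow> bool" where
  "steklov_eigenfunction L g \<sigma> f \<longleftrightarrow> harmonic_cyl L g f \<and>
     (\<forall>x\<in>cyl_boundary L. \<forall>\<nu>. outward_unit_normal L g x \<nu> \<longrightarrow>
        frechet_derivative f (at x) \<nu> = \<sigma> * f x)"

definition lin_indep_on :: "'a set \<Rightarrow> nat \<Rightarrow> (nat \<Rightarrow> 'a \<Rightarrow> real) \<Rightarrow> bool" where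
  "lin_indep_on S m F \<longleftrightarrow>
     (\<forall>c. (\<forall>x\<in>S. (\<Sum>i<m. c i * F i x) = 0) \<longrightarrow> (\<forall>i<m. c i = (0::real)))"

text \<open>The eigenvalues in increasing order, counted from \<open>0\<close> and repeated according to
  multiplicity: the \<open>k\<close>-th one is the least \<open>t\<close> such that the eigenvalues not exceeding \<open>t\<close> have
  total multiplicity at least \<open>k + 1\<close>.\<close>

definition steklov_eigenvalue :: "real \<Rightarrow> 'n::finite form_field \<Rightarrow> nat \<Rightarrow> real" where
  "steklov_eigenvalue L g k =
     Inf {t. \<exists>F s. lin_indep_on (cyl L) (Suc k) F \<and>
                   (\<forall>i<Suc k. s i \<le> t \<and> steklov_eigenfunction L g (s i) (F i))}"

definition B_bound :: "nat \<Rightarrow> real \<Rightarrow> real" where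
  "B_bound n L = min
     ((real n - 2) * (1 + L/2) ^ (n - 2) / ((1 + L/2) ^ (n - 2) - 1))
     ((real n - 1) * ((1 + L/2) ^ n - 1) / ((1 + L/2) ^ n + real n - 1))"

end

theory Submission imports Defs begin

text \<open>Separation of variables suggests that \<open>\<sigma>\<^sub>1\<close> is the smaller of two numbers: the eigenvalue
  \<open>2 / \<integral> h\<^sup>1\<^sup>-\<^sup>n\<close> of a radial function, and the lowest eigenvalue among the functions
  \<open>a(r) (p \<bullet> e)\<close>. Since \<open>\<bar>h'\<bar> \<le> 1\<close> forces \<open>h\<close> to lie below the tent
  \<open>1 + min(r, L - r)\<close>, strictly so at its corner, both are strictly smaller than their values for the tent,
  and these are the two terms of \<open>B\<^sub>n(L)\<close>; rounding the corner of the tent shows sharpness.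

  For the lower bound no spherical harmonics are needed. If an eigenfunction \<open>f\<close> is not radial, then
  \<open>f - f \<circ> R\<close> is nonzero for the reflection \<open>R\<close> along some unit vector \<open>e\<close>, and the
  maximum principle compares it on the half \<open>p \<bullet> e \<ge> 0\<close> with a positive superharmonic function
  \<open>a(r) \<psi>(p \<bullet> e)\<close>, where \<open>h\<^sup>n\<^sup>-\<^sup>1 a' / a\<close> satisfies a Riccati inequality. Hence an
  eigenvalue that is too small only admits radial eigenfunctions, and these solve an explicit
  differential equation.\<close>

section \<open>Smooth functions\<close>

lemma Ck_on_cong:
  assumes "open U" "\<And>x. x \<in> U \<Longrightarrow> f x = g x"
  shows "Ck_on k U f \<longleftrightarrow> Ck_on k U g"
  using assms
proof (induction k arbitrary: f g)
  case 0
  then show ?case by (simp cong: continuous_on_cong)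
next
  case (Suc k)
  have D: "(f has_derivative D) (at x) \<longleftrightarrow> (g has_derivative D) (at x)" if "x \<in> U" for x D
    using has_derivative_transform_within_open[OF _ \<open>open U\<close> that, of f D UNIV g]
      has_derivative_transform_within_open[OF _ \<open>open U\<close> that, of g D UNIV f] Suc.prems by auto
  then have "frechet_derivative f (at x) = frechet_derivative g (at x)" if "x \<in> U" for x
    using that by (simp add: frechet_derivative_def)
  then have "Ck_on k U (\<lambda>x. frechet_derivative f (at x) b) = Ck_on k U (\<lambda>x. frechet_derivative g (at x) b)" for b
    by (intro Suc.IH Suc.prems) simp
  moreover have "f differentiable at x \<longleftrightarrow> g differentiable at x" if "x \<in> U" for x
    using D that by (simp add: differentiable_def)
  ultimately show ?case by simp
qed

lemma Ck_on_subset: "Ck_on k U f \<Longrightarrow> V \<subseteq> U \<Longrightarrow> Ck_on k V f"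
  by (induction k arbitrary: f) (auto intro: continuous_on_subset)

lemma Ck_on_SucD: "Ck_on (Suc k) U f \<Longrightarrow> Ck_on k U f"
proof (induction k arbitrary: f)
  case 0
  then show ?case
    by (metis Ck_on.simps continuous_at_imp_continuous_on differentiable_imp_continuous_within)
next
  case (Suc k)
  then show ?case by (metis Ck_on.simps(2))
qed

lemma Ck_on_SucI:
  assumes "open U" "\<And>x. x \<in> U \<Longrightarrow> (f has_derivative D x) (at x)"
    and "\<And>b. b \<in> Basis \<Longrightarrow> Ck_on k U (\<lambda>x. D x b)"
  shows "Ck_on (Suc k) U f"
proof -
  have "Ck_on k U (\<lambda>x. frechet_derivative f (at x) b) = Ck_on k U (\<lambda>x. D x b)" for b
    using assms(2) by (intro Ck_on_cong \<open>open U\<close>) (metis frechet_derivative_at)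
  then show ?thesis using assms by (auto simp: differentiable_def)
qed

lemma Ck_on_const: "open U \<Longrightarrow> Ck_on k U (\<lambda>x. c)"
proof (induction k arbitrary: c)
  case (Suc k)
  then show ?case by (intro Ck_on_SucI[where D = "\<lambda>x w. 0"]) auto
qed simp

lemma Ck_on_add: "open U \<Longrightarrow> Ck_on k U f \<Longrightarrow> Ck_on k U g \<Longrightarrow> Ck_on k U (\<lambda>x. f x + g x)"
proof (induction k arbitrary: f g)
  case 0
  then show ?case by (simp add: continuous_on_add continuous_on_mult)
next
  case (Suc k)
  show ?case
  proof (rule Ck_on_SucI)
    show "((\<lambda>x. f x + g x) has_derivative (\<lambda>w. frechet_derivative f (at x) w + frechet_derivative g (at x) w)) (at x)"
      if "x \<in> U" for x
      using Suc.prems that by (intro has_derivative_add) (auto simp: frechet_derivative_works)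
  qed (use Suc in auto)
qed

lemma Ck_on_mult: "open U \<Longrightarrow> Ck_on k U f \<Longrightarrow> Ck_on k U g \<Longrightarrow> Ck_on k U (\<lambda>x. f x * g x)"
proof (induction k arbitrary: f g)
  case 0
  then show ?case by (simp add: continuous_on_add continuous_on_mult)
next
  case (Suc k)
  show ?case
  proof (rule Ck_on_SucI)
    show "((\<lambda>x. f x * g x) has_derivative
        (\<lambda>w. f x * frechet_derivative g (at x) w + frechet_derivative f (at x) w * g x)) (at x)"
      if "x \<in> U" for x
      using Suc.prems that by (intro has_derivative_mult) (auto simp: frechet_derivative_works)
  qed (use Suc Ck_on_SucD[OF Suc.prems(2)] Ck_on_SucD[OF Suc.prems(3)] in \<open>auto intro!: Ck_on_add\<close>)
qed

lemma Ck_on_power: "open U \<Longrightarrow> Ck_on k U f \<Longrightarrow> Ck_on k U (\<lambda>x. f x ^ m)"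
  by (induction m) (auto intro: Ck_on_const Ck_on_mult)

lemma Ck_on_bounded_linear:
  assumes "open U" "bounded_linear f"
  shows "Ck_on k U f"
proof (cases k)
  case 0
  then show ?thesis using assms by (simp add: linear_continuous_on)
next
  case (Suc j)
  then show ?thesis using assms
    by (auto intro!: Ck_on_SucI[where D = "\<lambda>x. f"] Ck_on_const bounded_linear_imp_has_derivative simp del: Ck_on.simps)
qed

lemma Ck_on_real_SucI:
  fixes f :: "real \<Rightarrow> real"
  assumes "open U" "\<And>x. x \<in> U \<Longrightarrow> (f has_real_derivative f' x) (at x)" "Ck_on k U f'"
  shows "Ck_on (Suc k) U f"
  using assms by (intro Ck_on_SucI[where D = "\<lambda>x. (*) (f' x)"]) (auto simp: has_field_derivative_def)

lemma Ck_on_real_deriv: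
  fixes f :: "real \<Rightarrow> real"
  assumes "open U" "Ck_on (Suc k) U f"
  shows "Ck_on k U (deriv f)" and "\<And>x. x \<in> U \<Longrightarrow> (f has_real_derivative deriv f x) (at x)"
proof -
  show D: "(f has_real_derivative deriv f x) (at x)" if "x \<in> U" for x
    using assms that by (auto simp: DERIV_deriv_iff_real_differentiable)
  have "frechet_derivative f (at x) 1 = deriv f x" if "x \<in> U" for x
    using frechet_derivative_at[OF D[OF that, unfolded has_field_derivative_def]]
    by (metis mult.right_neutral)
  then show "Ck_on k U (deriv f)"
    using assms Ck_on_cong[OF assms(1), of "\<lambda>x. frechet_derivative f (at x) 1" "deriv f"] by auto
qed

lemma Ck_on_compose_fst:
  fixes a :: "real \<Rightarrow> real"
  assumes "open U"
  shows "Ck_on k U a \<Longrightarrow> Ck_on k (U \<times> (UNIV :: 'a::euclidean_space set)) (\<lambda>x. a (fst x))"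
proof (induction k arbitrary: a)
  case 0
  then show ?case by (auto intro: continuous_on_compose2[OF _ continuous_on_fst[OF continuous_on_id]])
next
  case (Suc k)
  note d = Ck_on_real_deriv[OF assms Suc.prems]
  show ?case
  proof (rule Ck_on_SucI)
    show "((\<lambda>x. a (fst x)) has_derivative (\<lambda>w. deriv a (fst x) * fst w)) (at x)"
      if "x \<in> U \<times> (UNIV :: 'a set)" for x
      using that by (intro has_derivative_compose[OF has_derivative_fst[OF has_derivative_ident]
            d(2)[unfolded has_field_derivative_def]]) auto
    show "Ck_on k (U \<times> (UNIV :: 'a set)) (\<lambda>x. deriv a (fst x) * fst b)" for b
      by (intro Ck_on_mult Ck_on_const Suc.IH d(1) open_Times assms open_UNIV)
  qed (auto intro: open_Times assms)
qed

text \<open>The reciprocal satisfies the polynomial differential equation \<open>u' = - f' u\<^sup>2\<close>, so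
  its regularity bootstraps.\<close>

lemma Ck_on_inverse:
  fixes f :: "real \<Rightarrow> real"
  assumes "open U" "\<And>x. x \<in> U \<Longrightarrow> f x \<noteq> 0"
  shows "Ck_on k U f \<Longrightarrow> Ck_on k U (\<lambda>x. inverse (f x))"
proof (induction k)
  case 0
  then show ?case using assms by (auto intro: continuous_on_inverse)
next
  case (Suc k)
  note d = Ck_on_real_deriv[OF assms(1) Suc.prems]
  have IH: "Ck_on k U (\<lambda>x. inverse (f x))"
    using Suc Ck_on_SucD by blast
  show ?case
  proof (rule Ck_on_real_SucI[OF \<open>open U\<close>])
    show "((\<lambda>x. inverse (f x)) has_real_derivative deriv f x * ((-1) * (inverse (f x))\<^sup>2)) (at x)"
      if "x \<in> U" for x
      using d(2)[OF that] assms(2)[OF that]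
      by (auto intro!: derivative_eq_intros simp: power2_eq_square)
    show "Ck_on k U (\<lambda>x. deriv f x * ((-1) * (inverse (f x))\<^sup>2))"
      by (intro Ck_on_mult Ck_on_const Ck_on_power IH d(1) assms)
  qed
qed

lemma Ck_on_sqrt:
  fixes f :: "real \<Rightarrow> real"
  assumes "open U" "\<And>x. x \<in> U \<Longrightarrow> f x > 0" "\<And>k. Ck_on k U f"
  shows "Ck_on k U (\<lambda>x. sqrt (f x))"
proof (induction k)
  case 0
  then show ?case using assms(3)[of 0] by (simp add: continuous_on_real_sqrt)
next
  case (Suc k)
  note d = Ck_on_real_deriv[OF assms(1) assms(3)]
  show ?case
  proof (rule Ck_on_real_SucI[OF \<open>open U\<close>])
    show "((\<lambda>x. sqrt (f x)) has_real_derivative deriv f x * (inverse (sqrt (f x)) * (1/2))) (at x)"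
      if "x \<in> U" for x
      using d(2)[OF that] assms(2)[OF that]
      by (auto intro!: derivative_eq_intros simp: field_simps)
    show "Ck_on k U (\<lambda>x. deriv f x * (inverse (sqrt (f x)) * (1/2)))"
      by (intro Ck_on_mult Ck_on_const Ck_on_inverse Suc d(1) assms) (use assms(2) in force)
  qed
qed

section \<open>Second-order expansions\<close>

definition has_jet :: "('a::euclidean_space \<Rightarrow> real) \<Rightarrow> 'a \<Rightarrow> ('a \<Rightarrow> 'a) \<Rightarrow> ('a \<Rightarrow> 'a) \<Rightarrow> bool" where
  "has_jet F u G H \<longleftrightarrow>
     (\<forall>\<^sub>F y in nhds u. (F has_derivative (\<lambda>w. G y \<bullet> w)) (at y)) \<and> (G has_derivative H) (at u)"

lemma has_jetD:
  assumes "has_jet F u G H"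
  shows "(F has_derivative (\<lambda>w. G u \<bullet> w)) (at u)" "(G has_derivative H) (at u)" "bounded_linear H"
  using assms by (auto simp: has_jet_def has_derivative_bounded_linear dest: eventually_nhds_x_imp_x)

lemma has_jet_diff:
  assumes "has_jet F u G H" "has_jet F' u G' H'"
  shows "has_jet (\<lambda>y. F y - F' y) u (\<lambda>y. G y - G' y) (\<lambda>w. H w - H' w)"
proof -
  from assms[unfolded has_jet_def, THEN conjunct1]
  have "\<forall>\<^sub>F y in nhds u. ((\<lambda>y. F y - F' y) has_derivative (\<lambda>w. (G y - G' y) \<bullet> w)) (at y)"
    by (rule eventually_elim2) (simp only: inner_diff_left has_derivative_diff)
  then show ?thesis
    using has_derivative_diff[OF has_jetD(2)[OF assms(1)] has_jetD(2)[OF assms(2)]]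
    unfolding has_jet_def by blast
qed

lemma has_jet_cmult:
  assumes "has_jet F u G H"
  shows "has_jet (\<lambda>y. c * F y) u (\<lambda>y. c *\<^sub>R G y) (\<lambda>w. c *\<^sub>R H w)"
proof -
  from assms[unfolded has_jet_def, THEN conjunct1]
  have "\<forall>\<^sub>F y in nhds u. ((\<lambda>y. c * F y) has_derivative (\<lambda>w. (c *\<^sub>R G y) \<bullet> w)) (at y)"
    by (rule eventually_mono) (simp only: inner_scaleR_left has_derivative_mult_right)
  then show ?thesis
    using has_derivative_scaleR_right[OF has_jetD(2)[OF assms], of c]
    unfolding has_jet_def by blast
qed

lemma has_jet_mult:
  assumes "has_jet F u G H" "has_jet F' u G' H'"
  shows "has_jet (\<lambda>y. F y * F' y) u (\<lambda>y. F y *\<^sub>R G' y + F' y *\<^sub>R G y)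
    (\<lambda>w. F u *\<^sub>R H' w + (G u \<bullet> w) *\<^sub>R G' u + (F' u *\<^sub>R H w + (G' u \<bullet> w) *\<^sub>R G u))"
proof -
  note d = has_jetD[OF assms(1)] has_jetD[OF assms(2)]
  have "\<forall>\<^sub>F y in nhds u. ((\<lambda>y. F y * F' y) has_derivative (\<lambda>w. (F y *\<^sub>R G' y + F' y *\<^sub>R G y) \<bullet> w)) (at y)"
    using assms[unfolded has_jet_def, THEN conjunct1]
  proof (rule eventually_elim2)
    fix y assume "(F has_derivative (\<lambda>w. G y \<bullet> w)) (at y)" "(F' has_derivative (\<lambda>w. G' y \<bullet> w)) (at y)"
    from has_derivative_mult[OF this]
    show "((\<lambda>y. F y * F' y) has_derivative (\<lambda>w. (F y *\<^sub>R G' y + F' y *\<^sub>R G y) \<bullet> w)) (at y)"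
      by (rule has_derivative_eq_rhs) (simp add: inner_add_left algebra_simps)
  qed
  then show ?thesis
    unfolding has_jet_def
    using has_derivative_add[OF has_derivative_scaleR[OF d(1) d(5)] has_derivative_scaleR[OF d(4) d(2)]]
    by simp
qed

lemma has_jet_compose:
  assumes "has_jet F u G H"
    and "\<forall>\<^sub>F t in nhds (F u). (\<phi> has_real_derivative \<phi>' t) (at t)"
    and "(\<phi>' has_real_derivative \<phi>2) (at (F u))"
  shows "has_jet (\<lambda>y. \<phi> (F y)) u (\<lambda>y. \<phi>' (F y) *\<^sub>R G y)
    (\<lambda>w. \<phi>' (F u) *\<^sub>R H w + (\<phi>2 * (G u \<bullet> w)) *\<^sub>R G u)"
proof -
  note d = has_jetD[OF assms(1)]
  have "isCont F u" using d(1) has_derivative_continuous by blast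
  then have "filterlim F (nhds (F u)) (nhds u)"
    by (simp add: isCont_def tendsto_at_iff_tendsto_nhds)
  from eventually_compose_filterlim[OF assms(2) this]
  have "\<forall>\<^sub>F y in nhds u. (\<phi> has_real_derivative \<phi>' (F y)) (at (F y))" .
  then have "\<forall>\<^sub>F y in nhds u. ((\<lambda>y. \<phi> (F y)) has_derivative (\<lambda>w. (\<phi>' (F y) *\<^sub>R G y) \<bullet> w)) (at y)"
    using assms(1)[unfolded has_jet_def, THEN conjunct1]
  proof (rule eventually_elim2)
    fix y assume "(\<phi> has_real_derivative \<phi>' (F y)) (at (F y))" "(F has_derivative (\<lambda>w. G y \<bullet> w)) (at y)"
    then show "((\<lambda>y. \<phi> (F y)) has_derivative (\<lambda>w. (\<phi>' (F y) *\<^sub>R G y) \<bullet> w)) (at y)"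
      by (auto intro: has_derivative_eq_rhs[OF has_derivative_compose] simp: has_field_derivative_def)
  qed
  moreover have "((\<lambda>y. \<phi>' (F y)) has_derivative (\<lambda>w. \<phi>2 * (G u \<bullet> w))) (at u)"
    using has_derivative_compose[OF d(1) assms(3)[unfolded has_field_derivative_def]] .
  from has_derivative_scaleR[OF this d(2)]
  have "((\<lambda>y. \<phi>' (F y) *\<^sub>R G y) has_derivative (\<lambda>w. \<phi>' (F u) *\<^sub>R H w + (\<phi>2 * (G u \<bullet> w)) *\<^sub>R G u)) (at u)" .
  ultimately show ?thesis unfolding has_jet_def by blast
qed

lemma has_jet_cong:
  assumes "has_jet F u G H" "\<forall>\<^sub>F y in nhds u. F y = F' y"
  shows "has_jet F' u G H"
proof -
  from assms(2) obtain S where S: "open S" "u \<in> S" "\<And>y. y \<in> S \<Longrightarrow> F y = F' y"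
    by (auto simp: eventually_nhds)
  have "\<forall>\<^sub>F y in nhds u. y \<in> S" using S(1,2) by (rule eventually_nhds_in_open)
  with assms(1)[unfolded has_jet_def, THEN conjunct1]
  have "\<forall>\<^sub>F y in nhds u. (F' has_derivative (\<lambda>w. G y \<bullet> w)) (at y)"
    by (rule eventually_elim2) (rule has_derivative_transform_within_open[OF _ S(1) _ S(3)])
  then show ?thesis using assms(1) unfolding has_jet_def by blast
qed

lemma has_jet_reflect:
  assumes "has_jet F (R u) G H" "bounded_linear R" "\<And>v w. R v \<bullet> w = v \<bullet> R w"
  shows "has_jet (\<lambda>y. F (R y)) u (\<lambda>y. R (G (R y))) (\<lambda>w. R (H (R w)))"
proof -
  have R: "(R has_derivative R) (at y)" for y
    using assms(2) by (rule bounded_linear_imp_has_derivative)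
  have "filterlim R (nhds (R u)) (nhds u)"
    using has_derivative_continuous[OF R] by (simp add: isCont_def tendsto_at_iff_tendsto_nhds)
  from eventually_compose_filterlim[OF assms(1)[unfolded has_jet_def, THEN conjunct1] this]
  have "\<forall>\<^sub>F y in nhds u. (F has_derivative (\<lambda>w. G (R y) \<bullet> w)) (at (R y))" .
  then have "\<forall>\<^sub>F y in nhds u. ((\<lambda>y. F (R y)) has_derivative (\<lambda>w. R (G (R y)) \<bullet> w)) (at y)"
    by (rule eventually_mono) (use has_derivative_compose[OF R] assms(3) in fastforce)
  moreover have "((\<lambda>y. R (G (R y))) has_derivative (\<lambda>w. R (H (R w)))) (at u)"
    using has_derivative_compose[OF has_derivative_compose[OF R has_jetD(2)[OF assms(1)]] R] .
  ultimately show ?thesis unfolding has_jet_def by blast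
qed

lemma has_jet_norm:
  fixes u :: "'a::euclidean_space"
  assumes "u \<noteq> 0"
  shows "has_jet norm u (\<lambda>y. y /\<^sub>R norm y) (\<lambda>w. w /\<^sub>R norm u - ((u \<bullet> w) / norm u ^ 3) *\<^sub>R u)"
proof -
  have N: "(norm has_derivative (\<lambda>w. (y /\<^sub>R norm y) \<bullet> w)) (at y)" if "y \<noteq> 0" for y :: 'a
    using has_derivative_norm[OF that]
    by (rule has_derivative_eq_rhs) (simp add: sgn_div_norm inner_commute)
  have "\<forall>\<^sub>F y in nhds u. y \<noteq> 0"
    using assms by (intro t1_space_nhds)
  then have "\<forall>\<^sub>F y in nhds u. (norm has_derivative (\<lambda>w. (y /\<^sub>R norm y) \<bullet> w)) (at y)"
    by (rule eventually_mono) (rule N)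
  moreover have "((\<lambda>y. y /\<^sub>R norm y) has_derivative (\<lambda>w. w /\<^sub>R norm u - ((u \<bullet> w) / norm u ^ 3) *\<^sub>R u)) (at u)"
    using N[OF assms] assms
    by (auto intro!: derivative_eq_intros simp: power3_eq_cube field_simps)
  ultimately show ?thesis unfolding has_jet_def by blast
qed

lemma has_jet_inner: "has_jet (\<lambda>y. y \<bullet> e) u (\<lambda>y. e) (\<lambda>w. 0)"
  unfolding has_jet_def
  by (auto intro!: always_eventually derivative_eq_intros simp: inner_commute)

lemma has_jet_local_max:
  assumes "has_jet F u G H" "\<forall>\<^sub>F y in nhds u. F y \<le> F u"
  shows "G u = 0" "H w \<bullet> w \<le> 0"
proof -
  note d = has_jetD[OF assms(1)]
  from assms obtain S where S: "open S" "u \<in> S" "\<And>y. y \<in> S \<Longrightarrow> F y \<le> F u"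
    "\<And>y. y \<in> S \<Longrightarrow> (F has_derivative (\<lambda>w. G y \<bullet> w)) (at y)"
    unfolding has_jet_def eventually_nhds by (metis IntE IntI open_Int)
  have "G u \<bullet> G u = 0"
    using differential_zero_maxmin[OF S(2,1) d(1)] S(3) by (metis (no_types, lifting))
  then show G0: "G u = 0" by simp
  show "H w \<bullet> w \<le> 0"
  proof (rule ccontr)
    assume neg: "\<not> H w \<bullet> w \<le> 0"
    define l where "l t = u + t *\<^sub>R w" for t :: real
    have l: "(l has_derivative (\<lambda>t. t *\<^sub>R w)) (at t)" for t
      unfolding l_def by (auto intro!: derivative_eq_intros)
    have "isCont l 0" using has_derivative_continuous[OF l] .
    moreover have "l 0 = u" by (simp add: l_def)
    ultimately have "filterlim l (nhds u) (nhds 0)"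
      using tendsto_at_iff_tendsto_nhds[of l 0] by (simp add: isCont_def)
    from eventually_compose_filterlim[OF eventually_nhds_in_open[OF S(1,2)] this]
    have "\<forall>\<^sub>F t in nhds 0. l t \<in> S" .
    then obtain \<epsilon> where \<epsilon>: "\<epsilon> > 0" "\<And>t. \<bar>t\<bar> < \<epsilon> \<Longrightarrow> l t \<in> S"
      unfolding eventually_nhds_metric dist_real_def by auto
    have "((\<lambda>t. G (l t)) has_derivative (\<lambda>t. H (t *\<^sub>R w))) (at 0)"
      using has_derivative_compose[OF l, of G H 0] d(2) by (simp add: l_def)
    then have "((\<lambda>t. G (l t) \<bullet> w) has_derivative (\<lambda>t. H (t *\<^sub>R w) \<bullet> w)) (at 0)"
      by (intro has_derivative_inner_left)
    then have "((\<lambda>t. G (l t) \<bullet> w) has_real_derivative (H w \<bullet> w)) (at 0)"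
      using d(3) unfolding has_field_derivative_def
      by (auto elim!: has_derivative_eq_rhs simp: linear_simps)
    from DERIV_pos_inc_right[OF this] neg obtain \<delta> where \<delta>: "\<delta> > 0"
      "\<And>t. 0 < t \<Longrightarrow> t < \<delta> \<Longrightarrow> G (l t) \<bullet> w > 0"
      by (auto simp: l_def G0)
    define m where "m = min \<epsilon> \<delta> / 2"
    have m: "0 < m" "m < \<epsilon>" "m < \<delta>" using \<epsilon> \<delta> by (auto simp: m_def)
    have "F (l 0) < F (l m)"
    proof (rule DERIV_pos_imp_increasing_open[OF m(1)])
      fix t assume t: "0 < t" "t < m"
      have "(F has_derivative (\<lambda>v. G (l t) \<bullet> v)) (at (l t))"
        using t m by (intro S \<epsilon>) auto
      from has_derivative_compose[OF l this]
      have "((\<lambda>t. F (l t)) has_real_derivative (G (l t) \<bullet> w)) (at t)"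
        unfolding has_field_derivative_def by (auto elim!: has_derivative_eq_rhs simp: mult.commute)
      then show "\<exists>y. ((\<lambda>t. F (l t)) has_real_derivative y) (at t) \<and> 0 < y"
        using \<delta>(2)[of t] t m by auto
    next
      have "isCont (\<lambda>t. F (l t)) t" if "t \<in> {0..m}" for t
        using that m by (auto intro!: has_derivative_continuous has_derivative_compose[OF l S(4)] \<epsilon>(2))
      then show "continuous_on {0..m} (\<lambda>t. F (l t))"
        by (simp add: continuous_at_imp_continuous_on)
    qed
    moreover have "F (l m) \<le> F u" using \<epsilon>(2)[of m] m S(3) by auto
    ultimately show False by (simp add: l_def)
  qed
qed

section \<open>The Laplacian on second-order expansions\<close>

definition jet_lap :: "real \<Rightarrow> real \<Rightarrow> 'a::euclidean_space \<Rightarrow> 'a \<Rightarrow> ('a \<Rightarrow> 'a) \<Rightarrow> real" where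
  "jet_lap k m u v H = (let x = u /\<^sub>R norm u in
     x \<bullet> H x + (norm u / k)\<^sup>2 * ((\<Sum>b\<in>Basis. H b \<bullet> b) - x \<bullet> H x)
     + real (DIM('a) - 1) * (m / k - norm u / k\<^sup>2) * (x \<bullet> v))"

lemma sum_inner_Basis_mult:
  fixes v w :: "'a::euclidean_space"
  shows "(\<Sum>b\<in>Basis. (v \<bullet> b) * (w \<bullet> b)) = v \<bullet> w" "(\<Sum>b\<in>Basis. (b \<bullet> v) * (w \<bullet> b)) = v \<bullet> w"
    "(\<Sum>b\<in>Basis. (b \<bullet> v) * (b \<bullet> w)) = v \<bullet> w"
  using euclidean_inner[of v w] by (simp_all add: inner_commute)

lemma jet_lap_diff:
  fixes u :: "'a::euclidean_space"
  shows "jet_lap k m u (v - v') (\<lambda>w. H w - H' w) = jet_lap k m u v H - jet_lap k m u v' H'"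
proof -
  define d where "d = real (DIM('a) - 1)"
  show ?thesis
    unfolding jet_lap_def Let_def d_def[symmetric] inner_diff_left inner_diff_right sum_subtractf
    by (simp add: algebra_simps)
qed

lemma jet_lap_cmult: "jet_lap k m u (c *\<^sub>R v) (\<lambda>w. c *\<^sub>R H w) = c * jet_lap k m u v H"
  by (simp add: jet_lap_def Let_def sum_distrib_left[symmetric] algebra_simps)

lemma jet_lap_mult:
  assumes "u \<noteq> 0"
  shows "jet_lap k m u (f *\<^sub>R v' + f' *\<^sub>R v)
      (\<lambda>w. f *\<^sub>R H' w + (v \<bullet> w) *\<^sub>R v' + (f' *\<^sub>R H w + (v' \<bullet> w) *\<^sub>R v)) =
    f * jet_lap k m u v' H' + f' * jet_lap k m u v H +
    2 * ((u \<bullet> v) * (u \<bullet> v') / (norm u)\<^sup>2 + (norm u / k)\<^sup>2 * (v \<bullet> v' - (u \<bullet> v) * (u \<bullet> v') / (norm u)\<^sup>2))"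
proof -
  have "(\<Sum>b\<in>Basis. (v \<bullet> b) * (v' \<bullet> b)) = v \<bullet> v'" "(\<Sum>b\<in>Basis. (v' \<bullet> b) * (v \<bullet> b)) = v \<bullet> v'"
    by (simp_all add: euclidean_inner[of v v'] mult.commute)
  then show ?thesis using assms
    by (simp add: jet_lap_def Let_def inner_add_left inner_add_right sum.distrib sum_distrib_left[symmetric]
        inner_commute divide_simps power2_eq_square) (simp add: algebra_simps)
qed

lemma jet_lap_compose:
  assumes "u \<noteq> 0"
  shows "jet_lap k m u (c *\<^sub>R v) (\<lambda>w. c *\<^sub>R H w + (d * (v \<bullet> w)) *\<^sub>R v) =
    c * jet_lap k m u v H +
    d * ((u \<bullet> v)\<^sup>2 / (norm u)\<^sup>2 + (norm u / k)\<^sup>2 * (v \<bullet> v - (u \<bullet> v)\<^sup>2 / (norm u)\<^sup>2))"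
proof -
  have "(\<Sum>b\<in>Basis. d * (v \<bullet> b) * (v \<bullet> b)) = d * (v \<bullet> v)"
    by (simp add: euclidean_inner[of v v] sum_distrib_left mult.assoc)
  then show ?thesis using assms
    by (simp add: jet_lap_def Let_def inner_add_left inner_add_right sum.distrib sum_distrib_left[symmetric]
        inner_commute divide_simps power2_eq_square) (simp add: algebra_simps)
qed

lemma trace_reflection:
  fixes H :: "'a::euclidean_space \<Rightarrow> 'a"
  assumes "bounded_linear H" "norm e = 1" "R = (\<lambda>v. v - (2 * (v \<bullet> e)) *\<^sub>R e)"
  shows "(\<Sum>b\<in>Basis. R (H (R b)) \<bullet> b) = (\<Sum>b\<in>Basis. H b \<bullet> b)"
proof -
  interpret bounded_linear H by fact
  have e: "e \<bullet> e = 1" using assms(2) by (simp add: norm_eq_1)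
  have 1: "R (H (R b)) \<bullet> b = H b \<bullet> b - 2 * ((b \<bullet> e) * (H e \<bullet> b))
      - 2 * ((H b \<bullet> e) * (e \<bullet> b)) + 4 * (H e \<bullet> e) * ((b \<bullet> e) * (e \<bullet> b))" for b
    by (simp add: assms(3) diff scaleR inner_diff_left inner_diff_right algebra_simps)
  have "(\<Sum>b\<in>Basis. (b \<bullet> e) * (H e \<bullet> b)) = H e \<bullet> e"
    using sum_inner_Basis_mult(2)[of e "H e"] by (simp add: inner_commute)
  moreover have "(\<Sum>b\<in>Basis. (b \<bullet> e) * (e \<bullet> b)) = 1"
    using e by (simp add: euclidean_inner[of e e] mult.commute inner_commute)
  moreover have "(\<Sum>b\<in>Basis. (H b \<bullet> e) * (e \<bullet> b)) = H e \<bullet> e"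
  proof -
    have "H e = H (\<Sum>b\<in>Basis. (e \<bullet> b) *\<^sub>R b)" by (simp add: euclidean_representation)
    also have "\<dots> = (\<Sum>b\<in>Basis. (e \<bullet> b) *\<^sub>R H b)" by (simp add: sum scaleR)
    finally show ?thesis by (simp add: inner_sum_left mult.commute)
  qed
  ultimately show ?thesis
    unfolding 1 by (simp add: sum.distrib sum_subtractf sum_distrib_left[symmetric])
qed

lemma jet_lap_reflect:
  fixes u :: "'a::euclidean_space"
  assumes "bounded_linear H" "norm e = 1" "R = (\<lambda>v. v - (2 * (v \<bullet> e)) *\<^sub>R e)"
  shows "jet_lap k m u (R v) (\<lambda>w. R (H (R w))) = jet_lap k m (R u) v H"
proof -
  have e: "e \<bullet> e = 1" using assms(2) by (simp add: norm_eq_1)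
  have sa: "a \<bullet> R b = R a \<bullet> b" for a b
    by (simp add: assms(3) inner_diff_left inner_diff_right inner_commute)
  have "R a \<bullet> R a = a \<bullet> a" for a
    using e by (simp add: assms(3) inner_diff_left inner_diff_right inner_commute algebra_simps)
  then have "norm (R u) = norm u" by (simp add: norm_eq_sqrt_inner)
  moreover have "R (c *\<^sub>R a) = c *\<^sub>R R a" for c a
    by (simp add: assms(3) algebra_simps)
  ultimately show ?thesis
    by (simp add: jet_lap_def Let_def trace_reflection[OF assms] sa)
qed

lemma jet_lap_nonpos:
  fixes u :: "'a::euclidean_space"
  assumes "bounded_linear H" "u \<noteq> 0" "\<And>w. H w \<bullet> w \<le> 0"
  shows "jet_lap k m u 0 H \<le> 0"
proof -
  interpret bounded_linear H by fact
  define x where "x = u /\<^sub>R norm u"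
  have "norm x = 1" using assms(2) by (simp add: x_def)
  then have x: "x \<bullet> x = 1" by (simp add: norm_eq_1)
  have 1: "H (b - (b \<bullet> x) *\<^sub>R x) \<bullet> (b - (b \<bullet> x) *\<^sub>R x) = H b \<bullet> b - (H b \<bullet> x) * (x \<bullet> b)
      - (b \<bullet> x) * (H x \<bullet> b) + (H x \<bullet> x) * ((b \<bullet> x) * (x \<bullet> b))" for b
    by (simp add: diff scaleR inner_diff_left inner_diff_right algebra_simps inner_commute)
  have "(\<Sum>b\<in>Basis. (b \<bullet> x) * (H x \<bullet> b)) = H x \<bullet> x"
    using sum_inner_Basis_mult(2)[of x "H x"] by (simp add: inner_commute)
  moreover have "(\<Sum>b\<in>Basis. (b \<bullet> x) * (x \<bullet> b)) = 1"
    using x by (simp add: euclidean_inner[of x x] mult.commute inner_commute)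
  moreover have "(\<Sum>b\<in>Basis. (H b \<bullet> x) * (x \<bullet> b)) = H x \<bullet> x"
  proof -
    have "H x = H (\<Sum>b\<in>Basis. (x \<bullet> b) *\<^sub>R b)" by (simp add: euclidean_representation)
    also have "\<dots> = (\<Sum>b\<in>Basis. (x \<bullet> b) *\<^sub>R H b)" by (simp add: sum scaleR)
    finally show ?thesis by (simp add: inner_sum_left mult.commute)
  qed
  ultimately have "(\<Sum>b\<in>Basis. H b \<bullet> b) - H x \<bullet> x = (\<Sum>b\<in>Basis. H (b - (b \<bullet> x) *\<^sub>R x) \<bullet> (b - (b \<bullet> x) *\<^sub>R x))"
    unfolding 1 by (simp add: sum.distrib sum_subtractf sum_distrib_left[symmetric])
  also have "\<dots> \<le> 0" by (intro sum_nonpos assms(3))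
  finally have "(\<Sum>b\<in>Basis. H b \<bullet> b) - H x \<bullet> x \<le> 0" .
  then show ?thesis
    using assms(3)[of x] unfolding jet_lap_def Let_def x_def[symmetric]
    by (simp add: inner_commute add_nonpos_nonpos mult_nonneg_nonpos)
qed

lemma jet_lap_norm:
  fixes u :: "'a::euclidean_space"
  assumes "u \<noteq> 0" "k \<noteq> 0"
  shows "jet_lap k m u (u /\<^sub>R norm u) (\<lambda>w. w /\<^sub>R norm u - ((u \<bullet> w) / norm u ^ 3) *\<^sub>R u) = real (DIM('a) - 1) * m / k"
proof -
  have u: "u \<bullet> u = (norm u)\<^sup>2" by (simp add: power2_norm_eq_inner)
  have B: "b \<bullet> b = 1" if "b \<in> Basis" for b :: 'a using that by simp
  have "(\<Sum>b\<in>Basis. (b /\<^sub>R norm u - ((u \<bullet> b) / norm u ^ 3) *\<^sub>R u) \<bullet> b) =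
     (\<Sum>b\<in>(Basis::'a set). 1 / norm u) - (\<Sum>b\<in>Basis. (u \<bullet> b) * (u \<bullet> b)) / norm u ^ 3"
    by (simp add: inner_diff_left sum_subtractf sum_distrib_left B divide_inverse mult_ac)
  also have "\<dots> = real (DIM('a) - 1) / norm u"
    using assms(1) u by (simp add: euclidean_inner[symmetric] field_simps power2_eq_square power3_eq_cube of_nat_diff Suc_leI)
  finally show ?thesis using assms u
    by (simp add: jet_lap_def Let_def inner_diff_right inner_diff_left)
      (simp add: field_simps power2_eq_square power3_eq_cube)
qed

lemma jet_angle:
  fixes u e :: "'a::euclidean_space"
  assumes u0: "u \<noteq> 0"
  defines "\<rho> \<equiv> norm u"
  obtains G H where "has_jet (\<lambda>y. (y \<bullet> e) / norm y) u G H"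
    and "G u = e /\<^sub>R \<rho> - ((u \<bullet> e) / \<rho>^3) *\<^sub>R u"
    and "\<And>k m. k \<noteq> 0 \<Longrightarrow> jet_lap k m u (G u) H = - (real (DIM('a) - 1) * ((u \<bullet> e) / \<rho>) / k\<^sup>2)"
proof -
  have \<rho>: "\<rho> > 0" "\<rho> \<noteq> 0" using assms by auto
  have u: "u \<bullet> u = \<rho>\<^sup>2" by (simp add: power2_norm_eq_inner \<rho>_def)
  have inv: "\<forall>\<^sub>F t in nhds (norm u). (inverse has_real_derivative - (inverse t ^ 2)) (at t)"
  proof -
    have "\<forall>\<^sub>F t in nhds (norm u). t \<noteq> 0" using assms by (intro t1_space_nhds) auto
    then show ?thesis by (rule eventually_mono) (use DERIV_inverse in \<open>force simp: numeral_2_eq_2\<close>)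
  qed
  have inv2: "((\<lambda>t. - (inverse t ^ 2)) has_real_derivative 2 / \<rho>^3) (at (norm u))"
    using \<rho> unfolding \<rho>_def
    by (auto intro!: derivative_eq_intros simp: field_simps eval_nat_numeral)
  note j1 = has_jet_compose[OF has_jet_norm[OF u0] inv inv2]
  note j = has_jet_mult[OF has_jet_inner[of e] j1]
  show thesis
  proof (rule that[OF has_jet_cong[OF j]], goal_cases)
    case 1
    show ?case by (simp add: divide_inverse)
  next
    case 2
    show ?case using \<rho> by (simp add: \<rho>_def[symmetric] field_simps eval_nat_numeral)
  next
    case k: (3 k m)
    have 0: "jet_lap k m u e (\<lambda>w. 0) = real (DIM('a) - 1) * (m / k - \<rho> / k\<^sup>2) * (u \<bullet> e) / \<rho>"
      by (simp add: jet_lap_def Let_def \<rho>_def[symmetric] divide_inverse mult_ac)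
    show ?case
      unfolding jet_lap_mult[OF u0] jet_lap_compose[OF u0] jet_lap_norm[OF u0 k] 0
      using \<rho> k unfolding \<rho>_def[symmetric]
      by (simp add: u inner_commute) (simp add: field_simps eval_nat_numeral)
  qed
qed

lemma jet_separated:
  fixes u e :: "'a::euclidean_space" and a a' \<psi> \<psi>' :: "real \<Rightarrow> real"
  assumes u0: "u \<noteq> 0"
    and a: "\<forall>\<^sub>F r in nhds (norm u - 1). (a has_real_derivative a' r) (at r)"
      "(a' has_real_derivative a2) (at (norm u - 1))"
    and \<psi>: "\<And>s. (\<psi> has_real_derivative \<psi>' s) (at s)"
      "\<And>s. (\<psi>' has_real_derivative \<psi>2 s) (at s)"
  defines "r \<equiv> norm u - 1" and "s \<equiv> (u \<bullet> e) / norm u"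
  obtains G H where "has_jet (\<lambda>y. a (norm y - 1) * \<psi> ((y \<bullet> e) / norm y)) u G H"
    and "\<And>k m. k \<noteq> 0 \<Longrightarrow> jet_lap k m u (G u) H =
       \<psi> s * (a2 + real (DIM('a) - 1) * m / k * a' r)
       + a r / k\<^sup>2 * ((e \<bullet> e - s\<^sup>2) * \<psi>2 s - real (DIM('a) - 1) * s * \<psi>' s)"
proof -
  define \<rho> where "\<rho> = norm u"
  have \<rho>: "\<rho> > 0" "\<rho> \<noteq> 0" using assms by (auto simp: \<rho>_def)
  have u: "u \<bullet> u = \<rho>\<^sup>2" by (simp add: power2_norm_eq_inner \<rho>_def)
  have a1: "\<forall>\<^sub>F t in nhds (norm u). ((\<lambda>t. a (t - 1)) has_real_derivative a' (t - 1)) (at t)"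
  proof -
    have "filterlim (\<lambda>t. t - 1 :: real) (nhds (norm u - 1)) (nhds (norm u))"
      by (intro tendsto_intros filterlim_ident)
    from eventually_compose_filterlim[OF a(1) this] show ?thesis
    proof (rule eventually_mono)
      fix t assume a: "(a has_real_derivative a' (t - 1)) (at (t - 1))"
      have "((\<lambda>t. t - 1) has_real_derivative 1) (at t)" by (auto intro!: derivative_eq_intros)
      from DERIV_chain2[of a _ "\<lambda>t. t - 1", OF a this]
      show "((\<lambda>t. a (t - 1)) has_real_derivative a' (t - 1)) (at t)" by simp
    qed
  qed
  have a2: "((\<lambda>t. a' (t - 1)) has_real_derivative a2) (at (norm u))"
  proof -
    have "((\<lambda>t. t - 1) has_real_derivative 1) (at (norm u))" by (auto intro!: derivative_eq_intros)
    from DERIV_chain2[of a' _ "\<lambda>t. t - 1", OF a(2) this] show ?thesis by simp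
  qed
  note j1 = has_jet_compose[OF has_jet_norm[OF u0] a1 a2]
  obtain G H where j: "has_jet (\<lambda>y. (y \<bullet> e) / norm y) u G H"
    and Gu: "G u = e /\<^sub>R \<rho> - ((u \<bullet> e) / \<rho>^3) *\<^sub>R u"
    and lH: "\<And>k m. k \<noteq> 0 \<Longrightarrow> jet_lap k m u (G u) H = - (real (DIM('a) - 1) * ((u \<bullet> e) / \<rho>) / k\<^sup>2)"
    using jet_angle[OF u0, of e] unfolding \<rho>_def by blast
  have j2: "has_jet (\<lambda>y. \<psi> ((y \<bullet> e) / norm y)) u (\<lambda>y. \<psi>' ((y \<bullet> e) / norm y) *\<^sub>R G y)
     (\<lambda>w. \<psi>' ((u \<bullet> e) / norm u) *\<^sub>R H w + (\<psi>2 s * (G u \<bullet> w)) *\<^sub>R G u)"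
    using has_jet_compose[OF j, of \<psi> \<psi>' "\<psi>2 s"] \<psi> by (simp add: s_def)
  have uG: "u \<bullet> G u = 0" and GG: "G u \<bullet> G u = (e \<bullet> e - s\<^sup>2) / \<rho>\<^sup>2"
    using \<rho> unfolding Gu
    by (simp_all add: s_def \<rho>_def[symmetric] inner_diff_right inner_diff_left inner_commute u field_simps eval_nat_numeral)
  show thesis
  proof (rule that[OF has_jet_mult[OF j1 j2]], goal_cases)
    case k: (1 k m)
    show ?case
    proof -
      have 1: "u \<bullet> (u /\<^sub>R norm u) = \<rho>" "(u /\<^sub>R norm u) \<bullet> (u /\<^sub>R norm u) = 1"
        "(u /\<^sub>R norm u) \<bullet> G u = 0"
        using \<rho> by (simp_all add: u uG \<rho>_def[symmetric] power2_eq_square field_simps)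
      have 2: "(u \<bullet> e) / \<rho> = s" by (simp add: s_def \<rho>_def)
      define d where "d = real (DIM('a) - 1)"
      show ?thesis
        unfolding jet_lap_mult[OF u0] jet_lap_compose[OF u0]
        unfolding jet_lap_norm[OF u0 k] lH[OF k]
          inner_scaleR_right inner_scaleR_left 1 uG GG
        unfolding \<rho>_def[symmetric] 2 r_def d_def[symmetric]
        using \<rho> k by (simp add: u power_divide power_inverse)
          (simp add: field_simps power2_eq_square)
    qed
  qed
qed

section \<open>Polar coordinates\<close>

lemma has_derivative_polar:
  fixes y :: "real^'n::finite"
  assumes "y \<noteq> 0"
  shows "(polar has_derivative (\<lambda>w. ((y \<bullet> w) / norm y, w /\<^sub>R norm y - ((y \<bullet> w) / norm y ^ 3) *\<^sub>R y))) (at y)"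
proof -
  note j = has_jet_norm[OF assms]
  have "((\<lambda>y. norm y - 1) has_derivative (\<lambda>w. (y \<bullet> w) / norm y)) (at y)"
    using has_jetD(1)[OF j] by (auto intro!: derivative_eq_intros simp: field_simps)
  from has_derivative_Pair[OF this has_jetD(2)[OF j]] show ?thesis
    unfolding polar_def .
qed

lemma ex_jet_polar:
  fixes f :: "'n::finite point \<Rightarrow> real" and u :: "real^'n"
  assumes "Ck_on (Suc (Suc 0)) U f" "open U" "polar u \<in> U" "u \<noteq> 0"
  obtains G H where "has_jet (f \<circ> polar) u G H"
proof -
  define D where "D y = frechet_derivative f (at (polar y))" for y
  define P where "P b y = (fst b / norm y) *\<^sub>R y + snd b /\<^sub>R norm y - ((y \<bullet> snd b) / norm y ^ 3) *\<^sub>R y"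
    for b :: "'n point" and y
  define G where "G y = (\<Sum>b\<in>Basis. D y b *\<^sub>R P b y)" for y
  have f1: "(f has_derivative frechet_derivative f (at x)) (at x)" if "x \<in> U" for x
    using assms(1) that by (auto simp: frechet_derivative_works)
  have P: "P b y \<bullet> w = b \<bullet> ((y \<bullet> w) / norm y, w /\<^sub>R norm y - ((y \<bullet> w) / norm y ^ 3) *\<^sub>R y)" for b y w
    by (cases b) (simp add: P_def inner_add_left inner_diff_left inner_diff_right inner_add_right inner_commute)
  have "isCont polar u"
    using has_derivative_continuous[OF has_derivative_polar[OF assms(4)]] .
  then have "filterlim polar (nhds (polar u)) (nhds u)"
    using tendsto_at_iff_tendsto_nhds[of polar u] by (simp add: isCont_def)
  from eventually_compose_filterlim[OF eventually_nhds_in_open[OF assms(2,3)] this]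
  have ev1: "\<forall>\<^sub>F y in nhds u. polar y \<in> U" .
  have ev2: "\<forall>\<^sub>F y in nhds u. y \<noteq> 0"
    using assms by (intro t1_space_nhds) auto
  have "\<forall>\<^sub>F y in nhds u. ((f \<circ> polar) has_derivative (\<lambda>w. G y \<bullet> w)) (at y)"
    using ev1 ev2
  proof (rule eventually_elim2)
    fix y :: "real^'n" assume y: "polar y \<in> U" "y \<noteq> 0"
    have "((f \<circ> polar) has_derivative (\<lambda>w. D y ((y \<bullet> w) / norm y, w /\<^sub>R norm y - ((y \<bullet> w) / norm y ^ 3) *\<^sub>R y))) (at y)"
      unfolding D_def comp_def
      using has_derivative_compose[OF has_derivative_polar[OF y(2)] f1[OF y(1)]] .
    moreover have 1: "D y z = (\<Sum>b\<in>Basis. D y b * (b \<bullet> z))" for z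
    proof -
      interpret bounded_linear "D y" using has_derivative_bounded_linear[OF f1[OF y(1)]] by (simp add: D_def)
      have "D y z = D y (\<Sum>b\<in>Basis. (z \<bullet> b) *\<^sub>R b)" by (simp only: euclidean_representation)
      then show ?thesis by (simp only: sum scaleR) (simp add: mult.commute inner_commute)
    qed
    have "G y \<bullet> w = D y ((y \<bullet> w) / norm y, w /\<^sub>R norm y - ((y \<bullet> w) / norm y ^ 3) *\<^sub>R y)" for w
      unfolding G_def inner_sum_left inner_scaleR_left P by (rule 1[symmetric])
    ultimately show "((f \<circ> polar) has_derivative (\<lambda>w. G y \<bullet> w)) (at y)" by simp
  qed
  moreover have "G differentiable (at u)"
    unfolding G_def
  proof (intro differentiable_sum finite_Basis ballI)
    fix b :: "'n point" assume b: "b \<in> Basis"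
    have "(\<lambda>x. frechet_derivative f (at x) b) differentiable (at (polar u))"
      using assms(1,3) b by auto
    then have "((\<lambda>x. frechet_derivative f (at x) b) \<circ> polar) differentiable (at u)"
      using has_derivative_polar[OF assms(4)] by (intro differentiable_chain_at) (auto simp: differentiable_def)
    then have D: "(\<lambda>y. D y b) differentiable (at u)" by (simp add: D_def comp_def)
    have N: "norm differentiable (at u)" using has_jetD(1)[OF has_jet_norm[OF assms(4)]] by (auto simp: differentiable_def)
    have "P b differentiable (at u)"
      unfolding P_def[abs_def] divide_inverse
      by (intro differentiable_add differentiable_diff differentiable_scaleR differentiable_mult
          differentiable_inverse differentiable_power N differentiable_const differentiable_ident
          differentiable_inner) (use assms(4) in auto)
    with D show "(\<lambda>y. D y b *\<^sub>R P b y) differentiable (at u)"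
      by (rule differentiable_scaleR)
  qed
  then obtain H where "(G has_derivative H) (at u)" by (auto simp: differentiable_def)
  ultimately show thesis using that unfolding has_jet_def by blast
qed

lemma
  fixes x :: "real^'n::finite"
  assumes "norm x = 1"
  defines "M \<kappa> \<equiv> (\<chi> i j. \<kappa> * (if i = j then 1 else 0) + (1 - \<kappa>) * (x $ i * x $ j)) :: real^'n^'n"
  shows det_id_plus_rank_one: "det (M \<kappa>) = \<kappa> ^ (CARD('n) - 1)"
    and matrix_inv_id_plus_rank_one: "\<kappa> \<noteq> 0 \<Longrightarrow> matrix_inv (M \<kappa>) = M (1 / \<kappa>)"
proof -
  fix k :: 'n
  obtain Q :: "real^'n^'n" where Q: "orthogonal_matrix Q" "Q *v axis k 1 = x"
    using orthogonal_matrix_exists_basis[OF assms(1)] by blast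
  have Qk: "Q $ i $ k = x $ i" for i
    using Q(2) by (metis column_def matrix_vector_mult_basis vec_lambda_beta)
  have QQ: "(\<Sum>l\<in>UNIV. Q $ i $ l * Q $ j $ l) = (if i = j then 1 else 0)" for i j
    using Q(1) unfolding orthogonal_matrix_def matrix_matrix_mult_def transpose_def mat_def
    by (simp add: vec_eq_iff)
  define D :: "real^'n^'n" where "D = (\<chi> i j. if i = j then if i = k then 1 else \<kappa> else 0)"
  have "M \<kappa> = Q ** D ** transpose Q"
  proof -
    have 1: "(Q ** D) $ i $ l = Q $ i $ l * (\<kappa> + (if l = k then 1 - \<kappa> else 0))" for i l
      by (simp add: matrix_matrix_mult_def D_def if_distrib cong: if_cong)
    have "(Q ** D ** transpose Q) $ i $ j = \<kappa> * (\<Sum>l\<in>UNIV. Q $ i $ l * Q $ j $ l)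
       + (\<Sum>l\<in>UNIV. if l = k then (1 - \<kappa>) * (Q $ i $ l * Q $ j $ l) else 0)" for i j
      unfolding matrix_matrix_mult_def[of "Q ** D"] sum_distrib_left sum.distrib[symmetric]
      by (simp add: 1 transpose_def) (auto intro!: sum.cong simp: algebra_simps)
    then show ?thesis by (simp add: vec_eq_iff QQ Qk M_def)
  qed
  then have "det (M \<kappa>) = (det Q)\<^sup>2 * det D"
    by (simp add: det_mul power2_eq_square)
  also have "(det Q)\<^sup>2 = 1" using det_orthogonal_matrix[OF Q(1)] by auto
  also have "det D = (\<Prod>i\<in>UNIV. if i = k then 1 else \<kappa>)"
    by (subst det_diagonal) (auto simp: D_def)
  also have "\<dots> = \<kappa> ^ (CARD('n) - 1)"
    by (subst prod.remove[of _ k]) (auto simp: card_Diff_singleton)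
  finally show "det (M \<kappa>) = \<kappa> ^ (CARD('n) - 1)" by simp
  have xx: "(\<Sum>l\<in>UNIV. x $ l * x $ l) = 1"
    using assms(1) by (simp add: norm_eq_1 inner_vec_def)
  have MM: "M a ** M b = mat 1" if "a * b = 1" for a b
  proof -
    have "(M a ** M b) $ i $ j = (if i = j then 1 else 0)" for i j
    proof -
      have "(M a ** M b) $ i $ j = (\<Sum>l\<in>UNIV. if l = i then a * b * (if i = j then 1 else 0) + a * (1 - b) * (x $ i * x $ j) else 0)
         + (\<Sum>l\<in>UNIV. if l = j then (1 - a) * b * (x $ i * x $ j) else 0)
         + (1 - a) * (1 - b) * (x $ i * x $ j) * (\<Sum>l\<in>UNIV. x $ l * x $ l)"
        unfolding matrix_matrix_mult_def sum_distrib_left sum.distrib[symmetric]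
        by (auto intro!: sum.cong simp: M_def algebra_simps)
      also have "\<dots> = a * b * (if i = j then 1 else 0) + (a * (1 - b) + (1 - a) * b + (1 - a) * (1 - b)) * (x $ i * x $ j)"
        by (simp add: xx algebra_simps)
      also have "a * (1 - b) + (1 - a) * b + (1 - a) * (1 - b) = 0"
        using that by (simp add: algebra_simps)
      finally show ?thesis using that by simp
    qed
    then show ?thesis by (simp add: vec_eq_iff mat_def)
  qed
  show "matrix_inv (M \<kappa>) = M (1 / \<kappa>)" if "\<kappa> \<noteq> 0"
  proof -
    have *: "M \<kappa> ** M (1 / \<kappa>) = mat 1" "M (1 / \<kappa>) ** M \<kappa> = mat 1" using that by (auto intro: MM)
    show ?thesis unfolding matrix_inv_def
    proof (rule some_equality)
      fix B assume "M \<kappa> ** B = mat 1 \<and> B ** M \<kappa> = mat 1"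
      then show "B = M (1 / \<kappa>)"
        using * by (metis matrix_mul_assoc matrix_mul_lid matrix_mul_rid)
    qed (use * in auto)
  qed
qed

lemma sum_Basis_vec: "(\<Sum>b\<in>(Basis :: (real^'n::finite) set). f b) = (\<Sum>i\<in>UNIV. f (axis i 1))"
proof -
  have B: "(Basis :: (real^'n) set) = range (\<lambda>i. axis i 1)" by (auto simp: Basis_vec_def)
  have "inj (\<lambda>i::'n. axis i (1::real))" by (auto simp: inj_on_def axis_eq_axis)
  from sum.reindex[OF this, of f] show ?thesis unfolding B by (simp add: comp_def)
qed

lemma sum_trace_rank_one:
  fixes G :: "'a::euclidean_space"
  assumes "bounded_linear H"
  shows "(\<Sum>b\<in>Basis. (\<beta> *\<^sub>R H b + (c1 * (u \<bullet> b)) *\<^sub>R G + ((\<gamma> * (b \<bullet> G + u \<bullet> H b) + c2 * (u \<bullet> b)) *\<^sub>R u + c3 *\<^sub>R b)) \<bullet> b)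
    = \<beta> * (\<Sum>b\<in>Basis. H b \<bullet> b) + c1 * (u \<bullet> G) + \<gamma> * (u \<bullet> G + u \<bullet> H u) + c2 * (u \<bullet> u) + c3 * real DIM('a)"
proof -
  interpret bounded_linear H by fact
  have "(\<Sum>b\<in>Basis. (u \<bullet> b) * (u \<bullet> H b)) = u \<bullet> H u"
  proof -
    have "H u = H (\<Sum>b\<in>Basis. (u \<bullet> b) *\<^sub>R b)" by (simp only: euclidean_representation)
    also have "\<dots> = (\<Sum>b\<in>Basis. (u \<bullet> b) *\<^sub>R H b)" by (simp add: sum scaleR)
    finally show ?thesis by (simp add: inner_sum_right)
  qed
  then have 1: "(\<Sum>b\<in>Basis. (u \<bullet> b) * (u \<bullet> H b)) = u \<bullet> H u" .
  have 2: "(\<Sum>b\<in>Basis. (\<beta> *\<^sub>R H b + (c1 * (u \<bullet> b)) *\<^sub>R G + ((\<gamma> * (b \<bullet> G + u \<bullet> H b) + c2 * (u \<bullet> b)) *\<^sub>R u + c3 *\<^sub>R b)) \<bullet> b)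
    = (\<Sum>b\<in>Basis. \<beta> * (H b \<bullet> b) + c1 * ((u \<bullet> b) * (G \<bullet> b)) + \<gamma> * ((b \<bullet> G) * (u \<bullet> b))
       + \<gamma> * ((u \<bullet> b) * (u \<bullet> H b)) + c2 * ((u \<bullet> b) * (u \<bullet> b)) + c3)"
    by (intro sum.cong refl) (simp add: inner_add_left algebra_simps)
  have 3: "(\<Sum>b\<in>Basis. (b \<bullet> G) * (u \<bullet> b)) = u \<bullet> G"
    using sum_inner_Basis_mult(2)[of G u] by (simp only: inner_commute)
  show ?thesis
    unfolding 2 sum.distrib sum_distrib_left[symmetric] 1 3 sum_inner_Basis_mult(1)
    by (simp add: distrib_left)
qed

text \<open>With \<open>\<alpha> = (h/\<rho>)\<^sup>n\<^sup>-\<^sup>1\<close> and \<open>\<beta> = (h/\<rho>)\<^sup>n\<^sup>-\<^sup>3\<close>, the vector field whose divergence is taken is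
  \<open>\<beta> \<nabla>F + (\<alpha> - \<beta>) \<rho>\<^sup>-\<^sup>2 (v \<bullet> \<nabla>F) v\<close>.\<close>

lemma laplace_beltrami_polar:
  fixes g :: "'n::finite form_field" and u :: "real^'n"
  assumes n: "CARD('n) \<ge> 3"
    and g: "\<And>x v w. x \<in> cyl L \<Longrightarrow> v \<in> tangent_cyl x \<Longrightarrow> w \<in> tangent_cyl x \<Longrightarrow>
       g x v w = fst v * fst w + (h (fst x))\<^sup>2 * (snd v \<bullet> snd w)"
    and hpos: "\<And>r. r \<in> {0..L} \<Longrightarrow> h r > 0"
    and u: "1 < norm u" "norm u < 1 + L"
    and h': "(h has_real_derivative m) (at (norm u - 1))"
    and jet: "has_jet (f \<circ> polar) u G H"
  shows "laplace_beltrami g polar f u = jet_lap (h (norm u - 1)) m u (G u) H"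
proof -
  define q where "q t = h (t - 1) / t" for t
  define \<beta> where "\<beta> t = q t ^ (CARD('n) - 3)" for t
  define \<alpha> where "\<alpha> t = q t ^ (CARD('n) - 1)" for t
  define \<gamma> where "\<gamma> t = (\<alpha> t - \<beta> t) / t\<^sup>2" for t
  define V where "V v = \<beta> (norm v) *\<^sub>R G v + (\<gamma> (norm v) * (v \<bullet> G v)) *\<^sub>R v" for v
  have Suc2: "CARD('n) - 1 = Suc (Suc (CARD('n) - 3))" using n by simp
  have \<alpha>\<beta>: "\<alpha> t = \<beta> t * (q t)\<^sup>2" for t
    unfolding \<alpha>_def \<beta>_def Suc2 by (simp add: power2_eq_square mult_ac)
  define S where "S = {v :: real^'n. 1 < norm v \<and> norm v < 1 + L}"
  have "S = (ball 0 (1 + L) - cball 0 1)" by (auto simp: S_def)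
  then have S: "open S" by (simp add: open_Diff)
  have dpol: "partial_deriv i polar v = (v $ i / norm v, axis i 1 /\<^sub>R norm v - (v $ i / norm v ^ 3) *\<^sub>R v)"
    if "v \<in> S" for i v
  proof -
    have "v \<noteq> 0" using that by (auto simp: S_def)
    from frechet_derivative_at[OF has_derivative_polar[OF this], symmetric]
    show ?thesis by (simp add: partial_deriv_def inner_axis)
  qed
  have x1: "norm (v /\<^sub>R norm v) = 1" if "v \<in> S" for v
  proof -
    have "norm v \<noteq> 0" using that by (auto simp: S_def)
    then show ?thesis by simp
  qed
  have gram: "gram_matrix g polar v = (\<chi> i j. (q (norm v))\<^sup>2 * (if i = j then 1 else 0)
      + (1 - (q (norm v))\<^sup>2) * ((v /\<^sub>R norm v) $ i * (v /\<^sub>R norm v) $ j))"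
    if v: "v \<in> S" for v
  proof -
    have \<rho>: "norm v > 0" "norm v \<noteq> 0" using v by (auto simp: S_def)
    have vv: "v \<bullet> v = (norm v)\<^sup>2" by (simp add: power2_norm_eq_inner)
    have c: "polar v \<in> cyl L" using v x1[OF v] by (auto simp: S_def polar_def cyl_def)
    have t: "partial_deriv i polar v \<in> tangent_cyl (polar v)" for i
      using \<rho> unfolding dpol[OF v] tangent_cyl_def polar_def
      by (simp add: inner_diff_left inner_axis' vv field_simps eval_nat_numeral)
    have "gram_matrix g polar v $ i $ j = (v $ i / norm v) * (v $ j / norm v) + (h (norm v - 1))\<^sup>2 *
        ((if i = j then 1 else 0) / (norm v)\<^sup>2 - v $ i * v $ j / norm v ^ 4)" for i j
    proof -
      have "(axis i 1 /\<^sub>R norm v - (v $ i / norm v ^ 3) *\<^sub>R v) \<bullet> (axis j 1 /\<^sub>R norm v - (v $ j / norm v ^ 3) *\<^sub>R v)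
         = (if i = j then 1 else 0) / (norm v)\<^sup>2 - v $ i * v $ j / norm v ^ 4"
      proof -
        have "axis i 1 \<bullet> v = v $ i" "v \<bullet> axis j 1 = v $ j"
          "axis i 1 \<bullet> (axis j 1 :: real^'n) = (if i = j then 1 else 0)"
          by (simp_all add: inner_axis inner_commute[of _ v]) (simp add: axis_def)
        then show ?thesis
          using \<rho> unfolding inner_diff_left inner_diff_right inner_scaleR_left inner_scaleR_right vv
          by (simp add: field_simps eval_nat_numeral)
      qed
      note ip = this
      have "fst (polar v) = norm v - 1" by (simp add: polar_def)
      then show ?thesis
        unfolding gram_matrix_def vec_lambda_beta g[OF c t t] unfolding dpol[OF v] fst_conv snd_conv ip
        by simp
    qed
    moreover have "a / t * (b / t) + k\<^sup>2 * (d / t\<^sup>2 - a * b / t ^ 4)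
       = (k / t)\<^sup>2 * d + (1 - (k / t)\<^sup>2) * (inverse t * a * (inverse t * b))" if "t \<noteq> 0" for a b k d t :: real
      using that by (simp add: field_simps eval_nat_numeral)
    ultimately show ?thesis
      using \<rho> unfolding vec_eq_iff q_def vector_scaleR_component by simp
  qed
  have q0: "q (norm v) > 0" if "v \<in> S" for v
  proof -
    have "h (norm v - 1) > 0" using that by (intro hpos) (auto simp: S_def)
    moreover have "norm v > 0" using that unfolding S_def mem_Collect_eq by linarith
    ultimately show ?thesis by (simp add: q_def)
  qed
  have sq: "sqrt (det (gram_matrix g polar v)) = \<alpha> (norm v)" if "v \<in> S" for v
    unfolding gram[OF that] det_id_plus_rank_one[OF x1[OF that]] \<alpha>_def
    using q0[OF that] by (simp add: real_sqrt_power)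
  have inv: "matrix_inv (gram_matrix g polar v) = (\<chi> i j. 1 / (q (norm v))\<^sup>2 * (if i = j then 1 else 0)
      + (1 - 1 / (q (norm v))\<^sup>2) * ((v /\<^sub>R norm v) $ i * (v /\<^sub>R norm v) $ j))" if "v \<in> S" for v
    unfolding gram[OF that] using matrix_inv_id_plus_rank_one[OF x1[OF that]] q0[OF that] by auto
  obtain T where T: "open T" "u \<in> T" "\<And>y. y \<in> T \<Longrightarrow> ((f \<circ> polar) has_derivative (\<lambda>w. G y \<bullet> w)) (at y)"
    using jet unfolding has_jet_def eventually_nhds by blast
  have uS: "u \<in> S" using u by (simp add: S_def)
  let ?flux = "\<lambda>i v. sqrt (det (gram_matrix g polar v)) *
       (\<Sum>j\<in>UNIV. matrix_inv (gram_matrix g polar v) $ i $ j * partial_deriv j (f \<circ> polar) v)"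
  have flux: "?flux i v = V v $ i"
    if v: "v \<in> S \<inter> T" for v i
  proof -
    have vS: "v \<in> S" using v by simp
    have G: "partial_deriv j (f \<circ> polar) v = G v $ j" for j
      using frechet_derivative_at[OF T(3)[of v], symmetric] v by (simp add: partial_deriv_def inner_axis)
    have "(\<Sum>j\<in>UNIV. matrix_inv (gram_matrix g polar v) $ i $ j * partial_deriv j (f \<circ> polar) v)
       = (\<Sum>j\<in>UNIV. (if i = j then 1 / (q (norm v))\<^sup>2 * G v $ j else 0)) +
         (1 - 1 / (q (norm v))\<^sup>2) * (v $ i / (norm v)\<^sup>2) * (\<Sum>j\<in>UNIV. v $ j * G v $ j)"
      unfolding sum_distrib_left sum.distrib[symmetric]
      by (intro sum.cong refl) (simp add: inv[OF vS] G divide_inverse power_inverse power2_eq_square algebra_simps)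
    also have "\<dots> = 1 / (q (norm v))\<^sup>2 * G v $ i + (1 - 1 / (q (norm v))\<^sup>2) * (v $ i / (norm v)\<^sup>2) * (v \<bullet> G v)"
      by (simp add: inner_vec_def)
    also have "\<alpha> (norm v) * \<dots> = V v $ i"
    proof -
      have "b * Q\<^sup>2 * (1 / Q\<^sup>2 * y + (1 - 1 / Q\<^sup>2) * (a / N) * s) = b * y + (b * Q\<^sup>2 - b) / N * s * a"
        if "Q \<noteq> 0" for b Q y a N s :: real
        using that by (cases "N = 0") (simp_all add: field_simps)
      then show ?thesis
        using q0[OF vS] unfolding \<alpha>\<beta> V_def \<gamma>_def by simp
    qed
    finally show ?thesis unfolding sq[OF vS] .
  qed
  define \<rho> where "\<rho> = norm u"
  define k where "k = h (\<rho> - 1)"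
  have \<rho>: "\<rho> > 0" "\<rho> \<noteq> 0" using u by (auto simp: \<rho>_def)
  have u0: "u \<noteq> 0" using \<rho> by (auto simp: \<rho>_def)
  have k: "k > 0" using u unfolding k_def \<rho>_def by (intro hpos) auto
  define q' where "q' = (m * \<rho> - k) / \<rho>\<^sup>2"
  have "((\<lambda>t. h (t - 1)) has_real_derivative m) (at \<rho>)"
    using DERIV_shift[of h m \<rho> "-1"] h' by (simp add: \<rho>_def)
  then have q': "(q has_real_derivative q') (at \<rho>)"
    unfolding q_def[abs_def] q'_def k_def
    using \<rho> by (auto intro!: derivative_eq_intros simp: power2_eq_square)
  define \<alpha>' where "\<alpha>' = real (CARD('n) - 1) * q \<rho> ^ (CARD('n) - 2) * q'"
  have "CARD('n) - Suc (Suc 0) = CARD('n) - 2" by simp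
  then have \<alpha>': "(\<alpha> has_real_derivative \<alpha>') (at \<rho>)"
    unfolding \<alpha>_def[abs_def] \<alpha>'_def by (auto intro!: derivative_eq_intros q' simp: numeral_2_eq_2)
  obtain \<beta>' where \<beta>': "(\<beta> has_real_derivative \<beta>') (at \<rho>)"
    unfolding \<beta>_def[abs_def] using DERIV_power[OF q'] by blast
  define \<gamma>' where "\<gamma>' = (\<alpha>' - \<beta>') / \<rho>\<^sup>2 - 2 * (\<alpha> \<rho> - \<beta> \<rho>) / \<rho>^3"
  have \<gamma>': "(\<gamma> has_real_derivative \<gamma>') (at \<rho>)"
    unfolding \<gamma>_def[abs_def] \<gamma>'_def using \<rho>
    by (auto intro!: derivative_eq_intros \<alpha>' \<beta>' simp: field_simps eval_nat_numeral)
  have N: "(norm has_derivative (\<lambda>w. (u \<bullet> w) / \<rho>)) (at u)"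
    using has_jetD(1)[OF has_jet_norm[OF u0]] by (simp add: \<rho>_def divide_inverse mult.commute)
  note B = has_derivative_compose[OF N \<beta>'[unfolded has_field_derivative_def \<rho>_def]]
  note C = has_derivative_compose[OF N \<gamma>'[unfolded has_field_derivative_def \<rho>_def]]
  note Gd = has_jetD(2)[OF jet]
  define DV where "DV w = \<beta> \<rho> *\<^sub>R H w + ((\<beta>' / \<rho>) * (u \<bullet> w)) *\<^sub>R G u
     + ((\<gamma> \<rho> * (w \<bullet> G u + u \<bullet> H w) + ((\<gamma>' / \<rho>) * (u \<bullet> G u)) * (u \<bullet> w)) *\<^sub>R u
     + (\<gamma> \<rho> * (u \<bullet> G u)) *\<^sub>R w)" for w
  have "(V has_derivative (\<lambda>w. (\<beta> (norm u) *\<^sub>R H w + (\<beta>' * (u \<bullet> w / \<rho>)) *\<^sub>R G u)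
     + ((\<gamma> (norm u) * (u \<bullet> G u)) *\<^sub>R w + (\<gamma> (norm u) * (u \<bullet> H w + w \<bullet> G u) + (\<gamma>' * (u \<bullet> w / \<rho>)) * (u \<bullet> G u)) *\<^sub>R u))) (at u)"
    unfolding V_def[abs_def]
    by (intro has_derivative_add has_derivative_scaleR has_derivative_mult has_derivative_inner
        B C Gd has_derivative_ident)
  then have V': "(V has_derivative DV) (at u)"
    by (rule has_derivative_eq_rhs) (auto simp: DV_def \<rho>_def[symmetric] algebra_simps)
  have "partial_deriv i (?flux i) u
     = DV (axis i 1) \<bullet> axis i 1" for i
  proof -
    have "((\<lambda>v. V v $ i) has_derivative (\<lambda>w. DV w $ i)) (at u)"
      using V' bounded_linear.has_derivative[OF bounded_linear_vec_nth] by blast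
    then have "(?flux i has_derivative (\<lambda>w. DV w $ i)) (at u)"
      by (rule has_derivative_transform_within_open[OF _ open_Int[OF S T(1)]]) (use T(2) uS flux in simp_all)
    from frechet_derivative_at[OF this, symmetric] show ?thesis by (simp add: partial_deriv_def inner_axis)
  qed
  then have "laplace_beltrami g polar f u = (\<Sum>b\<in>Basis. DV b \<bullet> b) / \<alpha> \<rho>"
    unfolding laplace_beltrami_def sum_Basis_vec by (simp add: sq[OF uS] \<rho>_def)
  also have "(\<Sum>b\<in>Basis. DV b \<bullet> b) = \<beta> \<rho> * (\<Sum>b\<in>Basis. H b \<bullet> b) + (\<beta>' / \<rho>) * (u \<bullet> G u)
      + \<gamma> \<rho> * (u \<bullet> G u + u \<bullet> H u) + ((\<gamma>' / \<rho>) * (u \<bullet> G u)) * (u \<bullet> u) + (\<gamma> \<rho> * (u \<bullet> G u)) * real DIM(real^'n)"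
    unfolding DV_def by (rule sum_trace_rank_one[OF has_jetD(3)[OF jet]])
  also have "\<dots> = \<beta> \<rho> * (\<Sum>b\<in>Basis. H b \<bullet> b) + \<gamma> \<rho> * (u \<bullet> H u) +
      (\<alpha>' / \<rho> + real (CARD('n) - 1) * \<gamma> \<rho>) * (u \<bullet> G u)"
  proof -
    have uu: "u \<bullet> u = \<rho>\<^sup>2" by (simp add: power2_norm_eq_inner \<rho>_def)
    have n1: "real (CARD('n) - 1) = real DIM(real^'n) - 1" using n by simp
    have "\<beta>' / \<rho> + \<gamma>' / \<rho> * \<rho>\<^sup>2 = \<alpha>' / \<rho> - 2 * \<gamma> \<rho>"
      using \<rho> by (simp add: \<gamma>'_def \<gamma>_def field_simps eval_nat_numeral)
    note 1 = this
    have "b * t + B * s + c * (s + w) + C * s * N + c * s * n = b * t + c * w + (A + (n - 1) * c) * s"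
      if "B + C * N = A - 2 * c" for b t B s c w C N n A :: real
    proof -
      have "(B + C * N) * s = (A - 2 * c) * s" using that by simp
      then show ?thesis by (simp add: algebra_simps)
    qed
    from this[OF 1] show ?thesis unfolding uu n1 .
  qed
  also have "\<dots> / \<alpha> \<rho> = jet_lap k m u (G u) H"
  proof -
    have qk: "q \<rho> = k / \<rho>" by (simp add: q_def k_def)
    have \<beta>0: "\<beta> \<rho> > 0" using k \<rho> by (simp add: \<beta>_def qk)
    have 1: "\<beta> \<rho> / \<alpha> \<rho> = (\<rho> / k)\<^sup>2"
      using \<beta>0 k \<rho> by (simp add: \<alpha>\<beta> qk field_simps)
    have 2: "\<gamma> \<rho> / \<alpha> \<rho> = (1 - (\<rho> / k)\<^sup>2) / \<rho>\<^sup>2"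
      using \<beta>0 k \<rho> by (simp add: \<gamma>_def \<alpha>\<beta> qk field_simps)
    have "\<alpha> \<rho> = q \<rho> ^ (CARD('n) - 2) * q \<rho>"
    proof -
      have "CARD('n) - 1 = Suc (CARD('n) - 2)" using n by simp
      then show ?thesis by (simp only: \<alpha>_def power_Suc mult.commute)
    qed
    then have 3: "\<alpha>' / \<alpha> \<rho> = real (CARD('n) - 1) * (m / k - 1 / \<rho>)"
      using k \<rho> by (simp add: \<alpha>'_def q'_def qk field_simps power2_eq_square)
    interpret bounded_linear H by (rule has_jetD(3)[OF jet])
    show ?thesis
    proof -
      define d where "d = real (CARD('n) - 1)"
      have "(\<beta> \<rho> * t + \<gamma> \<rho> * a + (\<alpha>' / \<rho> + d * \<gamma> \<rho>) * b) / \<alpha> \<rho>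
          = (\<beta> \<rho> / \<alpha> \<rho>) * t + (\<gamma> \<rho> / \<alpha> \<rho>) * a + (\<alpha>' / \<alpha> \<rho> / \<rho> + d * (\<gamma> \<rho> / \<alpha> \<rho>)) * b" for t a b
        by (simp add: add_divide_distrib distrib_right mult.commute[of \<rho>])
      also have "\<dots> t a b = (\<rho> / k)\<^sup>2 * (t - a / \<rho>\<^sup>2) + a / \<rho>\<^sup>2 + d * (m / k - \<rho> / k\<^sup>2) * (b / \<rho>)" for t a b
        unfolding 1 2 3 d_def[symmetric] using \<rho> k by (simp add: field_simps power2_eq_square)
      finally have A: "(\<beta> \<rho> * t + \<gamma> \<rho> * a + (\<alpha>' / \<rho> + d * \<gamma> \<rho>) * b) / \<alpha> \<rho>
          = (\<rho> / k)\<^sup>2 * (t - a / \<rho>\<^sup>2) + a / \<rho>\<^sup>2 + d * (m / k - \<rho> / k\<^sup>2) * (b / \<rho>)" for t a b .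
      have "real (DIM(real^'n) - 1) = d" by (simp add: d_def)
      moreover have "(u /\<^sub>R \<rho>) \<bullet> H (u /\<^sub>R \<rho>) = (u \<bullet> H u) / \<rho>\<^sup>2"
        by (simp add: scaleR divide_inverse power2_eq_square mult_ac)
      moreover have "(u /\<^sub>R \<rho>) \<bullet> G u = (u \<bullet> G u) / \<rho>" by (simp add: divide_inverse mult_ac)
      ultimately show ?thesis
        unfolding jet_lap_def Let_def \<rho>_def[symmetric] d_def[symmetric] A by simp
    qed
  qed
  finally show ?thesis by (simp add: k_def \<rho>_def)
qed

section \<open>Comparison for eigenfunctions\<close>

lemma has_derivative_slice:
  fixes f :: "'n::finite point \<Rightarrow> real"
  assumes "(f has_derivative D) (at (r, p))"
  shows "((\<lambda>t. f (t, p)) has_real_derivative D (1, 0)) (at r)"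
proof -
  interpret bounded_linear D using assms by (rule has_derivative_bounded_linear)
  have "((\<lambda>t. (t, p)) has_derivative (\<lambda>t. (t, 0))) (at r)"
    by (auto intro!: derivative_eq_intros)
  from has_derivative_compose[OF this assms]
  have "((\<lambda>t. f (t, p)) has_derivative (\<lambda>t. D (t, 0))) (at r)" .
  moreover have "(\<lambda>t. D (t, 0)) = (*) (D (1, 0))"
  proof
    show "D (t, 0) = D (1, 0) * t" for t
      using scaleR[of t "(1, 0)"] by (simp add: mult.commute)
  qed
  ultimately show ?thesis by (simp only: has_field_derivative_def)
qed

locale revolution =
  fixes L :: real and h h' :: "real \<Rightarrow> real" and g :: "'n::finite form_field" and N :: nat
  assumes n3: "CARD('n) \<ge> 3" and N: "N = CARD('n) - 1" and L: "L > 0"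
    and h': "\<And>r. r \<in> {0..L} \<Longrightarrow> (h has_real_derivative h' r) (at r)"
    and h_pos: "\<And>r. r \<in> {0..L} \<Longrightarrow> h r > 0"
    and h0: "h 0 = 1" and hL: "h L = 1"
    and g: "\<And>x v w. x \<in> cyl L \<Longrightarrow> v \<in> tangent_cyl x \<Longrightarrow> w \<in> tangent_cyl x \<Longrightarrow>
       g x v w = fst v * fst w + (h (fst x))\<^sup>2 * (snd v \<bullet> snd w)"
begin

lemma N2: "N \<ge> 2" and N_real: "real N = real CARD('n) - 1" using n3 N by auto

lemma cont_h: "continuous_on {0..L} h"
  by (rule DERIV_continuous_on) (rule has_field_derivative_at_within[OF h'])

lemma outward_unit_normal_iff:
  assumes "x \<in> cyl_boundary L"
  shows "outward_unit_normal L g x \<nu> \<longleftrightarrow> \<nu> = (if fst x = 0 then -1 else 1, 0)"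
proof -
  have x: "x \<in> cyl L" and hx: "h (fst x) = 1"
    using assms L h0 hL by (auto simp: cyl_boundary_def cyl_def)
  show ?thesis
  proof
    assume o: "outward_unit_normal L g x \<nu>"
    then have t: "\<nu> \<in> tangent_cyl x" and sgn: "if fst x = 0 then fst \<nu> < 0 else fst \<nu> > 0"
      by (auto simp: outward_unit_normal_def)
    have "(0, snd \<nu>) \<in> tangent_boundary x" "(0, snd \<nu>) \<in> tangent_cyl x"
      using t by (auto simp: tangent_boundary_def tangent_cyl_def)
    then have "snd \<nu> \<bullet> snd \<nu> = 0"
      using o g[OF x t, of "(0, snd \<nu>)"] hx unfolding outward_unit_normal_def by auto
    then have s: "snd \<nu> = 0" by simp
    then have "(fst \<nu>)\<^sup>2 = 1"
      using o g[OF x t t] unfolding outward_unit_normal_def by (simp add: power2_eq_square)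
    then have "fst \<nu> = 1 \<or> fst \<nu> = -1" by (simp add: power2_eq_1_iff)
    with s sgn show "\<nu> = (if fst x = 0 then -1 else 1, 0)"
      by (cases \<nu>) (auto split: if_splits)
  next
    assume \<nu>: "\<nu> = (if fst x = 0 then -1 else 1, 0)"
    then have t: "\<nu> \<in> tangent_cyl x" by (simp add: tangent_cyl_def)
    show "outward_unit_normal L g x \<nu>"
      unfolding outward_unit_normal_def
      using t g[OF x t] \<nu> by (auto simp: tangent_boundary_def)
  qed
qed

lemma steklov_slice:
  assumes "steklov_eigenfunction L g \<sigma> f" "p \<in> sphere 0 1"
  shows "((\<lambda>t. f (t, p)) has_real_derivative - \<sigma> * f (0, p)) (at 0)"
    and "((\<lambda>t. f (t, p)) has_real_derivative \<sigma> * f (L, p)) (at L)"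
proof -
  obtain U where U: "cyl L \<subseteq> U" "Ck_on (Suc 0) U f"
    using assms(1) unfolding steklov_eigenfunction_def harmonic_cyl_def smooth_near_def by blast
  have b: "(0, p) \<in> cyl_boundary L" "(L, p) \<in> cyl_boundary L" and c: "cyl_boundary L \<subseteq> cyl L"
    using L assms(2) by (auto simp: cyl_boundary_def cyl_def)
  have D: "(f has_derivative frechet_derivative f (at x)) (at x)" if "x \<in> cyl_boundary L" for x
    using that U c by (auto simp: frechet_derivative_works)
  have e: "frechet_derivative f (at x) (if fst x = 0 then -1 else 1, 0) = \<sigma> * f x" if "x \<in> cyl_boundary L" for x
    using assms(1) outward_unit_normal_iff[OF that] that unfolding steklov_eigenfunction_def by blast
  interpret bounded_linear "frechet_derivative f (at (0, p))"
    using D[OF b(1)] by (rule has_derivative_bounded_linear)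
  have "frechet_derivative f (at (0, p)) (1, 0) = - \<sigma> * f (0, p)"
    using e[OF b(1)] neg[of "(1, 0)"] by simp
  then show "((\<lambda>t. f (t, p)) has_real_derivative - \<sigma> * f (0, p)) (at 0)"
    using has_derivative_slice[OF D[OF b(1)]] by simp
  show "((\<lambda>t. f (t, p)) has_real_derivative \<sigma> * f (L, p)) (at L)"
    using has_derivative_slice[OF D[OF b(2)]] e[OF b(2)] L by simp
qed

lemma harmonic_jet:
  fixes u :: "real^'n"
  assumes "harmonic_cyl L g f" "1 < norm u" "norm u < 1 + L"
  obtains G H where "has_jet (f \<circ> polar) u G H"
    and "jet_lap (h (norm u - 1)) (h' (norm u - 1)) u (G u) H = 0"
proof -
  obtain U where U: "open U" "cyl L \<subseteq> U" "Ck_on (Suc (Suc 0)) U f"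
    using assms(1) unfolding harmonic_cyl_def smooth_near_def by blast
  have u0: "u \<noteq> 0" using assms(2) by auto
  have "polar u \<in> cyl L" using assms(2,3) u0 by (auto simp: polar_def cyl_def)
  then obtain G H where j: "has_jet (f \<circ> polar) u G H"
    using ex_jet_polar[OF U(3,1) _ u0] U(2) by blast
  have "(h has_real_derivative h' (norm u - 1)) (at (norm u - 1))"
    using assms(2,3) by (intro h') auto
  from laplace_beltrami_polar[OF n3 g h_pos assms(2,3) this j]
  have "jet_lap (h (norm u - 1)) (h' (norm u - 1)) u (G u) H = 0"
    using assms unfolding harmonic_cyl_def by simp
  with j that show thesis by blast
qed

text \<open>Comparison argument: if \<open>f\<close> is not invariant under the reflection \<open>R\<close> along \<open>e\<close>, compare \<open>f - f \<circ> R\<close> on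
  the half \<open>p \<bullet> e \<ge> 0\<close> with \<open>w = a(r) \<psi>(p \<bullet> e)\<close>, \<open>a' = a y / h\<^sup>n\<^sup>-\<^sup>1\<close>. The Riccati inequality for
  \<open>y\<close>, with \<open>\<Lambda>\<close> strictly below the first eigenvalue \<open>n - 1\<close> of the sphere, leaves room to make
  \<open>\<psi>\<close> positive on the closed half and \<open>w\<close> strictly superharmonic, so the maximum of the
  quotient cannot be attained.\<close>

lemma steklov_radial:
  fixes y y' :: "real \<Rightarrow> real"
  assumes st: "steklov_eigenfunction L g \<sigma> f" and \<sigma>\<tau>: "\<sigma> < \<tau>"
    and cy: "continuous_on {0..L} y"
    and y': "\<And>r. 0 < r \<Longrightarrow> r < L \<Longrightarrow> (y has_real_derivative y' r) (at r)"
    and ric: "\<And>r. 0 < r \<Longrightarrow> r < L \<Longrightarrow> y' r + (y r)\<^sup>2 / h r ^ N \<le> \<Lambda> * h r ^ (N - 2)"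
    and \<Lambda>: "0 \<le> \<Lambda>" "\<Lambda> < N" and y0: "y 0 \<le> - \<tau>" and yL: "y L \<ge> \<tau>"
    and r0: "r0 \<in> {0..L}" and p: "p0 \<in> sphere 0 1" "p1 \<in> sphere 0 1"
  shows "f (r0, p0) \<le> f (r0, p1)"
proof (rule ccontr)
  assume less: "\<not> f (r0, p0) \<le> f (r0, p1)"
  then have ne: "p0 \<noteq> p1" by auto
  define e where "e = (p0 - p1) /\<^sub>R norm (p0 - p1)"
  have e1: "norm e = 1" using ne by (simp add: e_def)
  then have ee: "e \<bullet> e = 1" by (simp add: norm_eq_1)
  define R where "R = (\<lambda>v. v - (2 * (v \<bullet> e)) *\<^sub>R e)"
  have pp: "p0 \<bullet> p0 = 1" "p1 \<bullet> p1 = 1" using p by (auto simp: norm_eq_1)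
  have nn: "(norm (p0 - p1))\<^sup>2 = 2 * (1 - p0 \<bullet> p1)"
    by (simp add: power2_norm_eq_inner inner_diff_left inner_diff_right pp inner_commute)
  have p0e: "p0 \<bullet> e = norm (p0 - p1) / 2"
  proof -
    have "p0 \<bullet> e = (1 - p0 \<bullet> p1) / norm (p0 - p1)"
      by (simp add: e_def inner_diff_right pp divide_inverse mult.commute)
    also have "1 - p0 \<bullet> p1 = (norm (p0 - p1))\<^sup>2 / 2" using nn by simp
    finally show ?thesis using ne by (simp add: power2_eq_square)
  qed
  have Rp0: "R p0 = p1" using ne unfolding R_def p0e by (simp add: e_def)
  have sa: "R v \<bullet> w = v \<bullet> R w" for v w
    by (simp add: R_def inner_diff_left inner_diff_right inner_commute)
  have RR: "R v \<bullet> R v = v \<bullet> v" for v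
    using ee by (simp add: R_def inner_diff_left inner_diff_right inner_commute algebra_simps)
  then have nR: "norm (R v) = norm v" for v by (simp add: norm_eq_sqrt_inner)
  have Rsc: "R (c *\<^sub>R v) = c *\<^sub>R R v" for c v by (simp add: R_def algebra_simps)
  have blR: "bounded_linear R"
    unfolding R_def
    by (intro bounded_linear_sub bounded_linear_ident bounded_linear_scaleR_const
        bounded_linear_const_mult bounded_linear_inner_left)
  have hp: "h r ^ N > 0" if "r \<in> {0..L}" for r using h_pos[OF that] by simp
  define b where "b r = y r / h r ^ N" for r
  have "continuous_on {0..L} b"
    unfolding b_def using cy cont_h hp by (intro continuous_intros) fastforce+
  then obtain Y where Y: "\<And>r. r \<in> {0..L} \<Longrightarrow> (Y has_real_derivative b r) (at r within {0..L})"
    using antiderivative_continuous unfolding has_real_derivative_iff_has_vector_derivative by blast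
  define a where "a r = exp (Y r)" for r
  have a_pos: "a r > 0" for r by (simp add: a_def)
  have a': "(a has_real_derivative a r * b r) (at r within {0..L})" if "r \<in> {0..L}" for r
    unfolding a_def by (auto intro!: derivative_eq_intros Y[OF that])
  have a'': "(a has_real_derivative a r * b r) (at r)" if "0 < r" "r < L" for r
    using a'[of r] that by (simp add: at_within_Icc_at)
  define a2 where "a2 r = a r * b r * b r + a r * (y' r / h r ^ N - y r * (N * h' r) / h r ^ Suc N)" for r
  have b': "(b has_real_derivative y' r / h r ^ N - y r * (N * h' r) / h r ^ Suc N) (at r)" if "0 < r" "r < L" for r
  proof -
    have hr: "h r > 0" using h_pos that by simp
    have hS: "h r ^ N = h r * h r ^ (N - Suc 0)" using N2 by (metis Suc_pred' power_Suc One_nat_def Suc_1 less_le_trans zero_less_Suc)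
    show ?thesis
      unfolding b_def using hr that
      by (auto intro!: derivative_eq_intros h' y' simp: divide_simps) (simp add: hS algebra_simps)
  qed
  have a2: "((\<lambda>r. a r * b r) has_real_derivative a2 r) (at r)" if "0 < r" "r < L" for r
    unfolding a2_def using DERIV_mult[OF a''[OF that] b'[OF that]] by (simp add: algebra_simps)
  have a2_le: "a2 r + N * h' r / h r * (a r * b r) \<le> \<Lambda> * a r / (h r)\<^sup>2" if r: "0 < r" "r < L" for r
  proof -
    have hr: "h r > 0" using h_pos that by simp
    have "h r ^ N = h r ^ (N - 2) * (h r)\<^sup>2" using N2 by (metis le_add_diff_inverse2 power_add)
    then have q: "h r ^ (N - 2) / h r ^ N = 1 / (h r)\<^sup>2" using hr by simp
    have "a2 r + N * h' r / h r * (a r * b r) = a r * ((y' r + (y r)\<^sup>2 / h r ^ N) / h r ^ N)"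
      using hr by (simp add: a2_def b_def field_simps power2_eq_square)
    also have "\<dots> \<le> a r * ((\<Lambda> * h r ^ (N - 2)) / h r ^ N)"
      using ric[OF r] a_pos[of r] hr by (intro mult_left_mono divide_right_mono) auto
    also have "\<dots> = \<Lambda> * a r / (h r)\<^sup>2" using q by (metis mult.assoc mult.commute mult.right_neutral times_divide_eq_right)
    finally show ?thesis .
  qed
  define \<mu> where "\<mu> = real N - \<Lambda>"
  define \<delta> where "\<delta> = \<mu> / (real N * (real N + 1))"
  have N0: "real N \<ge> 2" using N2 by linarith
  have \<mu>: "0 < \<mu>" "\<mu> \<le> N" using \<Lambda> by (auto simp: \<mu>_def)
  have \<delta>: "\<delta> > 0" using \<mu> N0 by (simp add: \<delta>_def)
  have \<delta>N: "\<delta> * (real N * (real N + 1)) = \<mu>" using N0 by (simp add: \<delta>_def)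
  define \<psi> where "\<psi> s = s + \<delta> * (1 - N / 2 * s\<^sup>2)" for s :: real
  define \<psi>1 where "\<psi>1 s = 1 - \<delta> * N * s" for s :: real
  have \<psi>': "(\<psi> has_real_derivative \<psi>1 s) (at s)" "(\<psi>1 has_real_derivative - \<delta> * N) (at s)" for s :: real
    unfolding \<psi>_def[abs_def] \<psi>1_def[abs_def] by (auto intro!: derivative_eq_intros)
  have \<psi>_pos: "\<psi> s > 0" if "0 \<le> s" "s \<le> 1" for s :: real
  proof -
    have "\<delta> * N \<le> 1"
    proof -
      have "\<delta> * N * (real N + 1) \<le> 1 * (real N + 1)" using \<delta>N \<mu> by (simp add: mult.assoc)
      then show ?thesis by (rule mult_right_le_imp_le) (use N0 in simp)
    qed
    moreover have "s\<^sup>2 \<le> s" using that by (simp add: power2_eq_square mult_left_le)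
    ultimately have "\<delta> * N * s\<^sup>2 \<le> 1 * s" using that \<delta> by (intro mult_mono) auto
    then show ?thesis using \<delta> that by (simp add: \<psi>_def algebra_simps)
  qed
  have \<psi>_neg: "\<Lambda> * \<psi> s + ((1 - s\<^sup>2) * (- \<delta> * N) - N * s * \<psi>1 s) < 0" if "0 \<le> s" "s \<le> 1" for s :: real
  proof -
    have s2: "s\<^sup>2 \<le> s" using that by (simp add: power2_eq_square mult_left_le)
    have "\<Lambda> * \<psi> s + ((1 - s\<^sup>2) * (- \<delta> * N) - N * s * \<psi>1 s) =
        - \<mu> * s - \<delta> * \<mu> + \<delta> * (N * (N + 1)) * s\<^sup>2 - \<delta> * \<Lambda> * N / 2 * s\<^sup>2"
      by (simp add: \<psi>_def \<psi>1_def \<mu>_def power2_eq_square algebra_simps)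
    also have "\<dots> \<le> - \<mu> * s - \<delta> * \<mu> + \<mu> * s\<^sup>2"
    proof -
      have "\<delta> * (N * (N + 1)) * s\<^sup>2 = \<mu> * s\<^sup>2" using \<delta>N by (simp add: algebra_simps)
      moreover have "\<delta> * \<Lambda> * N / 2 * s\<^sup>2 \<ge> 0" using \<delta> \<Lambda> by simp
      ultimately show ?thesis by linarith
    qed
    also have "\<dots> < 0" using s2 \<mu> \<delta> by (smt (verit) mult_left_mono mult_pos_pos mult_minus_left)
    finally show ?thesis .
  qed
  define w where "w x = a (fst x) * \<psi> (snd x \<bullet> e)" for x :: "'n point"
  define fd where "fd x = f x - f (fst x, R (snd x))" for x :: "'n point"
  define D where "D = cyl L \<inter> {x :: 'n point. 0 \<le> snd x \<bullet> e}"
  have cD: "compact D"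
    unfolding D_def cyl_def
    by (intro compact_Int_closed compact_Times compact_Icc compact_sphere closed_Collect_le continuous_intros)
  have se: "snd x \<bullet> e \<le> 1" if "x \<in> cyl L" for x :: "'n point"
    using that norm_cauchy_schwarz[of "snd x" e] e1 by (auto simp: cyl_def)
  have w_pos: "w x > 0" if "x \<in> D" for x
    using that se a_pos \<psi>_pos by (auto simp: w_def D_def)
  obtain U where U: "open U" "cyl L \<subseteq> U" "Ck_on 0 U f"
    using st unfolding steklov_eigenfunction_def harmonic_cyl_def smooth_near_def by blast
  have cf: "continuous_on (cyl L) f" using U continuous_on_subset by auto
  have "continuous_on (cyl L) (\<lambda>x. f (fst x, R (snd x)))"
    by (rule continuous_on_compose2[OF cf])
      (intro continuous_on_Pair continuous_on_fst continuous_on_snd continuous_on_id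
        bounded_linear.continuous_on[OF blR], auto simp: cyl_def nR)
  then have "continuous_on (cyl L) fd" unfolding fd_def by (intro continuous_on_diff cf)
  then have cfd: "continuous_on D fd" by (rule continuous_on_subset) (auto simp: D_def)
  have ca: "continuous_on {0..L} a"
    by (rule DERIV_continuous_on) (rule a')
  have cw: "continuous_on D w"
    unfolding w_def \<psi>_def
    by (intro continuous_on_mult continuous_on_compose2[OF ca] continuous_intros) (auto simp: D_def cyl_def)
  have "0 \<le> p0 \<bullet> e" unfolding p0e by simp
  then have inD: "(r0, p0) \<in> D" using r0 p by (auto simp: D_def cyl_def)
  have "continuous_on D (\<lambda>x. fd x / w x)"
    using w_pos by (intro continuous_on_divide cfd cw) force
  then obtain x0 where x0: "x0 \<in> D" "\<And>x. x \<in> D \<Longrightarrow> fd x / w x \<le> fd x0 / w x0"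
    using continuous_attains_sup[OF cD] inD by blast
  define K where "K = fd x0 / w x0"
  have "fd (r0, p0) / w (r0, p0) > 0"
    using less w_pos[OF inD] by (simp add: fd_def Rp0)
  then have K: "K > 0" using x0(2)[OF inD] by (simp add: K_def)
  have fdx0: "fd x0 = K * w x0" using w_pos[OF x0(1)] by (simp add: K_def)
  have \<Phi>: "fd x - K * w x \<le> 0" if "x \<in> D" for x
    using x0(2)[OF that] w_pos[OF that] by (simp add: K_def divide_le_eq)
  obtain r q where rq: "x0 = (r, q)" by (cases x0)
  have r: "r \<in> {0..L}" and q: "q \<in> sphere 0 1" and qe: "0 \<le> q \<bullet> e"
    using x0(1) by (auto simp: D_def cyl_def rq)
  have "q \<bullet> e \<noteq> 0"
  proof
    assume "q \<bullet> e = 0"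
    then have "fd x0 = 0" by (simp add: fd_def rq R_def)
    then show False using K w_pos[OF x0(1)] by (simp add: K_def)
  qed
  with qe have qe: "0 < q \<bullet> e" by simp
  have qe1: "q \<bullet> e \<le> 1" using se[of "(0, q)"] q L by (auto simp: cyl_def)
  have Rq: "R q \<in> sphere 0 1" using q nR by auto
  define \<phi> where "\<phi> t = fd (t, q) - K * w (t, q)" for t
  have \<phi>_le: "\<phi> t \<le> 0" if "t \<in> {0..L}" for t
    unfolding \<phi>_def using that q qe by (intro \<Phi>) (auto simp: D_def cyl_def)
  have \<phi>r: "\<phi> r = 0" using fdx0 by (simp add: \<phi>_def rq)
  have fdr: "f (r, q) - f (r, R q) = K * a r * \<psi> (q \<bullet> e)"
    using fdx0 by (simp add: fd_def w_def rq)
  have pos: "K * a r * \<psi> (q \<bullet> e) > 0" using K a_pos \<psi>_pos qe qe1 by simp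
  show False
  proof (cases "r = 0 \<or> r = L")
    case True
    then consider "r = 0" | "r = L" by blast
    then show False
    proof cases
      case 1
      have "(\<phi> has_real_derivative (- \<sigma> * f (0, q) - (- \<sigma> * f (0, R q)) - K * (a 0 * b 0 * \<psi> (q \<bullet> e)))) (at 0 within {0..L})"
        unfolding \<phi>_def fd_def w_def fst_conv snd_conv
        by (intro DERIV_diff DERIV_cmult DERIV_cmult_right a'
            has_field_derivative_at_within[OF steklov_slice(1)[OF st q]]
            has_field_derivative_at_within[OF steklov_slice(1)[OF st Rq]]) (use L in simp)
      moreover have "- \<sigma> * f (0, q) - (- \<sigma> * f (0, R q)) - K * (a 0 * b 0 * \<psi> (q \<bullet> e))
          = (- \<sigma> - y 0) * (K * a r * \<psi> (q \<bullet> e))"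
      proof -
        have "- \<sigma> * f (0, q) - (- \<sigma> * f (0, R q)) = - \<sigma> * (K * a r * \<psi> (q \<bullet> e))"
          unfolding fdr[symmetric] using 1 by (simp add: algebra_simps)
        then show ?thesis using 1 h0 by (simp add: b_def algebra_simps)
      qed
      moreover have "\<dots> > 0" using pos \<sigma>\<tau> y0 by (intro mult_pos_pos[OF _ pos]) auto
      ultimately obtain d where "d > 0" "\<forall>t>0. 0 + t \<in> {0..L} \<longrightarrow> t < d \<longrightarrow> \<phi> 0 < \<phi> (0 + t)"
        using has_real_derivative_pos_inc_right[of \<phi> _ 0 "{0..L}"] by auto
      then have "\<phi> 0 < \<phi> (min d L / 2)" using L by (auto simp: min_def)
      then show False using \<phi>_le[of "min d L / 2"] \<phi>r 1 \<open>d > 0\<close> L by (auto simp: min_def split: if_splits)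
    next
      case 2
      have "(\<phi> has_real_derivative (\<sigma> * f (L, q) - \<sigma> * f (L, R q) - K * (a L * b L * \<psi> (q \<bullet> e)))) (at L within {0..L})"
        unfolding \<phi>_def fd_def w_def fst_conv snd_conv
        by (intro DERIV_diff DERIV_cmult DERIV_cmult_right a'
            has_field_derivative_at_within[OF steklov_slice(2)[OF st q]]
            has_field_derivative_at_within[OF steklov_slice(2)[OF st Rq]]) (use L in simp)
      moreover have "\<sigma> * f (L, q) - \<sigma> * f (L, R q) - K * (a L * b L * \<psi> (q \<bullet> e))
          = (\<sigma> - y L) * (K * a r * \<psi> (q \<bullet> e))"
      proof -
        have "\<sigma> * f (L, q) - \<sigma> * f (L, R q) = \<sigma> * (K * a r * \<psi> (q \<bullet> e))"
          unfolding fdr[symmetric] using 2 by (simp add: algebra_simps)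
        then show ?thesis using 2 hL by (simp add: b_def algebra_simps)
      qed
      moreover have "\<dots> < 0" using pos \<sigma>\<tau> yL by (intro mult_neg_pos[OF _ pos]) auto
      ultimately obtain d where "d > 0" "\<forall>t>0. L - t \<in> {0..L} \<longrightarrow> t < d \<longrightarrow> \<phi> L < \<phi> (L - t)"
        using has_real_derivative_neg_dec_left[of \<phi> _ L "{0..L}"] by auto
      then have "\<phi> L < \<phi> (L - min d L / 2)" using L by (auto simp: min_def)
      then show False using \<phi>_le[of "L - min d L / 2"] \<phi>r 2 \<open>d > 0\<close> L by (auto simp: min_def split: if_splits)
    qed
  next
    case False
    with r have r: "0 < r" "r < L" by auto
    define u where "u = (1 + r) *\<^sub>R q"
    have q1: "norm q = 1" using q by simp
    have nu: "norm u = 1 + r" using r q1 by (simp add: u_def)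
    have u0: "u \<noteq> 0" using nu r by auto
    have us: "1 < norm u" "norm u < 1 + L" using nu r by auto
    have pu: "polar u = (r, q)" using r unfolding polar_def nu by (simp add: u_def)
    have ue: "(u \<bullet> e) / norm u = q \<bullet> e" using r unfolding nu by (simp add: u_def)
    have harm: "harmonic_cyl L g f" using st by (simp add: steklov_eigenfunction_def)
    obtain G1 H1 where j1: "has_jet (f \<circ> polar) u G1 H1" and l1: "jet_lap (h r) (h' r) u (G1 u) H1 = 0"
      using harmonic_jet[OF harm us] nu by auto
    obtain G2 H2 where j2: "has_jet (f \<circ> polar) (R u) G2 H2" and l2: "jet_lap (h r) (h' r) (R u) (G2 (R u)) H2 = 0"
      using harmonic_jet[OF harm, of "R u"] nu us unfolding nR by auto
    note j2' = has_jet_reflect[where R = R, OF j2 blR sa]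
    have l2': "jet_lap (h r) (h' r) u (R (G2 (R u))) (\<lambda>w. R (H2 (R w))) = 0"
      using jet_lap_reflect[OF has_jetD(3)[OF j2] e1 R_def] l2 by simp
    have eva: "\<forall>\<^sub>F t in nhds (norm u - 1). (a has_real_derivative a t * b t) (at t)"
    proof -
      have "\<forall>\<^sub>F t in nhds (norm u - 1). t \<in> {0<..<L}"
        using r nu by (intro eventually_nhds_in_open) auto
      then show ?thesis by (rule eventually_mono) (simp add: a'')
    qed
    have a2u: "((\<lambda>r. a r * b r) has_real_derivative a2 r) (at (norm u - 1))"
      using a2[OF r] nu by simp
    obtain G3 H3 where j3: "has_jet (\<lambda>v. a (norm v - 1) * \<psi> ((v \<bullet> e) / norm v)) u G3 H3"
      and l3: "\<And>k m. k \<noteq> 0 \<Longrightarrow> jet_lap k m u (G3 u) H3 =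
       \<psi> (q \<bullet> e) * (a2 r + real (DIM(real^'n) - 1) * m / k * (a r * b r))
       + a r / k\<^sup>2 * ((1 - (q \<bullet> e)\<^sup>2) * (- \<delta> * N) - real (DIM(real^'n) - 1) * (q \<bullet> e) * \<psi>1 (q \<bullet> e))"
      using jet_separated[OF u0 eva a2u \<psi>', of e] unfolding ue ee using nu by auto
    have hr: "h r > 0" using h_pos r by simp
    have "jet_lap (h r) (h' r) u (G3 u) H3 = \<psi> (q \<bullet> e) * (a2 r + N * h' r / h r * (a r * b r))
       + a r / (h r)\<^sup>2 * ((1 - (q \<bullet> e)\<^sup>2) * (- \<delta> * N) - N * (q \<bullet> e) * \<psi>1 (q \<bullet> e))"
      using l3[of "h r" "h' r"] hr by (simp add: N)
    also have "\<dots> \<le> \<psi> (q \<bullet> e) * (\<Lambda> * a r / (h r)\<^sup>2)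
       + a r / (h r)\<^sup>2 * ((1 - (q \<bullet> e)\<^sup>2) * (- \<delta> * N) - N * (q \<bullet> e) * \<psi>1 (q \<bullet> e))"
      using a2_le[OF r] \<psi>_pos[of "q \<bullet> e"] qe qe1 by (intro add_right_mono mult_left_mono) auto
    also have "\<dots> = a r / (h r)\<^sup>2 * (\<Lambda> * \<psi> (q \<bullet> e) + ((1 - (q \<bullet> e)\<^sup>2) * (- \<delta> * N) - N * (q \<bullet> e) * \<psi>1 (q \<bullet> e)))"
      by (simp add: algebra_simps)
    also have "\<dots> < 0"
      using \<psi>_neg[of "q \<bullet> e"] qe qe1 a_pos[of r] hr by (intro mult_pos_neg) auto
    finally have l3: "jet_lap (h r) (h' r) u (G3 u) H3 < 0" .
    note j = has_jet_diff[OF has_jet_diff[OF j1 j2'] has_jet_cmult[OF j3, of K]]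
    let ?\<Phi> = "\<lambda>v. (f \<circ> polar) v - (f \<circ> polar) (R v) - K * (a (norm v - 1) * \<psi> ((v \<bullet> e) / norm v))"
    have val: "?\<Phi> v
        = fd (polar v) - K * w (polar v)" for v
      by (simp add: fd_def w_def polar_def nR Rsc divide_inverse mult.commute)
    have max: "\<forall>\<^sub>F v in nhds u. ?\<Phi> v
       \<le> ?\<Phi> u"
    proof -
      have 0: "fd (polar u) - K * w (polar u) = 0" using fdx0 by (simp add: pu rq)
      have "open ((ball 0 (1 + L) - cball 0 1) \<inter> {v :: real^'n. 0 < v \<bullet> e})"
        by (intro open_Int open_Diff open_ball closed_cball open_Collect_less continuous_intros)
      moreover have "u \<in> (ball 0 (1 + L) - cball 0 1) \<inter> {v :: real^'n. 0 < v \<bullet> e}"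
        using us qe r by (auto simp: u_def q1)
      ultimately have "\<forall>\<^sub>F v in nhds u. v \<in> (ball 0 (1 + L) - cball 0 1) \<inter> {v :: real^'n. 0 < v \<bullet> e}"
        by (rule eventually_nhds_in_open)
      then show ?thesis
      proof (rule eventually_mono)
        fix v :: "real^'n" assume v: "v \<in> (ball 0 (1 + L) - cball 0 1) \<inter> {v :: real^'n. 0 < v \<bullet> e}"
        then have "v \<noteq> 0" by auto
        with v have "polar v \<in> D" by (auto simp: D_def polar_def cyl_def)
        then show "?\<Phi> v
          \<le> ?\<Phi> u"
          unfolding val 0 by (rule \<Phi>)
      qed
    qed
    note lm = has_jet_local_max[OF j max]
    have "jet_lap (h r) (h' r) u (G1 u - R (G2 (R u)) - K *\<^sub>R G3 u) (\<lambda>w. H1 w - R (H2 (R w)) - K *\<^sub>R H3 w) \<le> 0"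
      unfolding lm(1) by (rule jet_lap_nonpos[OF has_jetD(3)[OF j] u0 lm(2)])
    then have "0 - 0 - K * jet_lap (h r) (h' r) u (G3 u) H3 \<le> 0"
      unfolding jet_lap_diff jet_lap_cmult l1 l2' .
    then show False using mult_pos_neg[OF K l3] by linarith
  qed
qed

lemma radial_eigenvalue:
  assumes st: "steklov_eigenfunction L g \<sigma> f"
    and rad: "\<And>r p q. r \<in> {0..L} \<Longrightarrow> p \<in> sphere 0 1 \<Longrightarrow> q \<in> sphere 0 1 \<Longrightarrow> f (r, p) = f (r, q)"
    and J: "\<And>r. r \<in> {0..L} \<Longrightarrow> (J has_real_derivative 1 / h r ^ N) (at r within {0..L})"
    and I: "\<sigma> * (J L - J 0) \<noteq> 2"
  shows "\<exists>c. \<forall>x\<in>cyl L. f x = c"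
proof -
  obtain U where U: "open U" "cyl L \<subseteq> U" "Ck_on (Suc (Suc 0)) U f"
    using st unfolding steklov_eigenfunction_def harmonic_cyl_def smooth_near_def by blast
  have harm: "\<And>u. 1 < norm u \<Longrightarrow> norm u < 1 + L \<Longrightarrow> laplace_beltrami g polar f u = 0"
    using st by (simp add: steklov_eigenfunction_def harmonic_cyl_def)
  define p :: "real^'n" where "p = axis undefined 1"
  have p: "p \<in> sphere 0 1" by (simp add: p_def)
  have c: "(r, p) \<in> cyl L" if "r \<in> {0..L}" for r using that p by (simp add: cyl_def)
  define a where "a r = f (r, p)" for r
  define d where "d x = frechet_derivative f (at x) (1, 0)" for x
  define a' where "a' r = d (r, p)" for r
  have a': "(a has_real_derivative a' r) (at r)" if "r \<in> {0..L}" for r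
    unfolding a_def a'_def d_def
    using U c[OF that] by (intro has_derivative_slice) (auto simp: frechet_derivative_works)
  have d: "(d has_derivative frechet_derivative d (at x)) (at x)" if "x \<in> U" for x
  proof -
    have "(1, 0) \<in> (Basis :: 'n point set)" by (simp add: Basis_prod_def)
    then have "d differentiable (at x)" using U(3) that unfolding d_def by auto
    then show ?thesis by (simp add: frechet_derivative_works)
  qed
  define a2 where "a2 r = frechet_derivative d (at (r, p)) (1, 0)" for r
  have a2: "(a' has_real_derivative a2 r) (at r)" if "r \<in> {0..L}" for r
    unfolding a'_def a2_def using U c[OF that] by (intro has_derivative_slice d) auto
  have ode: "a2 r + N * h' r / h r * a' r = 0" if r: "0 < r" "r < L" for r
  proof -
    define u :: "real^'n" where "u = (1 + r) *\<^sub>R p"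
    have nu: "norm u = 1 + r" using r p by (simp add: u_def)
    have u0: "u \<noteq> 0" using nu r by auto
    have eva: "\<forall>\<^sub>F t in nhds (norm u - 1). (a has_real_derivative a' t) (at t)"
    proof -
      have "\<forall>\<^sub>F t in nhds (norm u - 1). t \<in> {0<..<L}"
        using r nu by (intro eventually_nhds_in_open) auto
      then show ?thesis by (rule eventually_mono) (simp add: a')
    qed
    have a2u: "(a' has_real_derivative a2 r) (at (norm u - 1))"
      using a2[of r] r nu by simp
    have one: "((\<lambda>s. 1) has_real_derivative (\<lambda>s. 0) s) (at s)" "((\<lambda>s. 0) has_real_derivative (\<lambda>s. 0) s) (at s)" for s :: real
      by auto
    obtain G H where j: "has_jet (\<lambda>v. a (norm v - 1) * 1) u G H"
      and l: "\<And>k m. k \<noteq> 0 \<Longrightarrow> jet_lap k m u (G u) H = a2 r + real (DIM(real^'n) - 1) * m / k * a' r"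
      using jet_separated[OF u0 eva a2u one, of 0] nu by auto
    have "open (ball 0 (1 + L) - cball (0 :: real^'n) 1)" by (auto intro: open_Diff)
    moreover have "u \<in> ball 0 (1 + L) - cball 0 1" using nu r by auto
    ultimately have "\<forall>\<^sub>F v in nhds u. v \<in> ball 0 (1 + L) - cball 0 1" by (rule eventually_nhds_in_open)
    then have "\<forall>\<^sub>F v in nhds u. a (norm v - 1) * 1 = (f \<circ> polar) v"
    proof (rule eventually_mono)
      fix v :: "real^'n" assume "v \<in> ball 0 (1 + L) - cball 0 1"
      then have "v \<noteq> 0" "norm v - 1 \<in> {0..L}" by auto
      then show "a (norm v - 1) * 1 = (f \<circ> polar) v"
        using rad[of "norm v - 1" p "v /\<^sub>R norm v"] p by (simp add: a_def polar_def)
    qed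
    from has_jet_cong[OF j this] have j: "has_jet (f \<circ> polar) u G H" .
    have hd: "(h has_real_derivative h' r) (at (norm u - 1))" using h'[of r] r nu by simp
    have hr: "h r > 0" using h_pos r by simp
    have "laplace_beltrami g polar f u = jet_lap (h r) (h' r) u (G u) H"
      using laplace_beltrami_polar[OF n3 g h_pos _ _ hd j] nu r by simp
    then show ?thesis using l[of "h r" "h' r"] hr harm[of u] nu r by (simp add: N)
  qed
  define F where "F r = h r ^ N * a' r" for r
  have F': "(F has_real_derivative h r ^ N * (a2 r + N * h' r / h r * a' r)) (at r)" if "r \<in> {0..L}" for r
  proof -
    have hr: "h r > 0" using h_pos that by simp
    have hS: "h r ^ N = h r * h r ^ (N - Suc 0)" using N2 by (cases N) auto
    have "h r ^ N * (a2 r + N * h' r / h r * a' r)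
        = of_nat N * (h' r * h r ^ (N - Suc 0)) * a' r + a2 r * h r ^ N"
      using hr by (simp add: hS distrib_left)
    then show ?thesis unfolding F_def
      using DERIV_mult[OF DERIV_power[OF h'[OF that], of N] a2[OF that]] by simp
  qed
  have cF: "continuous_on {0..L} F"
    by (rule DERIV_continuous_on) (rule has_field_derivative_at_within[OF F'])
  have F0: "(F has_real_derivative 0) (at r)" if "0 < r" "r < L" for r
    using F'[of r] ode[OF that] that by simp
  have Fc: "F r = F 0" if "r \<in> {0..L}" for r
    by (rule DERIV_isconst2[OF L cF F0]) (use that in auto)
  have sl: "F 0 = - \<sigma> * a 0" "F L = \<sigma> * a L"
    using DERIV_unique[OF a' steklov_slice(1)[OF st p, folded a_def]]
      DERIV_unique[OF a' steklov_slice(2)[OF st p, folded a_def]] L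
    by (simp_all add: F_def h0 hL)
  define E where "E r = a r - F 0 * J r" for r
  have E': "(E has_real_derivative 0) (at r within {0..L})" if r: "r \<in> {0..L}" for r
  proof -
    have "h r > 0" using h_pos r by simp
    then have "a' r - F 0 * (1 / h r ^ N) = 0" using Fc[OF r] by (simp add: F_def field_simps)
    then show ?thesis
      unfolding E_def using DERIV_diff[OF has_field_derivative_at_within[OF a'[OF r]] DERIV_cmult[OF J[OF r]], of "F 0"]
      by simp
  qed
  have Ec: "E r = E 0" if "r \<in> {0..L}" for r
  proof -
    have "continuous_on {0..L} E" by (rule DERIV_continuous_on) (rule E')
    moreover have "(E has_real_derivative 0) (at r)" if "0 < r" "r < L" for r
      using E'[of r] that by (simp add: at_within_Icc_at)
    ultimately show ?thesis by (rule DERIV_isconst2[OF L]) (use that in auto)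
  qed
  have "a L - a 0 = F 0 * (J L - J 0)" using Ec[of L] L by (simp add: E_def algebra_simps)
  moreover have "2 * F 0 = \<sigma> * (a L - a 0)"
  proof -
    have "F L = F 0" by (rule Fc) (use L in simp)
    with sl have "F 0 + F 0 = \<sigma> * a L - \<sigma> * a 0" by linarith
    then show ?thesis by (simp only: right_diff_distrib mult_2)
  qed
  ultimately have "2 * F 0 = \<sigma> * (F 0 * (J L - J 0))" by (simp only:)
  then have "F 0 * (\<sigma> * (J L - J 0) - 2) = 0" by (simp add: algebra_simps)
  then have "F 0 = 0" using I by simp
  then have ac: "a r = a 0" if "r \<in> {0..L}" for r using Ec[OF that] by (simp add: E_def)
  have "f x = a 0" if "x \<in> cyl L" for x
  proof -
    have x: "fst x \<in> {0..L}" "snd x \<in> sphere 0 1" using that by (auto simp: cyl_def)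
    from rad[OF this p] have "f x = a (fst x)" by (simp add: a_def)
    then show ?thesis using ac[OF x(1)] by simp
  qed
  then show ?thesis by blast
qed

lemma steklov_eigenfunction_separated:
  fixes a P :: "real \<Rightarrow> real" and e :: "real^'n"
  assumes V: "open V" "{0..L} \<subseteq> V" "\<And>k. Ck_on k V a"
    and a: "\<And>r. r \<in> {0..L} \<Longrightarrow> (a has_real_derivative P r / h r ^ N) (at r)"
    and P: "\<And>r. r \<in> {0..L} \<Longrightarrow> (P has_real_derivative \<nu> * h r ^ (N - 2) * a r) (at r)"
    and bd: "P 0 = - \<sigma> * a 0" "P L = \<sigma> * a L"
    and \<nu>: "e = 0 \<and> \<nu> = 0 \<or> c = 0 \<and> \<nu> = real N"
  shows "steklov_eigenfunction L g \<sigma> (\<lambda>x. a (fst x) * (c + snd x \<bullet> e))"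
proof -
  define f where "f x = a (fst x) * (c + snd x \<bullet> e)" for x :: "'n point"
  have UV: "open (V \<times> (UNIV :: (real^'n) set))" by (intro open_Times V open_UNIV)
  have Ck: "Ck_on k (V \<times> UNIV) f" for k
    unfolding f_def
    by (intro Ck_on_mult Ck_on_add Ck_on_const Ck_on_compose_fst UV V Ck_on_bounded_linear
        bounded_linear_compose[OF bounded_linear_inner_left bounded_linear_snd])
  have sm: "smooth_near (cyl L) f"
    unfolding smooth_near_def using UV Ck V(2) by (auto simp: cyl_def)
  have a'': "((\<lambda>r. P r / h r ^ N) has_real_derivative
      \<nu> * a r / (h r)\<^sup>2 - N * h' r / h r * (P r / h r ^ N)) (at r)" if r: "r \<in> {0..L}" for r
  proof -
    have hr: "h r > 0" using h_pos that by simp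
    have hS: "h r ^ N = h r * h r ^ (N - Suc 0)" using N2 by (cases N) auto
    have h2: "h r ^ N = h r ^ (N - 2) * (h r)\<^sup>2" using N2 by (metis le_add_diff_inverse2 power_add)
    have "((\<lambda>r. P r / h r ^ N) has_real_derivative
        (\<nu> * h r ^ (N - 2) * a r * h r ^ N - P r * (N * h r ^ (N - 1) * h' r)) / (h r ^ N * h r ^ N)) (at r)"
      using hr by (auto intro!: derivative_eq_intros P[OF r] h'[OF r])
    moreover have "(\<nu> * h r ^ (N - 2) * a r * h r ^ N - P r * (N * h r ^ (N - 1) * h' r)) / (h r ^ N * h r ^ N)
      = \<nu> * a r * (h r ^ (N - 2) / h r ^ N) - N * h' r * (h r ^ (N - 1) / h r ^ N) * (P r / h r ^ N)"
      using hr by (simp add: field_simps)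
    moreover have X: "h r ^ (N - 2) / h r ^ N = 1 / (h r)\<^sup>2" using hr unfolding h2 by simp
    moreover have Y: "h r ^ (N - 1) / h r ^ N = 1 / h r" using hr unfolding hS by simp
    ultimately have "((\<lambda>r. P r / h r ^ N) has_real_derivative
        \<nu> * a r * (1 / (h r)\<^sup>2) - N * h' r * (1 / h r) * (P r / h r ^ N)) (at r)"
      by (simp only:)
    then show ?thesis by simp
  qed
  have "laplace_beltrami g polar f u = 0" if u: "1 < norm u" "norm u < 1 + L" for u
  proof -
    define r where "r = norm u - 1"
    have r: "0 < r" "r < L" using u by (auto simp: r_def)
    have u0: "u \<noteq> 0" using u by auto
    have eva: "\<forall>\<^sub>F t in nhds (norm u - 1). (a has_real_derivative P t / h t ^ N) (at t)"
    proof -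
      have "\<forall>\<^sub>F t in nhds (norm u - 1). t \<in> {0<..<L}"
        using u by (intro eventually_nhds_in_open) auto
      then show ?thesis by (rule eventually_mono) (simp add: a)
    qed
    have lin: "((\<lambda>s. c + s) has_real_derivative (\<lambda>s. 1) s) (at s)" "((\<lambda>s. 1) has_real_derivative (\<lambda>s. 0) s) (at s)" for s :: real
      by (auto intro!: derivative_eq_intros)
    define s where "s = (u \<bullet> e) / norm u"
    have r': "norm u - 1 \<in> {0..L}" using u by auto
    have hr: "h r > 0" using h_pos r by simp
    obtain G H where j: "has_jet (\<lambda>v. a (norm v - 1) * (c + (v \<bullet> e) / norm v)) u G H"
      and l: "\<And>k m. k \<noteq> 0 \<Longrightarrow> jet_lap k m u (G u) H =
        (c + s) * ((\<nu> * a r / (h r)\<^sup>2 - N * h' r / h r * (P r / h r ^ N)) + real (DIM(real^'n) - 1) * m / k * (P r / h r ^ N))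
        + a r / k\<^sup>2 * ((e \<bullet> e - s\<^sup>2) * 0 - real (DIM(real^'n) - 1) * s * 1)"
      using jet_separated[OF u0 eva a''[OF r'] lin, of e] unfolding r_def s_def by blast
    have "(\<lambda>v. a (norm v - 1) * (c + (v \<bullet> e) / norm v)) = f \<circ> polar"
      by (auto simp: f_def polar_def divide_inverse mult.commute)
    with j have j: "has_jet (f \<circ> polar) u G H" by simp
    have "laplace_beltrami g polar f u = jet_lap (h r) (h' r) u (G u) H"
      unfolding r_def using laplace_beltrami_polar[OF n3 g h_pos u h'[OF r'] j] by simp
    also have "\<dots> = (c + s) * (\<nu> * a r / (h r)\<^sup>2) - a r / (h r)\<^sup>2 * (N * s)"
      using l[of "h r" "h' r"] hr by (simp add: N)
    also have "\<dots> = 0" using \<nu> by (auto simp: s_def mult_ac)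
    finally show ?thesis .
  qed
  with sm have harm: "harmonic_cyl L g f" by (simp add: harmonic_cyl_def)
  have "frechet_derivative f (at x) \<nu>' = \<sigma> * f x" if x: "x \<in> cyl_boundary L" "outward_unit_normal L g x \<nu>'" for x \<nu>'
  proof -
    obtain r p where rp: "x = (r, p)" by (cases x)
    have r: "r = 0 \<or> r = L" using x(1) unfolding rp by (auto simp: cyl_boundary_def)
    have rL: "r \<in> {0..L}" using r L by auto
    have "\<forall>x\<in>V \<times> UNIV. f differentiable (at x)" using Ck[of "Suc 0"] by simp
    moreover have "x \<in> V \<times> UNIV" using V(2) rL rp by auto
    ultimately have "f differentiable (at x)" by (rule bspec)
    then have D: "(f has_derivative frechet_derivative f (at x)) (at x)" by (simp add: frechet_derivative_works)
    then interpret bounded_linear "frechet_derivative f (at x)" by (rule has_derivative_bounded_linear)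
    have "((\<lambda>t. f (t, p)) has_real_derivative P r / h r ^ N * (c + p \<bullet> e)) (at r)"
      using DERIV_cmult_right[OF a[OF rL], of "c + p \<bullet> e"] by (simp only: f_def fst_conv snd_conv)
    note DERIV_unique[OF has_derivative_slice[OF D[unfolded rp]] this]
    then have d: "frechet_derivative f (at x) (1, 0) = P r / h r ^ N * (c + p \<bullet> e)"
      unfolding rp .
    have \<nu>': "\<nu>' = (if r = 0 then -1 else 1, 0)"
      using x(2) unfolding outward_unit_normal_iff[OF x(1)] unfolding rp fst_conv .
    show ?thesis
    proof (cases "r = 0")
      case True
      then have "\<nu>' = - (1, 0)" using \<nu>' by simp
      then have "frechet_derivative f (at x) \<nu>' = - (P 0 / h 0 ^ N * (c + p \<bullet> e))"
        using d True by (simp only: neg)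
      then show ?thesis unfolding True rp h0 bd(1) f_def fst_conv snd_conv by simp
    next
      case False
      then have "\<nu>' = (1, 0)" "r = L" using \<nu>' r by simp_all
      then have "frechet_derivative f (at x) \<nu>' = P L / h L ^ N * (c + p \<bullet> e)"
        using d by (simp only:)
      then show ?thesis unfolding \<open>r = L\<close> rp hL bd(2) f_def fst_conv snd_conv by simp
    qed
  qed
  with harm have "steklov_eigenfunction L g \<sigma> f" unfolding steklov_eigenfunction_def by blast
  moreover have "f = (\<lambda>x. a (fst x) * (c + snd x \<bullet> e))" by (rule ext) (simp only: f_def)
  ultimately show ?thesis by (simp only:)
qed

end

section \<open>Linear systems of ordinary differential equations\<close>

lemma antiderivative_exp_bound:
  fixes F f :: "real \<Rightarrow> real"
  assumes F: "\<And>x. x \<in> {A..B} \<Longrightarrow> (F has_real_derivative f x) (at x within {A..B})" and F0: "F c = 0"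
    and f: "\<And>x. x \<in> {A..B} \<Longrightarrow> \<bar>f x\<bar> \<le> K * w * exp (w * \<bar>x - c\<bar>)"
    and K: "K \<ge> 0" and c: "c \<in> {A..B}" and x: "x \<in> {A..B}"
  shows "\<bar>F x\<bar> \<le> K * exp (w * \<bar>x - c\<bar>)"
proof -
  have Fi: "(F has_real_derivative f t) (at t)" if "A < t" "t < B" for t
    using F[of t] that by (simp add: at_within_Icc_at)
  have cF: "continuous_on S F" if "S \<subseteq> {A..B}" for S
    by (rule continuous_on_subset[OF DERIV_continuous_on that]) (rule F)
  have "s * F x \<le> K * exp (w * \<bar>x - c\<bar>)" if s: "s = 1 \<or> s = -1" for s :: real
  proof (cases "c \<le> x")
    case True
    have "K * exp (w * (c - c)) - s * F c \<le> K * exp (w * (x - c)) - s * F x"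
    proof (rule DERIV_nonneg_imp_increasing_open[OF True])
      fix t assume t: "c < t" "t < x"
      have "((\<lambda>t. K * exp (w * (t - c)) - s * F t) has_real_derivative K * (w * exp (w * (t - c))) - s * f t) (at t)"
        using t c x by (auto intro!: derivative_eq_intros Fi)
      moreover have "K * (w * exp (w * (t - c))) - s * f t \<ge> 0"
        using f[of t] t c x s by (auto simp: abs_le_iff mult.assoc)
      ultimately show "\<exists>y. ((\<lambda>t. K * exp (w * (t - c)) - s * F t) has_real_derivative y) (at t) \<and> 0 \<le> y"
        by blast
    next
      have "continuous_on {c..x} F" using c x by (intro cF) auto
      then show "continuous_on {c..x} (\<lambda>t. K * exp (w * (t - c)) - s * F t)"
        by (intro continuous_on_diff continuous_on_mult continuous_on_exp continuous_on_const continuous_on_id)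
    qed
    then show ?thesis using K True by (simp add: F0)
  next
    case False
    then have le: "x \<le> c" by simp
    have "K * exp (w * (c - c)) - s * F c \<le> K * exp (w * (c - x)) - s * F x"
    proof (rule DERIV_nonpos_imp_decreasing_open[OF le])
      fix t assume t: "x < t" "t < c"
      have "((\<lambda>t. K * exp (w * (c - t)) - s * F t) has_real_derivative - (K * (w * exp (w * (c - t)))) - s * f t) (at t)"
        using t c x by (auto intro!: derivative_eq_intros Fi)
      moreover have "- (K * (w * exp (w * (c - t)))) - s * f t \<le> 0"
        using f[of t] t c x s by (auto simp: abs_le_iff mult.assoc)
      ultimately show "\<exists>y. ((\<lambda>t. K * exp (w * (c - t)) - s * F t) has_real_derivative y) (at t) \<and> y \<le> 0"
        by blast
    next
      have "continuous_on {x..c} F" using c x by (intro cF) auto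
      then show "continuous_on {x..c} (\<lambda>t. K * exp (w * (c - t)) - s * F t)"
        by (intro continuous_on_diff continuous_on_mult continuous_on_exp continuous_on_const continuous_on_id)
    qed
    then show ?thesis using K False by (simp add: F0)
  qed
  from this[of 1] this[of "-1"] show ?thesis by (simp add: abs_le_iff)
qed

lemma nonneg_antiderivative:
  fixes F f :: "real \<Rightarrow> real"
  assumes F: "\<And>x. x \<in> {A..B} \<Longrightarrow> (F has_real_derivative f x) (at x within {A..B})"
    and f: "\<And>x. x \<in> {c..B} \<Longrightarrow> f x \<ge> 0" and c: "c \<in> {A..B}" and x: "x \<in> {c..B}"
  shows "F c \<le> F x"
proof (rule DERIV_nonneg_imp_increasing_open[of c x F])
  show "c \<le> x" using x by simp
  show "\<exists>y. (F has_real_derivative y) (at t) \<and> 0 \<le> y" if "c < t" "t < x" for t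
    using F[of t] f[of t] that c x by (auto simp: at_within_Icc_at)
  have "continuous_on {A..B} F" by (rule DERIV_continuous_on) (rule F)
  then show "continuous_on {c..x} F" by (rule continuous_on_subset) (use c x in auto)
qed

text \<open>Picard iteration as a series: the \<open>n\<close>-th term is bounded by
  \<open>2\<^sup>-\<^sup>n e\<^sup>2\<^sup>M\<^sup>|\<^sup>r\<^sup>-\<^sup>c\<^sup>|\<close>, where \<open>M\<close> bounds the coefficients.\<close>

lemma linear_system_solution:
  fixes \<alpha> \<beta> :: "real \<Rightarrow> real"
  assumes \<alpha>: "continuous_on {A..B} \<alpha>" "\<And>r. r \<in> {A..B} \<Longrightarrow> \<alpha> r \<ge> 0"
    and \<beta>: "continuous_on {A..B} \<beta>" "\<And>r. r \<in> {A..B} \<Longrightarrow> \<beta> r \<ge> 0" and c: "c \<in> {A..B}"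
  obtains v p where
    "\<And>r. r \<in> {A..B} \<Longrightarrow> (v has_real_derivative \<alpha> r * p r) (at r within {A..B})"
    "\<And>r. r \<in> {A..B} \<Longrightarrow> (p has_real_derivative \<beta> r * v r) (at r within {A..B})"
    "v c = 0" "p c = 1" "\<And>r. r \<in> {c..B} \<Longrightarrow> v r \<ge> 0" "\<And>r. r \<in> {c..B} \<Longrightarrow> p r \<ge> 1"
proof -
  have "bounded (\<alpha> ` {A..B})" "bounded (\<beta> ` {A..B})"
    using compact_continuous_image[OF \<alpha>(1) compact_Icc] compact_continuous_image[OF \<beta>(1) compact_Icc]
    by (auto intro: compact_imp_bounded)
  then obtain M1 M2 where "\<forall>r\<in>{A..B}. \<bar>\<alpha> r\<bar> \<le> M1" "\<forall>r\<in>{A..B}. \<bar>\<beta> r\<bar> \<le> M2"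
    unfolding bounded_iff ball_simps real_norm_def by blast
  then have "max 1 (max M1 M2) > 0" "\<bar>\<alpha> r\<bar> \<le> max 1 (max M1 M2)" "\<bar>\<beta> r\<bar> \<le> max 1 (max M1 M2)"
    if "r \<in> {A..B}" for r using that by force+
  then obtain M where M: "M > 0" "\<And>r. r \<in> {A..B} \<Longrightarrow> \<bar>\<alpha> r\<bar> \<le> M" "\<And>r. r \<in> {A..B} \<Longrightarrow> \<bar>\<beta> r\<bar> \<le> M"
    using c by blast
  define E where "E n r = (1/2) ^ n * exp (2 * M * \<bar>r - c\<bar>)" for n :: nat and r
  define good where "good n f \<longleftrightarrow> continuous_on {A..B} f \<and> (\<forall>r\<in>{A..B}. \<bar>f r\<bar> \<le> E n r) \<and> (\<forall>r\<in>{c..B}. f r \<ge> 0)"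
    for n and f :: "real \<Rightarrow> real"
  define step where "step \<gamma> f F \<longleftrightarrow> F c = 0 \<and> (\<forall>r\<in>{A..B}. (F has_real_derivative \<gamma> r * f r) (at r within {A..B}))"
    for \<gamma> f F :: "real \<Rightarrow> real"
  have ex: "\<exists>F. good (Suc n) F \<and> step \<gamma> f F"
    if f: "good n f" and \<gamma>: "continuous_on {A..B} \<gamma>" "\<And>r. r \<in> {A..B} \<Longrightarrow> \<gamma> r \<ge> 0" "\<And>r. r \<in> {A..B} \<Longrightarrow> \<bar>\<gamma> r\<bar> \<le> M"
    for n f \<gamma>
  proof -
    have "continuous_on {A..B} (\<lambda>r. \<gamma> r * f r)"
      using f \<gamma> by (intro continuous_on_mult) (auto simp: good_def)
    then obtain F0 where F0: "\<And>r. r \<in> {A..B} \<Longrightarrow> (F0 has_real_derivative \<gamma> r * f r) (at r within {A..B})"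
      using antiderivative_continuous unfolding has_real_derivative_iff_has_vector_derivative by blast
    define F where "F r = F0 r - F0 c" for r
    have F: "(F has_real_derivative \<gamma> r * f r) (at r within {A..B})" if "r \<in> {A..B}" for r
      unfolding F_def using DERIV_diff[OF F0[OF that] DERIV_const] by simp
    have Fc: "F c = 0" by (simp add: F_def)
    have "continuous_on {A..B} F" by (rule DERIV_continuous_on) (rule F)
    moreover have "\<bar>F r\<bar> \<le> E (Suc n) r" if r: "r \<in> {A..B}" for r
    proof -
      have "\<bar>F r\<bar> \<le> (1/2) ^ Suc n * exp (2 * M * \<bar>r - c\<bar>)"
      proof (rule antiderivative_exp_bound[OF F Fc _ _ c r])
        fix t assume t: "t \<in> {A..B}"
        have "\<bar>\<gamma> t * f t\<bar> \<le> M * E n t"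
          unfolding abs_mult using f t \<gamma>(3)[OF t] by (intro mult_mono) (auto simp: good_def)
        then show "\<bar>\<gamma> t * f t\<bar> \<le> (1/2) ^ Suc n * (2 * M) * exp (2 * M * \<bar>t - c\<bar>)"
          by (simp add: E_def mult_ac)
      qed auto
      then show ?thesis by (simp add: E_def)
    qed
    moreover have "F r \<ge> 0" if r: "r \<in> {c..B}" for r
    proof -
      have "F c \<le> F r"
        using f \<gamma>(2) c by (intro nonneg_antiderivative[OF F _ c r]) (auto simp: good_def)
      then show ?thesis by (simp add: Fc)
    qed
    ultimately show ?thesis using F Fc unfolding good_def step_def by blast
  qed
  have "\<exists>z. \<forall>n. (good n (fst (z n)) \<and> good n (snd (z n)) \<and> (n = 0 \<longrightarrow> z n = ((\<lambda>r. 0), (\<lambda>r. 1)))) \<and>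
      (step \<alpha> (snd (z n)) (fst (z (Suc n))) \<and> step \<beta> (fst (z n)) (snd (z (Suc n))))"
  proof (rule dependent_nat_choice)
    show "\<exists>z. good 0 (fst z) \<and> good 0 (snd z) \<and> (0 = (0::nat) \<longrightarrow> z = ((\<lambda>r. 0), (\<lambda>r. 1)))"
      using M(1) by (intro exI[of _ "((\<lambda>r. 0), (\<lambda>r. 1))"]) (auto simp: good_def E_def)
    fix z :: "(real \<Rightarrow> real) \<times> (real \<Rightarrow> real)" and n :: nat
    assume z: "good n (fst z) \<and> good n (snd z) \<and> (n = 0 \<longrightarrow> z = ((\<lambda>r. 0), (\<lambda>r. 1)))"
    obtain F where F: "good (Suc n) F" "step \<alpha> (snd z) F" using ex[of n "snd z" \<alpha>] z \<alpha> M by blast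
    obtain G where G: "good (Suc n) G" "step \<beta> (fst z) G" using ex[of n "fst z" \<beta>] z \<beta> M by blast
    show "\<exists>z'. (good (Suc n) (fst z') \<and> good (Suc n) (snd z') \<and> (Suc n = 0 \<longrightarrow> z' = ((\<lambda>r. 0), (\<lambda>r. 1)))) \<and>
       step \<alpha> (snd z) (fst z') \<and> step \<beta> (fst z) (snd z')"
      using F G by (intro exI[of _ "(F, G)"]) auto
  qed
  then obtain z where z: "\<And>n. good n (fst (z n))" "\<And>n. good n (snd (z n))" "z 0 = ((\<lambda>r. 0), (\<lambda>r. 1))"
    "\<And>n. step \<alpha> (snd (z n)) (fst (z (Suc n)))" "\<And>n. step \<beta> (fst (z n)) (snd (z (Suc n)))"
    by blast
  define V where "V n = fst (z n)" for n
  define P where "P n = snd (z n)" for n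
  have V: "good n (V n)" and P: "good n (P n)" for n using z by (auto simp: V_def P_def)
  have V0: "V 0 = (\<lambda>r. 0)" and P0: "P 0 = (\<lambda>r. 1)" using z(3) by (auto simp: V_def P_def)
  have VS: "step \<alpha> (P n) (V (Suc n))" and PS: "step \<beta> (V n) (P (Suc n))" for n using z by (auto simp: V_def P_def)
  define X where "X = exp (2 * M * (B - A))"
  have EX: "E n r \<le> (1/2) ^ n * X" if "r \<in> {A..B}" for n r
    unfolding E_def X_def using that c M(1) by (intro mult_left_mono) auto
  have bX: "\<bar>f r\<bar> \<le> (1/2) ^ n * X" if "good n f" "r \<in> {A..B}" for n f r
    using that EX[OF that(2), of n] by (force simp: good_def)
  have sX: "summable (\<lambda>n. (1/2) ^ n * X)" by (intro summable_mult2 summable_geometric) simp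
  have sm: "summable (\<lambda>n. W n r)" if "\<And>n. good n (W n)" "r \<in> {A..B}" for W r
    by (rule summable_comparison_test'[OF sX, of 0]) (use bX[OF that(1) that(2)] in simp)
  have der: "((\<lambda>r. \<Sum>n. W n r) has_real_derivative \<gamma> r * (\<Sum>n. Z n r)) (at r within {A..B})"
    if W: "\<And>n. good n (W n)" and Z: "\<And>n. good n (Z n)" and k: "W 0 = (\<lambda>r. k)" and WS: "\<And>n. step \<gamma> (Z n) (W (Suc n))"
      and \<gamma>: "\<And>r. r \<in> {A..B} \<Longrightarrow> \<bar>\<gamma> r\<bar> \<le> M" and r: "r \<in> {A..B}" for W Z \<gamma> k r
  proof -
    define D where "D n = (case n of 0 \<Rightarrow> (\<lambda>r. 0) | Suc m \<Rightarrow> (\<lambda>r. \<gamma> r * Z m r))" for n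
    have d: "(W n has_real_derivative D n r) (at r within {A..B})" if "r \<in> {A..B}" for n r
      using that WS by (cases n) (auto simp: D_def k step_def)
    have bD: "\<bar>D n r\<bar> \<le> M * (2 * ((1/2) ^ n * X))" if "r \<in> {A..B}" for n r
    proof (cases n)
      case 0
      then show ?thesis using M(1) by (simp add: D_def X_def)
    next
      case (Suc m)
      have "\<bar>\<gamma> r * Z m r\<bar> \<le> M * ((1/2) ^ m * X)"
        unfolding abs_mult using \<gamma>[OF that] bX[OF Z that] M(1) by (intro mult_mono) auto
      then show ?thesis by (simp add: D_def Suc)
    qed
    have "uniform_limit {A..B} (\<lambda>n r. \<Sum>i<n. D i r) (\<lambda>r. \<Sum>i. D i r) sequentially"
      by (rule Weierstrass_m_test[of _ _ "\<lambda>n. M * (2 * ((1/2) ^ n * X))"])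
        (use bD sX in \<open>auto intro!: summable_mult\<close>)
    moreover have "convex {A..B}" by (rule convex_real_interval)
    ultimately have "\<exists>g. \<forall>t\<in>{A..B}. (\<lambda>n. W n t) sums g t \<and> (g has_real_derivative (\<Sum>i. D i t)) (at t within {A..B})"
      using has_field_derivative_series[OF _ d _ r sm[OF W r]] by blast
    then obtain g where g: "\<And>t. t \<in> {A..B} \<Longrightarrow> (\<lambda>n. W n t) sums g t"
      "\<And>t. t \<in> {A..B} \<Longrightarrow> (g has_real_derivative (\<Sum>i. D i t)) (at t within {A..B})" by blast
    have "(\<Sum>i. D i r) = \<gamma> r * (\<Sum>n. Z n r)"
    proof -
      have s: "summable (\<lambda>n. D (Suc n) r)" using summable_mult[OF sm[OF Z r]] by (simp add: D_def)
      then have "summable (\<lambda>n. D n r)" by (subst (asm) summable_Suc_iff)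
      from suminf_split_head[OF this] have "(\<Sum>i. D i r) = (\<Sum>n. D (Suc n) r)" by (simp add: D_def)
      also have "\<dots> = \<gamma> r * (\<Sum>n. Z n r)" using suminf_mult[OF sm[OF Z r]] by (simp add: D_def)
      finally show ?thesis .
    qed
    with g(2)[OF r] have "(g has_real_derivative \<gamma> r * (\<Sum>n. Z n r)) (at r within {A..B})" by simp
    then show ?thesis
      by (rule has_field_derivative_transform_within[OF _ zero_less_one r]) (use g(1) in \<open>auto dest: sums_unique\<close>)
  qed
  define v where "v r = (\<Sum>n. V n r)" for r
  define p where "p r = (\<Sum>n. P n r)" for r
  show thesis
  proof (rule that[of v p])
    show "(v has_real_derivative \<alpha> r * p r) (at r within {A..B})" if "r \<in> {A..B}" for r
      unfolding v_def p_def by (rule der[OF V P V0 VS M(2) that])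
    show "(p has_real_derivative \<beta> r * v r) (at r within {A..B})" if "r \<in> {A..B}" for r
      unfolding v_def p_def by (rule der[OF P V P0 PS M(3) that])
    have "V n c = 0" for n using V0 VS by (cases n) (auto simp: step_def)
    then show "v c = 0" by (simp add: v_def)
    have "P n c = (if n = 0 then 1 else 0)" for n using P0 PS by (cases n) (auto simp: step_def)
    then show "p c = 1" unfolding p_def using suminf_finite[of "{0}" "\<lambda>n. P n c"] by simp
    fix r assume r: "r \<in> {c..B}"
    then have rA: "r \<in> {A..B}" using c by auto
    show "v r \<ge> 0" unfolding v_def using V r by (intro suminf_nonneg sm V rA) (auto simp: good_def)
    have "sum (\<lambda>n. P n r) {0} \<le> p r"
      unfolding p_def using P r by (intro sum_le_suminf sm rA) (auto simp: good_def)
    then show "p r \<ge> 1" by (simp add: P0)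
  qed
qed

lemma Ck_on_linear_system:
  fixes \<alpha> \<beta> :: "real \<Rightarrow> real"
  assumes "open U" "\<And>k. Ck_on k U \<alpha>" "\<And>k. Ck_on k U \<beta>"
    and v: "\<And>r. r \<in> U \<Longrightarrow> (v has_real_derivative \<alpha> r * p r) (at r)"
    and p: "\<And>r. r \<in> U \<Longrightarrow> (p has_real_derivative \<beta> r * v r) (at r)"
  shows "Ck_on k U v \<and> Ck_on k U p"
proof (induction k)
  case 0
  have "continuous_on U v" by (rule DERIV_continuous_on) (rule has_field_derivative_at_within[OF v])
  moreover have "continuous_on U p" by (rule DERIV_continuous_on) (rule has_field_derivative_at_within[OF p])
  ultimately show ?case by simp
next
  case (Suc k)
  have "Ck_on (Suc k) U v"
    by (rule Ck_on_real_SucI[OF assms(1) v Ck_on_mult[OF assms(1,2)]]) (use Suc in simp_all)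
  moreover have "Ck_on (Suc k) U p"
    by (rule Ck_on_real_SucI[OF assms(1) p Ck_on_mult[OF assms(1,3)]]) (use Suc in simp_all)
  ultimately show ?case by blast
qed

section \<open>Comparison with the tent profile\<close>

definition tent_mode :: "nat \<Rightarrow> real \<Rightarrow> real \<Rightarrow> real" where
  "tent_mode N R \<rho> = N * \<rho> + R ^ Suc N / \<rho> ^ N"

definition tent_flux :: "nat \<Rightarrow> real \<Rightarrow> real \<Rightarrow> real" where
  "tent_flux N R \<rho> = N * (\<rho> ^ N - R ^ Suc N / \<rho>)"

lemma tent_mode_pos: "\<rho> > 0 \<Longrightarrow> R > 0 \<Longrightarrow> tent_mode N R \<rho> > 0"
  by (simp add: tent_mode_def add_nonneg_pos)

lemma tent_flux_neg:
  assumes "0 < \<rho>" "\<rho> < R" "N > 0"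
  shows "tent_flux N R \<rho> < 0"
proof -
  have "\<rho> ^ Suc N < R ^ Suc N" using assms by (intro power_strict_mono) auto
  then have "\<rho> ^ N < R ^ Suc N / \<rho>" using assms(1) by (simp add: field_simps)
  then show ?thesis using assms(3) by (simp add: tent_flux_def mult_pos_neg)
qed

lemma tent_flux_end: "R > 0 \<Longrightarrow> tent_flux N R R = 0"
  by (simp add: tent_flux_def)

lemma DERIV_tent_mode:
  assumes "\<rho> > 0" "N \<ge> 2"
  shows "(tent_mode N R has_real_derivative tent_flux N R \<rho> / \<rho> ^ N) (at \<rho>)"
proof -
  obtain M where M: "N = Suc M" using assms(2) by (cases N) auto
  have "((\<lambda>\<rho>. N * \<rho> + R ^ Suc N / \<rho> ^ N) has_real_derivative
      N * 1 + (0 * \<rho> ^ N - R ^ Suc N * (of_nat N * (1 * \<rho> ^ (N - Suc 0)))) / (\<rho> ^ N * \<rho> ^ N)) (at \<rho>)"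
    using assms(1) by (intro DERIV_add DERIV_cmult DERIV_divide DERIV_power DERIV_ident DERIV_const) auto
  moreover have "N * 1 + (0 * \<rho> ^ N - R ^ Suc N * (of_nat N * (1 * \<rho> ^ (N - Suc 0)))) / (\<rho> ^ N * \<rho> ^ N)
      = tent_flux N R \<rho> / \<rho> ^ N"
    using assms(1) by (simp add: tent_flux_def M field_simps)
  ultimately show ?thesis unfolding tent_mode_def[abs_def] by (simp only:)
qed

lemma DERIV_tent_flux:
  assumes "\<rho> > 0" "N \<ge> 2"
  shows "(tent_flux N R has_real_derivative N * \<rho> ^ (N - 2) * tent_mode N R \<rho>) (at \<rho>)"
proof -
  obtain M where M: "N = Suc (Suc M)" using assms(2) by (metis Suc_diff_Suc diff_Suc_1 le_iff_add add_2_eq_Suc)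
  have "((\<lambda>\<rho>. N * (\<rho> ^ N - R ^ Suc N / \<rho>)) has_real_derivative
      N * (of_nat N * (1 * \<rho> ^ (N - Suc 0)) - (0 * \<rho> - R ^ Suc N * 1) / (\<rho> * \<rho>))) (at \<rho>)"
    using assms(1) by (intro DERIV_diff DERIV_cmult DERIV_divide DERIV_power DERIV_ident DERIV_const) auto
  moreover have "N * (of_nat N * (1 * \<rho> ^ (N - Suc 0)) - (0 * \<rho> - R ^ Suc N * 1) / (\<rho> * \<rho>))
      = N * \<rho> ^ (N - 2) * tent_mode N R \<rho>"
    using assms(1) by (simp add: tent_mode_def M field_simps)
  ultimately show ?thesis unfolding tent_flux_def[abs_def] by (simp only:)
qed

lemma increasing_strict_near_end:
  fixes Z Z' k :: "real \<Rightarrow> real"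
  assumes "l > 0" "continuous_on {0..l} Z"
    and Z: "\<And>r. 0 < r \<Longrightarrow> r < l \<Longrightarrow> (Z has_real_derivative Z' r) (at r)"
    and nonneg: "\<And>r. 0 < r \<Longrightarrow> r < l \<Longrightarrow> Z' r \<ge> 0"
    and k: "continuous_on {0..l} k" "k l > 0"
    and pos: "\<And>r. 0 < r \<Longrightarrow> r < l \<Longrightarrow> k r > 0 \<Longrightarrow> Z' r > 0"
  shows "Z 0 < Z l"
proof -
  have "l \<in> {0..l}" using assms(1) by simp
  then obtain d where d: "d > 0" "\<And>r. r \<in> {0..l} \<Longrightarrow> dist r l < d \<Longrightarrow> dist (k r) (k l) < k l"
    using k unfolding continuous_on_iff by blast
  define \<delta> where "\<delta> = min d l / 2"
  have \<delta>: "0 < \<delta>" "\<delta> < d" "\<delta> < l" using d(1) assms(1) by (auto simp: \<delta>_def min_def)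
  have "Z 0 \<le> Z (l - \<delta>)"
  proof (rule DERIV_nonneg_imp_increasing_open[of 0 "l - \<delta>" Z])
    show "\<exists>y. (Z has_real_derivative y) (at t) \<and> 0 \<le> y" if "0 < t" "t < l - \<delta>" for t
      using Z[of t] nonneg[of t] that \<delta> by auto
    show "continuous_on {0..l - \<delta>} Z"
      by (rule continuous_on_subset[OF assms(2)]) (use \<delta> in auto)
  qed (use \<delta> in simp)
  also have "Z (l - \<delta>) < Z l"
  proof (rule DERIV_pos_imp_increasing_open[of "l - \<delta>" l Z])
    fix t assume t: "l - \<delta> < t" "t < l"
    then have "dist (k t) (k l) < k l" using \<delta> by (intro d(2)) (auto simp: dist_real_def)
    then have "k t > 0" unfolding dist_real_def by linarith
    then show "\<exists>y. (Z has_real_derivative y) (at t) \<and> 0 < y"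
      using Z[of t] pos[of t] t \<delta> by auto
  next
    show "continuous_on {l - \<delta>..l} Z"
      by (rule continuous_on_subset[OF assms(2)]) (use \<delta> in auto)
  qed (use \<delta> in simp_all)
  finally show ?thesis .
qed

text \<open>Picone's identity: with \<open>b\<close> the symmetric first mode for the tent profile \<open>1 + r\<close> and \<open>Q\<close>
  its flux, \<open>Q b - P b\<^sup>2 / a\<close> is monotone because \<open>h \<le> 1 + r\<close>.\<close>

lemma first_mode_less:
  fixes h a P :: "real \<Rightarrow> real"
  assumes l: "l > 0" and N: "N \<ge> 2"
    and ch: "continuous_on {0..l} h" and h: "\<And>r. r \<in> {0..l} \<Longrightarrow> 0 < h r" "\<And>r. r \<in> {0..l} \<Longrightarrow> h r \<le> 1 + r"
    and hl: "h l < 1 + l"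
    and a': "\<And>r. r \<in> {0..l} \<Longrightarrow> (a has_real_derivative P r / h r ^ N) (at r within {0..l})"
    and P': "\<And>r. r \<in> {0..l} \<Longrightarrow> (P has_real_derivative N * h r ^ (N - 2) * a r) (at r within {0..l})"
    and a: "\<And>r. r \<in> {0..l} \<Longrightarrow> a r > 0" and P0: "P 0 = - \<sigma> * a 0" and Pl: "P l \<ge> 0"
  shows "\<sigma> < N * ((1 + l) ^ Suc N - 1) / ((1 + l) ^ Suc N + N)"
proof -
  define b where "b r = tent_mode N (1 + l) (1 + r)" for r
  define Q where "Q r = tent_flux N (1 + l) (1 + r)" for r
  have b: "b r > 0" if "r \<ge> 0" for r using that l by (simp add: b_def tent_mode_pos)
  have b': "(b has_real_derivative Q r / (1 + r) ^ N) (at r)" if "r \<ge> 0" for r :: real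
  proof -
    have "((\<lambda>r. 1 + r) has_real_derivative 0 + 1) (at r)" by (intro DERIV_add DERIV_const DERIV_ident)
    with DERIV_chain2[of "tent_mode N (1 + l)" _ "\<lambda>r. 1 + r" r] DERIV_tent_mode[of "1 + r" N "1 + l"] that N
    show ?thesis unfolding b_def Q_def by fastforce
  qed
  have Q': "(Q has_real_derivative N * (1 + r) ^ (N - 2) * b r) (at r)" if "r \<ge> 0" for r :: real
  proof -
    have "((\<lambda>r. 1 + r) has_real_derivative 0 + 1) (at r)" by (intro DERIV_add DERIV_const DERIV_ident)
    with DERIV_chain2[of "tent_flux N (1 + l)" _ "\<lambda>r. 1 + r" r] DERIV_tent_flux[of "1 + r" N "1 + l"] that N
    show ?thesis unfolding b_def Q_def by fastforce
  qed
  define Z where "Z r = Q r * b r - P r * (b r)\<^sup>2 / a r" for r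
  define Z' where "Z' r = N * ((1 + r) ^ (N - 2) - h r ^ (N - 2)) * (b r)\<^sup>2
      + ((1 + r) ^ N - h r ^ N) * (Q r / (1 + r) ^ N)\<^sup>2
      + (h r ^ N * (Q r / (1 + r) ^ N) - P r / a r * b r)\<^sup>2 / h r ^ N" for r
  have Zd: "(Z has_real_derivative Z' r) (at r within {0..l})" if r: "r \<in> {0..l}" for r
  proof -
    define H A B C where "H = (1 + r) ^ N" and "A = h r ^ N" and "B = (1 + r) ^ (N - 2)" and "C = h r ^ (N - 2)"
    have HA: "H > 0" "A > 0" using r h(1)[OF r] by (auto simp: H_def A_def)
    have r0: "r \<ge> 0" using r by simp
    have "(Z has_real_derivative
       (N * B * b r) * b r + (Q r / H) * Q r
       - ((N * C * a r) * (b r)\<^sup>2 + (of_nat 2 * ((Q r / H) * b r ^ (2 - Suc 0))) * P r) / a r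
       + (P r * (b r)\<^sup>2) * (P r / A) / (a r * a r)) (at r within {0..l})"
    proof -
      note d = has_field_derivative_at_within[OF b'[OF r0], of "{0..l}"] has_field_derivative_at_within[OF Q'[OF r0], of "{0..l}"]
      have "a r \<noteq> 0" using a[OF r] by simp
      from DERIV_diff[OF DERIV_mult[OF d(2,1)] DERIV_divide[OF DERIV_mult[OF P'[OF r] DERIV_power[OF d(1), of 2]] a'[OF r] this]]
      show ?thesis unfolding Z_def
        by (rule DERIV_cong) (use \<open>a r \<noteq> 0\<close> in \<open>simp add: H_def A_def B_def C_def diff_divide_distrib\<close>)
    qed
    moreover have "(N * B * b r) * b r + (Q r / H) * Q r
       - ((N * C * a r) * (b r)\<^sup>2 + (of_nat 2 * ((Q r / H) * b r ^ (2 - Suc 0))) * P r) / a r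
       + (P r * (b r)\<^sup>2) * (P r / A) / (a r * a r) = Z' r"
      unfolding Z'_def H_def[symmetric] A_def[symmetric] B_def[symmetric] C_def[symmetric]
      using HA a[OF r] by (simp add: field_simps power2_eq_square)
    ultimately show ?thesis by (simp only:)
  qed
  have Z'1: "((1 + r) ^ N - h r ^ N) * (Q r / (1 + r) ^ N)\<^sup>2 \<le> Z' r" if r: "r \<in> {0..l}" for r
  proof -
    have "h r ^ (N - 2) \<le> (1 + r) ^ (N - 2)" using h[OF r] by (intro power_mono) auto
    then show ?thesis using h(1)[OF r] by (simp add: Z'_def)
  qed
  have le: "h r ^ N \<le> (1 + r) ^ N" if r: "r \<in> {0..l}" for r
    using h[OF r] by (intro power_mono) auto
  have "Z 0 < Z l"
  proof (rule increasing_strict_near_end[OF l])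
    show "continuous_on {0..l} Z" by (rule DERIV_continuous_on) (rule Zd)
    show "(Z has_real_derivative Z' r) (at r)" if "0 < r" "r < l" for r
      using Zd[of r] that by (simp add: at_within_Icc_at)
    show "Z' r \<ge> 0" if "0 < r" "r < l" for r
      using Z'1[of r] le[of r] that by (auto intro: order_trans[rotated])
    show "continuous_on {0..l} (\<lambda>r. 1 + r - h r)"
      by (intro continuous_on_diff continuous_on_add continuous_on_const continuous_on_id ch)
    show "0 < 1 + l - h l" using hl by simp
    show "Z' r > 0" if "0 < r" "r < l" "1 + r - h r > 0" for r
    proof -
      have r: "r \<in> {0..l}" using that by simp
      have "h r ^ N < (1 + r) ^ N" using that N h(1)[OF r] by (intro power_strict_mono) auto
      moreover have "Q r < 0" unfolding Q_def using that N by (intro tent_flux_neg) auto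
      ultimately have "0 < ((1 + r) ^ N - h r ^ N) * (Q r / (1 + r) ^ N)\<^sup>2"
        using that by (intro mult_pos_pos) auto
      then show ?thesis using Z'1[OF r] by linarith
    qed
  qed
  also have "Z l \<le> 0"
    using l a[of l] Pl by (simp add: Z_def Q_def tent_flux_end)
  finally have "Z 0 < 0" .
  moreover have "Z 0 = b 0 * (Q 0 + \<sigma> * b 0)"
    using a[of 0] l by (simp add: Z_def P0 power2_eq_square algebra_simps)
  ultimately have "Q 0 + \<sigma> * b 0 < 0" using b[of 0] by (simp add: mult_less_0_iff)
  then have "\<sigma> * (N + (1 + l) ^ Suc N) < N * ((1 + l) ^ Suc N - 1)"
    by (simp add: Q_def b_def tent_flux_def tent_mode_def algebra_simps)
  moreover have "(1 + l) ^ Suc N + N > 0" using l by (intro add_pos_nonneg) auto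
  ultimately show ?thesis by (simp add: pos_less_divide_eq add.commute)
qed

lemma DERIV_reflect:
  fixes J d :: "real \<Rightarrow> real"
  assumes J: "\<And>r. r \<in> {0..L} \<Longrightarrow> (J has_real_derivative d r) (at r within {0..L})"
    and r: "r \<in> {0..l}" and l: "l \<le> L"
  shows "((\<lambda>r. - J (L - r)) has_real_derivative d (L - r)) (at r within {0..l})"
proof -
  have "((\<lambda>r. L - r) has_real_derivative 0 - 1) (at r within {0..l})" by (intro DERIV_diff DERIV_const DERIV_ident)
  moreover have "(J has_real_derivative d (L - r)) (at (L - r) within (\<lambda>r. L - r) ` {0..l})"
    by (rule has_field_derivative_subset[OF J]) (use r l in auto)
  ultimately have "((\<lambda>r. J (L - r)) has_real_derivative d (L - r) * (0 - 1)) (at r within {0..l})"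
    by (rule DERIV_image_chain[unfolded comp_def, rotated])
  from DERIV_minus[OF this] show ?thesis by simp
qed

lemma DERIV_tent_potential:
  assumes r0: "1 + r > 0" and N: "N \<ge> 2"
  shows "((\<lambda>r. 1 / (real (N - 1) * (1 + r) ^ (N - 1))) has_real_derivative - (1 / (1 + r) ^ N)) (at r)"
proof -
  obtain M where M: "N = Suc (Suc M)" using N by (metis Suc_diff_Suc diff_Suc_1 le_iff_add add_2_eq_Suc)
  have "((\<lambda>r. 1 / (real (N - 1) * (1 + r) ^ (N - 1))) has_real_derivative
      (0 * (real (N - 1) * (1 + r) ^ (N - 1)) - 1 * (real (N - 1) * (of_nat (N - 1) * ((0 + 1) * (1 + r) ^ (N - 1 - Suc 0)))))
      / (real (N - 1) * (1 + r) ^ (N - 1) * (real (N - 1) * (1 + r) ^ (N - 1)))) (at r)"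
    using r0 M by (intro DERIV_divide DERIV_cmult DERIV_power DERIV_add DERIV_ident DERIV_const) auto
  moreover have "(0 * (real (N - 1) * (1 + r) ^ (N - 1)) - 1 * (real (N - 1) * (of_nat (N - 1) * ((0 + 1) * (1 + r) ^ (N - 1 - Suc 0)))))
      / (real (N - 1) * (1 + r) ^ (N - 1) * (real (N - 1) * (1 + r) ^ (N - 1))) = - (1 / (1 + r) ^ N)"
  proof -
    define t where "t = 1 + r"
    show ?thesis unfolding t_def[symmetric] using r0 M by (simp add: t_def[symmetric] divide_simps)
  qed
  ultimately show ?thesis by (simp only:)
qed

lemma radial_integral_greater:
  fixes h J :: "real \<Rightarrow> real"
  assumes l: "l > 0" and N: "N \<ge> 2"
    and ch: "continuous_on {0..l} h" and h: "\<And>r. r \<in> {0..l} \<Longrightarrow> 0 < h r" "\<And>r. r \<in> {0..l} \<Longrightarrow> h r \<le> 1 + r"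
    and hl: "h l < 1 + l"
    and J: "\<And>r. r \<in> {0..l} \<Longrightarrow> (J has_real_derivative 1 / h r ^ N) (at r within {0..l})"
  shows "J l - J 0 > (1 - 1 / (1 + l) ^ (N - 1)) / (N - 1)"
proof -
  define Z where "Z r = J r + 1 / (real (N - 1) * (1 + r) ^ (N - 1))" for r
  have Zd: "(Z has_real_derivative 1 / h r ^ N - 1 / (1 + r) ^ N) (at r within {0..l})" if r: "r \<in> {0..l}" for r
  proof -
    have r0: "1 + r > 0" using r by simp
    from DERIV_add[OF J[OF r] has_field_derivative_at_within[OF DERIV_tent_potential[OF r0 N]]]
    show ?thesis unfolding Z_def by simp
  qed
  have "Z 0 < Z l"
  proof (rule increasing_strict_near_end[OF l])
    show "continuous_on {0..l} Z" by (rule DERIV_continuous_on) (rule Zd)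
    show "(Z has_real_derivative 1 / h r ^ N - 1 / (1 + r) ^ N) (at r)" if "0 < r" "r < l" for r
      using Zd[of r] that by (simp add: at_within_Icc_at)
    show "1 / h r ^ N - 1 / (1 + r) ^ N \<ge> 0" if "0 < r" "r < l" for r
    proof -
      have r: "r \<in> {0..l}" using that by simp
      have "h r ^ N \<le> (1 + r) ^ N" using h[OF r] by (intro power_mono) auto
      then show ?thesis using h(1)[OF r] that by (simp add: frac_le)
    qed
    show "continuous_on {0..l} (\<lambda>r. 1 + r - h r)"
      by (intro continuous_on_diff continuous_on_add continuous_on_const continuous_on_id ch)
    show "0 < 1 + l - h l" using hl by simp
    show "1 / h r ^ N - 1 / (1 + r) ^ N > 0" if "0 < r" "r < l" "1 + r - h r > 0" for r
    proof -
      have r: "r \<in> {0..l}" using that by simp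
      have "h r ^ N < (1 + r) ^ N" using that N h(1)[OF r] by (intro power_strict_mono) auto
      then show ?thesis using h(1)[OF r] that by (simp add: frac_less2)
    qed
  qed
  then show ?thesis by (simp add: Z_def diff_divide_distrib mult.commute)
qed

lemma radial_integral_le:
  fixes h J :: "real \<Rightarrow> real"
  assumes l: "l > 0" and N: "N \<ge> 2" and \<theta>: "\<theta> > 0"
    and h: "\<And>r. r \<in> {0..l} \<Longrightarrow> \<theta> * (1 + r) \<le> h r"
    and J: "\<And>r. r \<in> {0..l} \<Longrightarrow> (J has_real_derivative 1 / h r ^ N) (at r within {0..l})"
  shows "J l - J 0 \<le> 1 / \<theta> ^ N * ((1 - 1 / (1 + l) ^ (N - 1)) / (N - 1))"
proof -
  define c where "c = 1 / \<theta> ^ N"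
  define Z where "Z r = J r + c * (1 / (real (N - 1) * (1 + r) ^ (N - 1)))" for r
  have Zd: "(Z has_real_derivative 1 / h r ^ N + c * - (1 / (1 + r) ^ N)) (at r within {0..l})" if r: "r \<in> {0..l}" for r
  proof -
    have r0: "1 + r > 0" using r by simp
    from DERIV_add[OF J[OF r] DERIV_cmult[OF has_field_derivative_at_within[OF DERIV_tent_potential[OF r0 N]], of c]]
    show ?thesis unfolding Z_def .
  qed
  have "Z 0 \<ge> Z l"
  proof (rule DERIV_nonpos_imp_decreasing_open[of 0 l Z])
    fix r assume r: "0 < r" "r < l"
    have p: "\<theta> * (1 + r) > 0" using \<theta> r by simp
    have "(\<theta> * (1 + r)) ^ N \<le> h r ^ N" using h[of r] r p by (intro power_mono) auto
    then have "1 / h r ^ N \<le> 1 / (\<theta> * (1 + r)) ^ N" using p by (intro frac_le) auto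
    also have "\<dots> = c * (1 / (1 + r) ^ N)" by (simp add: c_def power_mult_distrib)
    finally have "1 / h r ^ N + c * - (1 / (1 + r) ^ N) \<le> 0" by simp
    moreover have "(Z has_real_derivative 1 / h r ^ N + c * - (1 / (1 + r) ^ N)) (at r)"
      using Zd[of r] r by (simp add: at_within_Icc_at)
    ultimately show "\<exists>y. (Z has_real_derivative y) (at r) \<and> y \<le> 0" by blast
  next
    show "continuous_on {0..l} Z" by (rule DERIV_continuous_on) (rule Zd)
  qed (use l in simp)
  then show ?thesis by (simp add: Z_def c_def[symmetric] diff_divide_distrib right_diff_distrib mult.commute)
qed

section \<open>Existence of eigenfunctions\<close>

context revolution
begin

lemma tent_bound:
  assumes h1: "\<And>r. r \<in> {0..L} \<Longrightarrow> \<bar>h' r\<bar> \<le> 1"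
  shows "\<And>r. r \<in> {0..L} \<Longrightarrow> h r \<le> 1 + r" and "\<And>r. r \<in> {0..L} \<Longrightarrow> h r \<le> 1 + (L - r)"
    and "h (L / 2) < 1 + L / 2"
proof -
  have cS: "continuous_on S h" if "S \<subseteq> {0..L}" for S by (rule continuous_on_subset[OF cont_h that])
  have d1: "((\<lambda>r. 1 + r - h r) has_real_derivative 0 + 1 - h' r) (at r)" if "r \<in> {0..L}" for r
    by (intro DERIV_diff DERIV_add DERIV_const DERIV_ident h' that)
  have d2: "((\<lambda>r. 1 + (L - r) - h r) has_real_derivative 0 + (0 - 1) - h' r) (at r)" if "r \<in> {0..L}" for r
    by (intro DERIV_diff DERIV_add DERIV_const DERIV_ident h' that)
  show 1: "h r \<le> 1 + r" if r: "r \<in> {0..L}" for r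
  proof -
    have "1 + 0 - h 0 \<le> 1 + r - h r"
    proof (rule DERIV_nonneg_imp_increasing_open[of 0 r "\<lambda>r. 1 + r - h r"])
      show "\<exists>y. ((\<lambda>r. 1 + r - h r) has_real_derivative y) (at t) \<and> 0 \<le> y" if "0 < t" "t < r" for t
        using d1[of t] h1[of t] that r by (intro exI[of _ "0 + 1 - h' t"]) auto
      show "continuous_on {0..r} (\<lambda>r. 1 + r - h r)"
        using r by (intro continuous_on_diff continuous_on_add continuous_on_const continuous_on_id cS) auto
    qed (use r in simp)
    then show ?thesis by (simp add: h0)
  qed
  show 2: "h r \<le> 1 + (L - r)" if r: "r \<in> {0..L}" for r
  proof -
    have "1 + (L - r) - h r \<ge> 1 + (L - L) - h L"
    proof (rule DERIV_nonpos_imp_decreasing_open[of r L "\<lambda>r. 1 + (L - r) - h r"])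
      show "\<exists>y. ((\<lambda>r. 1 + (L - r) - h r) has_real_derivative y) (at t) \<and> y \<le> 0" if "r < t" "t < L" for t
        using d2[of t] h1[of t] that r by (intro exI[of _ "0 + (0 - 1) - h' t"]) auto
      show "continuous_on {r..L} (\<lambda>r. 1 + (L - r) - h r)"
        using r by (intro continuous_on_diff continuous_on_add continuous_on_const continuous_on_id cS) auto
    qed (use r in simp)
    then show ?thesis by (simp add: hL)
  qed
  have m: "L / 2 \<in> {0..L}" using L by simp
  show "h (L / 2) < 1 + L / 2"
  proof (rule ccontr)
    assume "\<not> h (L / 2) < 1 + L / 2"
    then have eq: "h (L / 2) = 1 + L / 2" using 1[OF m] by simp
    have near: "r \<in> {0..L}" if "\<bar>L / 2 - r\<bar> < L / 2" for r
      using that unfolding abs_less_iff atLeastAtMost_iff by linarith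
    have "0 + 1 - h' (L / 2) = 0"
      by (rule DERIV_local_min[OF d1[OF m], of "L / 2"]) (use L 1 near eq in \<open>auto simp: algebra_simps\<close>)
    moreover have "0 + (0 - 1) - h' (L / 2) = 0"
      by (rule DERIV_local_min[OF d2[OF m], of "L / 2"]) (use L 2 near eq in \<open>auto simp: algebra_simps\<close>)
    ultimately show False by simp
  qed
qed

lemma smooth_interval:
  assumes "smooth_near {0..L} h"
  obtains \<eta> where "\<eta> > 0" "\<And>k. Ck_on k {- \<eta><..<L + \<eta>} h" "\<And>r. r \<in> {- \<eta>..L + \<eta>} \<Longrightarrow> h r > 0"
    "continuous_on {- \<eta>..L + \<eta>} h"
proof -
  obtain U where U: "open U" "{0..L} \<subseteq> U" "\<And>k. Ck_on k U h" using assms by (auto simp: smooth_near_def)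
  have cU: "continuous_on U h" using U(3)[of 0] by simp
  define W where "W = U \<inter> h -` {0<..}"
  have W: "open W" unfolding W_def by (rule continuous_open_preimage[OF cU U(1) open_greaterThan])
  have "{0..L} \<subseteq> W" using U(2) h_pos by (auto simp: W_def)
  then obtain e where e: "e > 0" "(\<Union>x\<in>{0..L}. ball x e) \<subseteq> W"
    using compact_subset_open_imp_ball_epsilon_subset[OF compact_Icc W] by blast
  have "{- (e/2)..L + e/2} \<subseteq> W"
  proof
    fix r assume r: "r \<in> {- (e/2)..L + e/2}"
    define x where "x = max 0 (min L r)"
    have "x \<in> {0..L}" "r \<in> ball x e" using r L e(1) by (auto simp: x_def dist_real_def max_def min_def)
    then show "r \<in> W" using e(2) by blast
  qed
  then have sub: "{- (e/2)..L + e/2} \<subseteq> U" and pos: "\<And>r. r \<in> {- (e/2)..L + e/2} \<Longrightarrow> h r > 0"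
    by (auto simp: W_def)
  have "{- (e/2)<..<L + e/2} \<subseteq> U" using sub by (auto simp: subset_iff)
  with that[of "e/2"] e(1) pos continuous_on_subset[OF cU sub] Ck_on_subset[OF U(3)] show thesis by simp
qed

lemma ex_radial_eigenfunction:
  assumes sm: "smooth_near {0..L} h"
  obtains J f where "\<And>r. r \<in> {0..L} \<Longrightarrow> (J has_real_derivative 1 / h r ^ N) (at r within {0..L})"
    and "J L > J 0" and "steklov_eigenfunction L g (2 / (J L - J 0)) f"
    and "\<exists>x\<in>cyl L. \<exists>y\<in>cyl L. f x \<noteq> f y"
proof -
  obtain \<eta> where \<eta>: "\<eta> > 0" "\<And>k. Ck_on k {- \<eta><..<L + \<eta>} h" "\<And>r. r \<in> {- \<eta>..L + \<eta>} \<Longrightarrow> h r > 0"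
    "continuous_on {- \<eta>..L + \<eta>} h" using smooth_interval[OF sm] by blast
  define \<alpha> where "\<alpha> r = inverse (h r ^ N)" for r
  have "continuous_on {- \<eta>..L + \<eta>} \<alpha>"
    unfolding \<alpha>_def by (intro continuous_on_inverse continuous_on_power \<eta>(4)) (use \<eta>(3) in force)
  then obtain J where J: "\<And>r. r \<in> {- \<eta>..L + \<eta>} \<Longrightarrow> (J has_real_derivative \<alpha> r) (at r within {- \<eta>..L + \<eta>})"
    using antiderivative_continuous unfolding has_real_derivative_iff_has_vector_derivative by blast
  define V where "V = {- \<eta><..<L + \<eta>}"
  have V: "open V" "{0..L} \<subseteq> V" using \<eta>(1) by (auto simp: V_def)
  have Jd: "(J has_real_derivative \<alpha> r) (at r)" if "r \<in> V" for r
    using J[of r] that by (simp add: V_def at_within_Icc_at)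
  have hV: "Ck_on k V h" for k using \<eta>(2) by (simp add: V_def)
  have hN: "h r ^ N \<noteq> 0" if "r \<in> V" for r
  proof -
    have "h r > 0" using that by (intro \<eta>(3)) (auto simp: V_def)
    then show ?thesis by simp
  qed
  have C\<alpha>: "Ck_on k V \<alpha>" for k
    unfolding \<alpha>_def
    by (rule Ck_on_inverse[OF V(1) hN Ck_on_power[OF V(1) hV]])
  have CJ: "Ck_on k V J" for k
  proof (cases k)
    case 0
    have "continuous_on V J" by (rule DERIV_continuous_on) (rule has_field_derivative_at_within[OF Jd])
    then show ?thesis by (simp add: 0)
  next
    case (Suc j)
    show ?thesis unfolding Suc by (rule Ck_on_real_SucI[OF V(1) Jd C\<alpha>])
  qed
  have J0L: "J 0 < J L"
  proof (rule DERIV_pos_imp_increasing[OF L])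
    fix x assume "0 \<le> x" "x \<le> L"
    then have "x \<in> V" "\<alpha> x > 0" using V(2) h_pos[of x] by (auto simp: \<alpha>_def)
    then show "\<exists>y. (J has_real_derivative y) (at x) \<and> 0 < y" using Jd by blast
  qed
  define a where "a r = J r + - (J 0 + J L) / 2" for r
  have st: "steklov_eigenfunction L g (2 / (J L - J 0)) (\<lambda>x. a (fst x) * (1 + snd x \<bullet> 0))"
  proof (rule steklov_eigenfunction_separated[OF V, where a = a and P = "\<lambda>r. 1" and \<nu> = 0
        and \<sigma> = "2 / (J L - J 0)" and c = 1 and e = 0])
    show "Ck_on k V a" for k unfolding a_def by (intro Ck_on_add Ck_on_const V(1) CJ)
    show "(a has_real_derivative 1 / h r ^ N) (at r)" if "r \<in> {0..L}" for r
    proof -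
      have "r \<in> V" using V(2) that by blast
      from DERIV_add[OF Jd[OF this] DERIV_const[of "- (J 0 + J L) / 2"]] show ?thesis
        unfolding a_def \<alpha>_def by (simp add: inverse_eq_divide)
    qed
    show "((\<lambda>r. 1) has_real_derivative 0 * h r ^ (N - 2) * a r) (at r)" for r by simp
    have "a 0 = - ((J L - J 0) / 2)" by (simp add: a_def field_simps)
    moreover have "a L = (J L - J 0) / 2" by (simp add: a_def field_simps)
    ultimately show "1 = - (2 / (J L - J 0)) * a 0" "1 = 2 / (J L - J 0) * a L"
      using J0L by simp_all
  qed simp
  have nc: "\<exists>x\<in>cyl L. \<exists>y\<in>cyl L. a (fst x) * (1 + snd x \<bullet> (0::real^'n)) \<noteq> a (fst y) * (1 + snd y \<bullet> (0::real^'n))"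
  proof -
    define p :: "real^'n" where "p = axis undefined 1"
    have "norm p = 1" by (simp add: p_def)
    then have "(0, p) \<in> cyl L" "(L, p) \<in> cyl L" using L by (auto simp: cyl_def)
    moreover have "a (fst (0, p)) * (1 + snd (0, p) \<bullet> 0) \<noteq> a (fst (L, p)) * (1 + snd (L, p) \<bullet> (0::real^'n))"
      using J0L by (simp add: a_def)
    ultimately show ?thesis by blast
  qed
  have J': "(J has_real_derivative 1 / h r ^ N) (at r within {0..L})" if "r \<in> {0..L}" for r
  proof -
    have "r \<in> V" using V(2) that by blast
    from has_field_derivative_at_within[OF Jd[OF this]] show ?thesis by (simp add: \<alpha>_def divide_inverse)
  qed
  show thesis by (rule that[OF J' J0L st nc])
qed

lemma ex_first_mode:
  assumes sm: "smooth_near {0..L} h"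
    and h1: "\<And>r. r \<in> {0..L} \<Longrightarrow> \<bar>h' r\<bar> \<le> 1"
  obtains \<sigma> f where "steklov_eigenfunction L g \<sigma> f" and "\<exists>x\<in>cyl L. \<exists>y\<in>cyl L. f x \<noteq> f y"
    and "\<sigma> < N * ((1 + L / 2) ^ Suc N - 1) / ((1 + L / 2) ^ Suc N + N)"
proof -
  obtain \<eta> where \<eta>: "\<eta> > 0" "\<And>k. Ck_on k {- \<eta><..<L + \<eta>} h" "\<And>r. r \<in> {- \<eta>..L + \<eta>} \<Longrightarrow> h r > 0"
    "continuous_on {- \<eta>..L + \<eta>} h" using smooth_interval[OF sm] by blast
  define \<alpha> where "\<alpha> r = inverse (h r ^ N)" for r
  define \<beta> where "\<beta> r = real N * h r ^ (N - 2)" for r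
  define S where "S = {- \<eta>..L + \<eta>}"
  define V where "V = {- \<eta><..<L + \<eta>}"
  have V: "open V" "{0..L} \<subseteq> V" "V \<subseteq> S" using \<eta>(1) by (auto simp: V_def S_def)
  have c\<alpha>: "continuous_on S \<alpha>"
    unfolding \<alpha>_def S_def by (intro continuous_on_inverse continuous_on_power \<eta>(4)) (use \<eta>(3) in force)
  have c\<beta>: "continuous_on S \<beta>"
    unfolding \<beta>_def S_def by (intro continuous_on_mult continuous_on_const continuous_on_power \<eta>(4))
  have pos: "\<alpha> r > 0" "\<beta> r \<ge> 0" if "r \<in> S" for r using \<eta>(3) that by (auto simp: \<alpha>_def \<beta>_def S_def less_imp_le)
  have hV: "Ck_on k V h" for k using \<eta>(2) by (simp add: V_def)
  have hN: "h r ^ N \<noteq> 0" if "r \<in> V" for r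
  proof -
    have "h r > 0" using that by (intro \<eta>(3)) (auto simp: V_def)
    then show ?thesis by simp
  qed
  have C\<alpha>: "Ck_on k V \<alpha>" for k
    unfolding \<alpha>_def
    by (rule Ck_on_inverse[OF V(1) hN Ck_on_power[OF V(1) hV]])
  have C\<beta>: "Ck_on k V \<beta>" for k
    unfolding \<beta>_def by (intro Ck_on_mult Ck_on_const Ck_on_power V(1) hV)
  have refl: "L - r \<in> S" if "r \<in> S" for r using that by (auto simp: S_def)
  have cr: "continuous_on S (\<lambda>r. L - r)" by (intro continuous_on_diff continuous_on_const continuous_on_id)
  have z: "0 \<in> S" using \<eta>(1) L by (simp add: S_def)
  have nn: "\<alpha> r \<ge> 0" if "r \<in> S" for r using pos(1)[OF that] by simp
  obtain v p where v: "\<And>r. r \<in> S \<Longrightarrow> (v has_real_derivative \<alpha> r * p r) (at r within S)"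
    and p: "\<And>r. r \<in> S \<Longrightarrow> (p has_real_derivative \<beta> r * v r) (at r within S)"
    and i: "v 0 = 0" "p 0 = 1" and p1: "\<And>r. r \<in> {0..L + \<eta>} \<Longrightarrow> p r \<ge> 1"
  proof (rule linear_system_solution[of "- \<eta>" "L + \<eta>" \<alpha> \<beta> 0, folded S_def, OF c\<alpha> nn c\<beta> pos(2) z])
    fix v p assume "\<And>r. r \<in> S \<Longrightarrow> (v has_real_derivative \<alpha> r * p r) (at r within S)"
      "\<And>r. r \<in> S \<Longrightarrow> (p has_real_derivative \<beta> r * v r) (at r within S)"
      "v 0 = 0" "p 0 = 1" "\<And>r. r \<in> {0..L + \<eta>} \<Longrightarrow> p r \<ge> 1"
    then show thesis by (rule that)
  qed
  have cr': "continuous_on S (\<lambda>r. \<alpha> (L - r))" "continuous_on S (\<lambda>r. \<beta> (L - r))"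
    by (rule continuous_on_compose2[OF c\<alpha> cr], use refl in blast)
      (rule continuous_on_compose2[OF c\<beta> cr], use refl in blast)
  obtain v' p' where v': "\<And>r. r \<in> S \<Longrightarrow> (v' has_real_derivative \<alpha> (L - r) * p' r) (at r within S)"
    and p': "\<And>r. r \<in> S \<Longrightarrow> (p' has_real_derivative \<beta> (L - r) * v' r) (at r within S)"
    and i': "v' 0 = 0" "p' 0 = 1" and p1': "\<And>r. r \<in> {0..L + \<eta>} \<Longrightarrow> p' r \<ge> 1"
  proof (rule linear_system_solution[of "- \<eta>" "L + \<eta>" "\<lambda>r. \<alpha> (L - r)" "\<lambda>r. \<beta> (L - r)" 0, folded S_def,
        OF cr'(1) nn[OF refl] cr'(2) pos(2)[OF refl] z])
    fix v p assume "\<And>r. r \<in> S \<Longrightarrow> (v has_real_derivative \<alpha> (L - r) * p r) (at r within S)"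
      "\<And>r. r \<in> S \<Longrightarrow> (p has_real_derivative \<beta> (L - r) * v r) (at r within S)"
      "v 0 = 0" "p 0 = 1" "\<And>r. r \<in> {0..L + \<eta>} \<Longrightarrow> p r \<ge> 1"
    then show thesis by (rule that)
  qed
  have SV: "at r within S = at r" if "r \<in> V" for r using that by (simp add: S_def V_def at_within_Icc_at)
  have LV: "L - r \<in> V" if "r \<in> V" for r using that by (auto simp: V_def)
  have vd: "(v has_real_derivative \<alpha> r * p r) (at r)" "(p has_real_derivative \<beta> r * v r) (at r)" if "r \<in> V" for r
    using v[of r] p[of r] that V(3) SV[OF that] by auto
  have vd': "(v' has_real_derivative \<alpha> (L - r) * p' r) (at r)" "(p' has_real_derivative \<beta> (L - r) * v' r) (at r)" if "r \<in> V" for r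
    using v'[of r] p'[of r] that V(3) SV[OF that] by auto
  have vdL: "((\<lambda>r. v' (L - r)) has_real_derivative - (\<alpha> r * p' (L - r))) (at r)"
    "((\<lambda>r. p' (L - r)) has_real_derivative - (\<beta> r * v' (L - r))) (at r)" if "r \<in> V" for r
  proof -
    have "((\<lambda>r. L - r) has_real_derivative 0 - 1) (at r)" by (intro DERIV_diff DERIV_const DERIV_ident)
    note c = DERIV_chain2[of _ _ "\<lambda>r. L - r", OF _ this]
    show "((\<lambda>r. v' (L - r)) has_real_derivative - (\<alpha> r * p' (L - r))) (at r)"
      "((\<lambda>r. p' (L - r)) has_real_derivative - (\<beta> r * v' (L - r))) (at r)"
      using c[OF vd'(1)[OF LV[OF that]]] c[OF vd'(2)[OF LV[OF that]]] by simp_all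
  qed
  have in0: "{0..L} \<subseteq> {0..L + \<eta>}" using \<eta>(1) by auto
  have v_pos: "v r > 0" "v' r > 0" if r: "0 < r" "r \<le> L" for r
  proof -
    have *: "x \<in> V" "L - x \<in> S" "x \<in> {0..L + \<eta>}" if "0 \<le> x" "x \<le> r" for x
      using that r V(2,3) in0 by (auto simp: subset_iff)
    have "v 0 < v r"
    proof (rule DERIV_pos_imp_increasing[OF r(1)])
      fix x assume x: "0 \<le> x" "x \<le> r"
      have "\<alpha> x * p x > 0" using pos(1)[of x] p1[of x] *[OF x] V(3) by (intro mult_pos_pos) force+
      then show "\<exists>y. (v has_real_derivative y) (at x) \<and> 0 < y" using vd(1)[of x] *[OF x] by blast
    qed
    then show "v r > 0" using i by simp
    have "v' 0 < v' r"
    proof (rule DERIV_pos_imp_increasing[OF r(1)])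
      fix x assume x: "0 \<le> x" "x \<le> r"
      have "\<alpha> (L - x) * p' x > 0" using pos(1)[of "L - x"] p1'[of x] *[OF x] by (intro mult_pos_pos) force+
      then show "\<exists>y. (v' has_real_derivative y) (at x) \<and> 0 < y" using vd'(1)[of x] *[OF x] by blast
    qed
    then show "v' r > 0" using i' by simp
  qed
  have wronskian: "v L = v' L"
  proof -
    define w where "w r = v r * p' (L - r) + p r * v' (L - r)" for r
    have w': "(w has_real_derivative 0) (at r)" if "r \<in> {0..L}" for r
    proof -
      have r: "r \<in> V" using that V(2) by blast
      show ?thesis unfolding w_def
        using DERIV_add[OF DERIV_mult[OF vd(1)[OF r] vdL(2)[OF r]] DERIV_mult[OF vd(2)[OF r] vdL(1)[OF r]]]
        by (rule DERIV_cong) (simp add: algebra_simps)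
    qed
    have "continuous_on {0..L} w" by (rule DERIV_continuous_on) (rule has_field_derivative_at_within[OF w'])
    then have "w L = w 0" by (rule DERIV_isconst2[OF L]) (use w' L in auto)
    then show ?thesis by (simp add: w_def i i')
  qed
  define D where "D = sqrt ((p L - p' L)\<^sup>2 + 4)"
  define \<kappa> where "\<kappa> = (p' L - p L + D) / 2"
  have "\<bar>p L - p' L\<bar> < D" unfolding D_def by (rule real_less_rsqrt) simp
  then have \<kappa>: "\<kappa> > 0" by (simp add: \<kappa>_def abs_less_iff)
  have "D\<^sup>2 = (p L - p' L)\<^sup>2 + 4" by (simp add: D_def)
  then have \<kappa>eq: "\<kappa> * p L - 1 = (p' L - \<kappa>) * \<kappa>" by (simp add: \<kappa>_def power2_eq_square field_simps)
  define a where "a r = v' (L - r) + \<kappa> * v r" for r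
  define P where "P r = - p' (L - r) + \<kappa> * p r" for r
  have a': "(a has_real_derivative \<alpha> r * P r) (at r)" and P': "(P has_real_derivative \<beta> r * a r) (at r)" if "r \<in> V" for r
    using DERIV_cong[OF DERIV_add[OF vdL(1)[OF that] DERIV_cmult[OF vd(1)[OF that], of \<kappa>]], of "\<alpha> r * P r"]
      DERIV_cong[OF DERIV_add[OF DERIV_minus[OF vdL(2)[OF that]] DERIV_cmult[OF vd(2)[OF that], of \<kappa>]], of "\<beta> r * a r"]
    unfolding a_def[abs_def] P_def[abs_def] by (simp_all add: algebra_simps)
  have a_pos: "a r > 0" if r: "r \<in> {0..L}" for r
  proof (cases "r = 0")
    case True
    then show ?thesis using v_pos(2)[of L] L i by (simp add: a_def)
  next
    case False
    then have "v r > 0" using r by (intro v_pos) auto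
    moreover have "v' (L - r) \<ge> 0" using v_pos(2)[of "L - r"] r i' by (cases "r = L") auto
    ultimately show ?thesis using \<kappa> by (simp add: a_def add_nonneg_pos)
  qed
  define m where "m = v L"
  have m: "m > 0" using v_pos(1)[of L] L by (simp add: m_def)
  have aL: "a 0 = m" "a L = \<kappa> * m" by (simp_all add: a_def m_def wronskian i i')
  have PL: "P 0 = - (p' L - \<kappa>)" "P L = (p' L - \<kappa>) * \<kappa>" using \<kappa>eq by (simp_all add: P_def i i')
  define \<sigma> where "\<sigma> = (p' L - \<kappa>) / m"
  have bd: "P 0 = - \<sigma> * a 0" "P L = \<sigma> * a L" using m by (simp_all add: aL PL \<sigma>_def)
  have Ca: "Ck_on k V a" for k
    using Ck_on_linear_system[OF V(1) C\<alpha> C\<beta> a' P'] by blast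
  have ad: "(a has_real_derivative P r / h r ^ N) (at r)" "(P has_real_derivative N * h r ^ (N - 2) * a r) (at r)"
    if "r \<in> {0..L}" for r
    using a'[of r] P'[of r] that V(2) by (auto simp: \<alpha>_def \<beta>_def divide_inverse mult.commute)
  define e :: "real^'n" where "e = axis undefined 1"
  have e: "norm e = 1" by (simp add: e_def)
  have st: "steklov_eigenfunction L g \<sigma> (\<lambda>x. a (fst x) * (0 + snd x \<bullet> e))"
    by (rule steklov_eigenfunction_separated[OF V(1,2) Ca ad bd]) simp_all
  have nc: "\<exists>x\<in>cyl L. \<exists>y\<in>cyl L. a (fst x) * (0 + snd x \<bullet> e) \<noteq> a (fst y) * (0 + snd y \<bullet> e)"
  proof -
    have "(0, e) \<in> cyl L" "(0, - e) \<in> cyl L" using e L by (auto simp: cyl_def)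
    moreover have "e \<bullet> e = 1" using e by (simp add: norm_eq_1)
    then have "a (fst (0, e)) * (0 + snd (0, e) \<bullet> e) \<noteq> a (fst (0, - e)) * (0 + snd (0, - e) \<bullet> e)"
      using m by (simp add: aL)
    ultimately show ?thesis by blast
  qed
  have "\<sigma> < N * ((1 + L / 2) ^ Suc N - 1) / ((1 + L / 2) ^ Suc N + N)"
  proof -
    define l where "l = L / 2"
    have l: "l > 0" "{0..l} \<subseteq> {0..L}" using L by (auto simp: l_def)
    have Lr: "L - r \<in> {0..L}" if "r \<in> {0..l}" for r using that l by auto
    have chl: "continuous_on {0..l} h" by (rule continuous_on_subset[OF cont_h l(2)])
    have tb1: "h r \<le> 1 + r" and tb2: "h r \<le> 1 + (L - r)" if "r \<in> {0..L}" for r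
      using tent_bound(1,2)[OF h1 that] by blast+
    have tb3: "h (L / 2) < 1 + L / 2" using tent_bound(3)[OF h1] by blast
    have hl: "h l < 1 + l" using tb3 by (simp add: l_def)
    show ?thesis unfolding l_def[symmetric]
    proof (cases "P l \<ge> 0")
      case True
      show "\<sigma> < N * ((1 + l) ^ Suc N - 1) / ((1 + l) ^ Suc N + N)"
      proof (rule first_mode_less[OF l(1) N2, of h a P])
        show "continuous_on {0..l} h" by (rule chl)
        show "h l < 1 + l" by (rule hl)
        show "P 0 = - \<sigma> * a 0" by (rule bd(1))
        show "P l \<ge> 0" by (rule True)
        fix r assume "r \<in> {0..l}"
        then have r: "r \<in> {0..L}" using l(2) by blast
        show "0 < h r" by (rule h_pos[OF r])
        show "h r \<le> 1 + r" by (rule tb1[OF r])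
        show "0 < a r" by (rule a_pos[OF r])
        show "(a has_real_derivative P r / h r ^ N) (at r within {0..l})"
          "(P has_real_derivative N * h r ^ (N - 2) * a r) (at r within {0..l})"
          using ad[OF r] by (auto intro: has_field_derivative_at_within)
      qed
    next
      case False
      show "\<sigma> < N * ((1 + l) ^ Suc N - 1) / ((1 + l) ^ Suc N + N)"
      proof (rule first_mode_less[OF l(1) N2, of "\<lambda>r. h (L - r)" "\<lambda>r. a (L - r)" "\<lambda>r. - P (L - r)"])
        show "continuous_on {0..l} (\<lambda>r. h (L - r))"
          by (rule continuous_on_compose2[OF cont_h]) (use Lr in \<open>auto intro!: continuous_on_diff continuous_on_const continuous_on_id\<close>)
        show "h (L - l) < 1 + l" using hl by (simp add: l_def)
        show "- P (L - 0) = - \<sigma> * a (L - 0)" using bd(2) by simp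
        show "- P (L - l) \<ge> 0" using False by (simp add: l_def)
        fix r assume "r \<in> {0..l}"
        then have r: "L - r \<in> {0..L}" by (rule Lr)
        show "0 < h (L - r)" "0 < a (L - r)" using h_pos a_pos r by blast+
        show "h (L - r) \<le> 1 + r" using tb2[OF r] by simp
        have "((\<lambda>r. L - r) has_real_derivative 0 - 1) (at r within {0..l})" by (intro DERIV_diff DERIV_const DERIV_ident)
        note c = DERIV_chain2[of _ _ "\<lambda>r. L - r", OF _ this]
        show "((\<lambda>r. a (L - r)) has_real_derivative - P (L - r) / h (L - r) ^ N) (at r within {0..l})"
          using c[OF ad(1)[OF r]] by simp
        show "((\<lambda>r. - P (L - r)) has_real_derivative N * h (L - r) ^ (N - 2) * a (L - r)) (at r within {0..l})"
          using DERIV_minus[OF c[OF ad(2)[OF r]]] by simp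
      qed
    qed
  qed
  then show thesis by (rule that[OF st nc])
qed

end

section \<open>Bounds for the first eigenvalue\<close>

context revolution
begin

lemma steklov_const: "steklov_eigenfunction L g 0 (\<lambda>x. 1)"
proof -
  have "steklov_eigenfunction L g 0 (\<lambda>x. (\<lambda>r. 1) (fst x) * (1 + snd x \<bullet> (0::real^'n)))"
  proof (rule steklov_eigenfunction_separated[where V = UNIV and a = "\<lambda>r. 1" and P = "\<lambda>r. 0" and \<nu> = 0])
    show "Ck_on k UNIV (\<lambda>r::real. 1)" for k by (rule Ck_on_const[OF open_UNIV])
  qed simp_all
  then show ?thesis by simp
qed

lemma two_eigenfunctions:
  assumes "steklov_eigenfunction L g \<sigma> f" "\<exists>x\<in>cyl L. \<exists>y\<in>cyl L. f x \<noteq> f y"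
  shows "\<exists>F s. lin_indep_on (cyl L) (Suc 1) F \<and>
    (\<forall>i<Suc 1. s i \<le> max 0 \<sigma> \<and> steklov_eigenfunction L g (s i) (F i))"
proof -
  define F where "F i = (if i = 0 then (\<lambda>x. 1) else f)" for i :: nat
  define s where "s i = (if i = 0 then 0 else \<sigma>)" for i :: nat
  obtain x y where xy: "x \<in> cyl L" "y \<in> cyl L" "f x \<noteq> f y" using assms(2) by blast
  have "lin_indep_on (cyl L) (Suc 1) F"
    unfolding lin_indep_on_def
  proof (intro allI impI)
    fix c :: "nat \<Rightarrow> real" and i :: nat
    assume c: "\<forall>x\<in>cyl L. (\<Sum>i<Suc 1. c i * F i x) = 0" and i: "i < Suc 1"
    have e: "c 0 + c 1 * f x = 0" "c 0 + c 1 * f y = 0"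
      using bspec[OF c xy(1)] bspec[OF c xy(2)] by (simp_all add: F_def)
    then have "c 1 * (f x - f y) = 0" by (simp only: right_diff_distrib)
    then have "c 1 = 0" using xy(3) by simp
    moreover from this e have "c 0 = 0" by simp
    ultimately show "c i = 0" using i by (cases i) auto
  qed
  moreover have "\<forall>i<Suc 1. s i \<le> max 0 \<sigma> \<and> steklov_eigenfunction L g (s i) (F i)"
    using steklov_const assms(1) by (simp add: F_def s_def)
  ultimately show ?thesis by blast
qed

lemma eigenvalue_bound_from_constancy:
  assumes const: "\<And>\<sigma> f. steklov_eigenfunction L g \<sigma> f \<Longrightarrow> \<sigma> < T \<Longrightarrow> \<exists>c. \<forall>x\<in>cyl L. f x = c"
    and F: "lin_indep_on (cyl L) (Suc 1) F" "\<forall>i<Suc 1. s i \<le> t \<and> steklov_eigenfunction L g (s i) (F i)"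
  shows "T \<le> t"
proof (rule ccontr)
  assume "\<not> T \<le> t"
  have 0: "s 0 \<le> t" "steklov_eigenfunction L g (s 0) (F 0)" using F(2)[rule_format, of 0] by simp_all
  have 1: "s 1 \<le> t" "steklov_eigenfunction L g (s 1) (F 1)" using F(2)[rule_format, of 1] by simp_all
  have lt: "s 0 < T" "s 1 < T" using 0(1) 1(1) \<open>\<not> T \<le> t\<close> by linarith+
  obtain a where a: "\<And>x. x \<in> cyl L \<Longrightarrow> F 0 x = a" using const[OF 0(2) lt(1)] by blast
  obtain b where b: "\<And>x. x \<in> cyl L \<Longrightarrow> F 1 x = b" using const[OF 1(2) lt(2)] by blast
  have li: "c i = 0" if "c 0 * a + c 1 * b = 0" "i < Suc 1" for c :: "nat \<Rightarrow> real" and i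
  proof -
    have "\<forall>x\<in>cyl L. (\<Sum>i<Suc 1. c i * F i x) = 0"
    proof
      fix x :: "'n point" assume x: "x \<in> cyl L"
      have "(\<Sum>i<Suc 1. c i * F i x) = c 0 * F 0 x + c 1 * F 1 x" by simp
      then show "(\<Sum>i<Suc 1. c i * F i x) = 0" using a[OF x] b[OF x] that(1) by (simp only:)
    qed
    then show ?thesis using F(1) that(2) unfolding lin_indep_on_def by blast
  qed
  have "b = 0" using li[of "\<lambda>i. if i = 0 then b else - a" 0] by simp
  moreover have "a = 0" using li[of "\<lambda>i. if i = 0 then b else - a" 1] by simp
  ultimately show False using li[of "\<lambda>i. 1" 0] by simp
qed

lemma eigenfunction_constant:
  assumes st: "steklov_eigenfunction L g \<sigma> f" and \<sigma>\<tau>: "\<sigma> < \<tau>"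
    and cy: "continuous_on {0..L} y"
    and y': "\<And>r. 0 < r \<Longrightarrow> r < L \<Longrightarrow> (y has_real_derivative y' r) (at r)"
    and ric: "\<And>r. 0 < r \<Longrightarrow> r < L \<Longrightarrow> y' r + (y r)\<^sup>2 / h r ^ N \<le> \<Lambda> * h r ^ (N - 2)"
    and \<Lambda>: "0 \<le> \<Lambda>" "\<Lambda> < N" and yb: "y 0 \<le> - \<tau>" "y L \<ge> \<tau>"
    and J: "\<And>r. r \<in> {0..L} \<Longrightarrow> (J has_real_derivative 1 / h r ^ N) (at r within {0..L})"
    and I: "\<sigma> * (J L - J 0) < 2"
  shows "\<exists>c. \<forall>x\<in>cyl L. f x = c"
proof (rule radial_eigenvalue[OF st, where J = J])
  have le: "f (r, p) \<le> f (r, q)" if "r \<in> {0..L}" "p \<in> sphere 0 1" "q \<in> sphere 0 1" for r p q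
  proof (rule steklov_radial[OF st \<sigma>\<tau> cy _ _ \<Lambda> yb that])
    show "(y has_real_derivative y' r) (at r)" if "0 < r" "r < L" for r by (rule y'[OF that])
    show "y' r + (y r)\<^sup>2 / h r ^ N \<le> \<Lambda> * h r ^ (N - 2)" if "0 < r" "r < L" for r by (rule ric[OF that])
  qed
  show "f (r, p) = f (r, q)" if "r \<in> {0..L}" "p \<in> sphere 0 1" "q \<in> sphere 0 1" for r p q
    by (rule antisym[OF le[OF that] le[OF that(1,3,2)]])
  show "(J has_real_derivative 1 / h r ^ N) (at r within {0..L})" if "r \<in> {0..L}" for r by (rule J[OF that])
  show "\<sigma> * (J L - J 0) \<noteq> 2" using I by simp
qed

lemma steklov_eigenvalue_less:
  assumes sm: "smooth_near {0..L} h" and h1: "\<And>r. r \<in> {0..L} \<Longrightarrow> \<bar>h' r\<bar> \<le> 1"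
  shows "steklov_eigenvalue L g 1 < real (N - 1) * (1 + L / 2) ^ (N - 1) / ((1 + L / 2) ^ (N - 1) - 1)"
    and "steklov_eigenvalue L g 1 < N * ((1 + L / 2) ^ Suc N - 1) / ((1 + L / 2) ^ Suc N + N)"
proof -
  define S where "S = {t. \<exists>F s. lin_indep_on (cyl L) (Suc 1) F \<and>
    (\<forall>i<Suc 1. s i \<le> t \<and> steklov_eigenfunction L g (s i) (F i))}"
  have ev: "steklov_eigenvalue L g 1 = Inf S" by (simp add: steklov_eigenvalue_def S_def)
  define R where "R = 1 + L / 2"
  have R: "R > 1" using L by (simp add: R_def)
  obtain J f where J: "\<And>r. r \<in> {0..L} \<Longrightarrow> (J has_real_derivative 1 / h r ^ N) (at r within {0..L})"
    and J0L: "J L > J 0" and f: "steklov_eigenfunction L g (2 / (J L - J 0)) f"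
    and fnc: "\<exists>x\<in>cyl L. \<exists>y\<in>cyl L. f x \<noteq> f y"
    using ex_radial_eigenfunction[OF sm] by blast
  have "0 \<le> t" if "t \<in> S" for t
  proof -
    have const: "\<exists>c. \<forall>x\<in>cyl L. u x = c" if u: "steklov_eigenfunction L g \<sigma> u" "\<sigma> < 0" for \<sigma> u
    proof (rule eigenfunction_constant[OF u, where y = "\<lambda>r. 0" and y' = "\<lambda>r. 0" and \<Lambda> = 0 and J = J])
      show "(J has_real_derivative 1 / h r ^ N) (at r within {0..L})" if "r \<in> {0..L}" for r by (rule J[OF that])
      have "\<sigma> * (J L - J 0) < 0" using u(2) J0L by (intro mult_neg_pos) auto
      then show "\<sigma> * (J L - J 0) < 2" by simp
    qed (use N2 in simp_all)
    from that obtain F s where "lin_indep_on (cyl L) (Suc 1) F"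
      "\<forall>i<Suc 1. s i \<le> t \<and> steklov_eigenfunction L g (s i) (F i)" unfolding S_def by blast
    with const show ?thesis by (rule eigenvalue_bound_from_constancy)
  qed
  then have bdd: "bdd_below S" by (rule bdd_belowI)
  have up: "steklov_eigenvalue L g 1 \<le> max 0 \<sigma>"
    if "steklov_eigenfunction L g \<sigma> u" "\<exists>x\<in>cyl L. \<exists>y\<in>cyl L. u x \<noteq> u y" for \<sigma> u
    unfolding ev using two_eigenfunctions[OF that] by (intro cInf_lower bdd) (simp add: S_def)
  obtain \<sigma> u where u: "steklov_eigenfunction L g \<sigma> u" "\<exists>x\<in>cyl L. \<exists>y\<in>cyl L. u x \<noteq> u y"
    and \<sigma>: "\<sigma> < N * (R ^ Suc N - 1) / (R ^ Suc N + N)"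
    using ex_first_mode[OF sm h1] unfolding R_def by blast
  have RS: "R ^ Suc N > 1" using R by (intro one_less_power) auto
  have "N * (R ^ Suc N - 1) / (R ^ Suc N + N) > 0"
    using RS N2 by (intro divide_pos_pos mult_pos_pos) auto
  then have "steklov_eigenvalue L g 1 < N * (R ^ Suc N - 1) / (R ^ Suc N + N)"
    using up[OF u] \<sigma> by linarith
  then show "steklov_eigenvalue L g 1 < N * ((1 + L / 2) ^ Suc N - 1) / ((1 + L / 2) ^ Suc N + N)"
    by (simp only: R_def)
  define X where "X = R ^ (N - 1)"
  have X: "X > 1" unfolding X_def using R N2 by (intro one_less_power) auto
  define l where "l = L / 2"
  have l: "l > 0" "{0..l} \<subseteq> {0..L}" "l \<in> {0..L}" using L by (auto simp: l_def)
  have tb1: "h r \<le> 1 + r" and tb2: "h r \<le> 1 + (L - r)" if "r \<in> {0..L}" for r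
    using tent_bound(1,2)[OF h1 that] by blast+
  have tb3: "h l < 1 + l" using tent_bound(3)[OF h1] unfolding l_def by blast
  have Lr: "L - r \<in> {0..L}" if "r \<in> {0..l}" for r using that l by auto
  define I0 where "I0 = (1 - 1 / X) / (N - 1)"
  have "J l - J 0 > (1 - 1 / (1 + l) ^ (N - 1)) / (N - 1)"
  proof (rule radial_integral_greater[OF l(1) N2, of h])
    show "continuous_on {0..l} h" by (rule continuous_on_subset[OF cont_h l(2)])
    show "h l < 1 + l" by (rule tb3)
    fix r assume "r \<in> {0..l}"
    then have r: "r \<in> {0..L}" using l(2) by blast
    show "0 < h r" by (rule h_pos[OF r])
    show "h r \<le> 1 + r" by (rule tb1[OF r])
    show "(J has_real_derivative 1 / h r ^ N) (at r within {0..l})"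
      by (rule has_field_derivative_subset[OF J[OF r] l(2)])
  qed
  then have "J l - J 0 > I0" by (simp only: I0_def X_def R_def l_def)
  moreover have "(- J (L - l)) - (- J (L - 0)) > (1 - 1 / (1 + l) ^ (N - 1)) / (N - 1)"
  proof (rule radial_integral_greater[OF l(1) N2, of "\<lambda>r. h (L - r)" "\<lambda>r. - J (L - r)"])
    show "continuous_on {0..l} (\<lambda>r. h (L - r))"
      by (rule continuous_on_compose2[OF cont_h]) (use Lr in \<open>auto intro!: continuous_on_diff continuous_on_const continuous_on_id\<close>)
    show "h (L - l) < 1 + l" using tb3 by (simp add: l_def)
    fix r assume r0: "r \<in> {0..l}"
    then have r: "L - r \<in> {0..L}" by (rule Lr)
    show "0 < h (L - r)" by (rule h_pos[OF r])
    show "h (L - r) \<le> 1 + r" using tb2[OF r] by simp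
    show "((\<lambda>r. - J (L - r)) has_real_derivative 1 / h (L - r) ^ N) (at r within {0..l})"
      by (rule DERIV_reflect[where d = "\<lambda>r. 1 / h r ^ N", OF J r0]) (use l in auto)
  qed
  then have "J L - J l > I0" by (simp add: I0_def X_def R_def l_def)
  ultimately have I: "J L - J 0 > 2 * I0" by linarith
  have N1: "real (N - 1) > 0" using N2 by simp
  have I0: "I0 > 0" unfolding I0_def using X N1 by (intro divide_pos_pos) auto
  have "2 / (J L - J 0) < 2 / (2 * I0)" using I I0 by (intro divide_strict_left_mono mult_pos_pos) auto
  also have "\<dots> = real (N - 1) * X / (X - 1)" using X N1 by (simp add: I0_def field_simps)
  finally have lt: "2 / (J L - J 0) < real (N - 1) * X / (X - 1)" .
  have "2 / (J L - J 0) > 0" using J0L by simp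
  with up[OF f fnc] lt have "steklov_eigenvalue L g 1 < real (N - 1) * X / (X - 1)" by linarith
  then show "steklov_eigenvalue L g 1 < real (N - 1) * (1 + L / 2) ^ (N - 1) / ((1 + L / 2) ^ (N - 1) - 1)"
    by (simp only: X_def R_def)
qed

end

lemma odd_reflection_DERIV:
  fixes f f' :: "real \<Rightarrow> real"
  assumes l: "l > 0" and L: "L = 2 * l" and f0: "f l = 0"
    and f: "\<And>r. -1 < r \<Longrightarrow> r \<le> l \<Longrightarrow> (f has_real_derivative f' r) (at r)"
    and r: "-1 < r" "r < L + 1"
  shows "((\<lambda>r. if r \<le> l then f r else - f (L - r)) has_real_derivative f' (min r (L - r))) (at r)"
proof -
  let ?y = "\<lambda>r. if r \<le> l then f r else - f (L - r)"
  have g: "((\<lambda>r. - f (L - r)) has_real_derivative f' (L - r)) (at r)" if "l \<le> r" "r < L + 1" for r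
  proof -
    have "((\<lambda>r. L - r) has_real_derivative 0 - 1) (at r)" by (intro DERIV_diff DERIV_const DERIV_ident)
    moreover have "(f has_real_derivative f' (L - r)) (at (L - r))" using that L by (intro f) auto
    ultimately show ?thesis using DERIV_minus[OF DERIV_chain2[of f _ "\<lambda>r. L - r" r "0 - 1" UNIV]] by simp
  qed
  consider "r < l" | "r = l" | "r > l" by linarith
  then show ?thesis
  proof cases
    case 1
    then have m: "min r (L - r) = r" using L by simp
    show ?thesis unfolding m
      by (rule has_field_derivative_transform_within_open[OF f open_lessThan[of l]]) (use 1 r in auto)
  next
    case 2
    have m: "min r (L - r) = l" using 2 L by simp
    have a: "(?y has_real_derivative f' l) (at l within {..l})"
      by (rule has_field_derivative_transform_within[OF has_field_derivative_at_within[OF f] zero_less_one]) (use l in auto)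
    have "L - l = l" using L by simp
    moreover have "(?y has_real_derivative f' (L - l)) (at l within {l..})"
      by (rule has_field_derivative_transform_within[OF has_field_derivative_at_within[OF g] zero_less_one])
        (use l L f0 in auto)
    ultimately have b: "(?y has_real_derivative f' l) (at l within {l..})" by (simp only:)
    have "((\<lambda>x. (?y x - ?y l) / (x - l)) \<longlongrightarrow> f' l) (at l within {..l} \<union> {l..})"
      unfolding at_within_union
      by (rule filterlim_sup[OF a[unfolded has_field_derivative_iff] b[unfolded has_field_derivative_iff]])
    then have "(?y has_real_derivative f' l) (at l within {..l} \<union> {l..})"
      unfolding has_field_derivative_iff .
    moreover have "{..l} \<union> {l..} = UNIV" by auto
    ultimately have "(?y has_real_derivative f' l) (at l)" by (simp only:)
    then show ?thesis unfolding m unfolding 2 .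
  next
    case 3
    then have m: "min r (L - r) = L - r" using L by simp
    show ?thesis unfolding m
      by (rule has_field_derivative_transform_within_open[OF g open_greaterThan[of l]]) (use 3 r in auto)
  qed
qed

context revolution
begin

lemma steklov_eigenvalue_ge:
  assumes sm: "smooth_near {0..L} h" and \<theta>: "0 < \<theta>" "\<theta> < 1"
    and h\<theta>: "\<And>r. r \<in> {0..L} \<Longrightarrow> \<theta> * (1 + min r (L - r)) \<le> h r"
  shows "\<theta> ^ N * min (real (N - 1) * (1 + L / 2) ^ (N - 1) / ((1 + L / 2) ^ (N - 1) - 1))
      (N * ((1 + L / 2) ^ Suc N - 1) / ((1 + L / 2) ^ Suc N + N)) \<le> steklov_eigenvalue L g 1"
proof -
  define S where "S = {t. \<exists>F s. lin_indep_on (cyl L) (Suc 1) F \<and>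
    (\<forall>i<Suc 1. s i \<le> t \<and> steklov_eigenfunction L g (s i) (F i))}"
  have ev: "steklov_eigenvalue L g 1 = Inf S" by (simp add: steklov_eigenvalue_def S_def)
  define l where "l = L / 2"
  have l: "l > 0" "L = 2 * l" using L by (auto simp: l_def)
  define R where "R = 1 + l"
  have R: "R > 1" using l by (simp add: R_def)
  define \<kappa> where "\<kappa> = \<theta> ^ N"
  have \<kappa>: "\<kappa> > 0" using \<theta> by (simp add: \<kappa>_def)
  define A1 where "A1 = real (N - 1) * R ^ (N - 1) / (R ^ (N - 1) - 1)"
  define A2 where "A2 = N * (R ^ Suc N - 1) / (R ^ Suc N + N)"
  obtain J f where J: "\<And>r. r \<in> {0..L} \<Longrightarrow> (J has_real_derivative 1 / h r ^ N) (at r within {0..L})"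
    and J0L: "J L > J 0" and f: "steklov_eigenfunction L g (2 / (J L - J 0)) f"
    and fnc: "\<exists>x\<in>cyl L. \<exists>y\<in>cyl L. f x \<noteq> f y"
    using ex_radial_eigenfunction[OF sm] by blast
  have S: "S \<noteq> {}" using two_eigenfunctions[OF f fnc] unfolding S_def by blast
  define I0 where "I0 = (1 - 1 / R ^ (N - 1)) / (N - 1)"
  have X: "R ^ (N - 1) > 1" using R N2 by (intro one_less_power) auto
  have N1: "real (N - 1) > 0" using N2 by simp
  have I0: "I0 > 0" unfolding I0_def using X N1 by (intro divide_pos_pos) auto
  have "d * x / (x - 1) = 1 / ((1 - 1 / x) / d)" if "x > 1" "d > 0" for x d :: real
    using that by (simp add: field_simps)
  then have A1: "A1 = 1 / I0" using X N1 unfolding I0_def A1_def by blast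
  have "J l - J 0 \<le> 1 / \<theta> ^ N * ((1 - 1 / (1 + l) ^ (N - 1)) / (N - 1))"
  proof (rule radial_integral_le[OF l(1) N2 \<theta>(1), of h])
    fix r assume r: "r \<in> {0..l}"
    then have rL: "r \<in> {0..L}" using l by auto
    show "\<theta> * (1 + r) \<le> h r" using h\<theta>[OF rL] r l by simp
    show "(J has_real_derivative 1 / h r ^ N) (at r within {0..l})"
      by (rule has_field_derivative_subset[OF J[OF rL]]) (use l in auto)
  qed
  then have "J l - J 0 \<le> 1 / \<kappa> * I0" by (simp only: \<kappa>_def I0_def R_def)
  moreover have "(- J (L - l)) - (- J (L - 0)) \<le> 1 / \<theta> ^ N * ((1 - 1 / (1 + l) ^ (N - 1)) / (N - 1))"
  proof (rule radial_integral_le[OF l(1) N2 \<theta>(1), of "\<lambda>r. h (L - r)" "\<lambda>r. - J (L - r)"])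
    fix r assume r: "r \<in> {0..l}"
    then have rL: "L - r \<in> {0..L}" using l by auto
    show "\<theta> * (1 + r) \<le> h (L - r)" using h\<theta>[OF rL] r l by (simp add: min_absorb2)
    show "((\<lambda>r. - J (L - r)) has_real_derivative 1 / h (L - r) ^ N) (at r within {0..l})"
      by (rule DERIV_reflect[where d = "\<lambda>r. 1 / h r ^ N", OF J r]) (use l in auto)
  qed
  then have "J L - J l \<le> 1 / \<kappa> * I0" unfolding \<kappa>_def I0_def R_def using l by simp
  ultimately have I: "J L - J 0 \<le> 2 * (1 / \<kappa> * I0)" by linarith
  define yT where "yT r = tent_flux N R (1 + r) / tent_mode N R (1 + r)" for r
  define yT' where "yT' r = N * (1 + r) ^ (N - 2) - (yT r)\<^sup>2 / (1 + r) ^ N" for r :: real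
  have yT: "(yT has_real_derivative yT' r) (at r)" if "-1 < r" for r :: real
  proof -
    have p: "1 + r > 0" using that by simp
    have m: "tent_mode N R (1 + r) > 0" using p R by (intro tent_mode_pos) auto
    have s: "((\<lambda>r. 1 + r) has_real_derivative 0 + 1) (at r)" by (intro DERIV_add DERIV_const DERIV_ident)
    note d = DERIV_divide[OF DERIV_chain2[OF DERIV_tent_flux[OF p N2] s] DERIV_chain2[OF DERIV_tent_mode[OF p N2] s]]
    show ?thesis unfolding yT_def
      by (rule DERIV_cong[OF d]) (use m p in \<open>simp_all add: yT'_def yT_def field_simps power2_eq_square\<close>)
  qed
  define y where "y r = (if r \<le> l then \<kappa> * yT r else - (\<kappa> * yT (L - r)))" for r
  define y' where "y' r = \<kappa> * yT' (min r (L - r))" for r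
  have yd: "(y has_real_derivative y' r) (at r)" if "-1 < r" "r < L + 1" for r :: real
    unfolding y_def y'_def
  proof (rule odd_reflection_DERIV[OF l(1,2) _ _ that, of "\<lambda>r. \<kappa> * yT r" "\<lambda>r. \<kappa> * yT' r"])
    show "\<kappa> * yT l = 0" using R by (simp add: yT_def tent_flux_end R_def[symmetric])
    show "((\<lambda>r. \<kappa> * yT r) has_real_derivative \<kappa> * yT' r) (at r)" if "-1 < r" for r
      by (rule DERIV_cmult[OF yT[OF that]])
  qed
  have y_sq: "(y r)\<^sup>2 = \<kappa>\<^sup>2 * (yT (min r (L - r)))\<^sup>2" for r
  proof (cases "r \<le> l")
    case True
    then have "min r (L - r) = r" using l by simp
    then show ?thesis using True by (simp add: y_def power_mult_distrib)
  next
    case False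
    then have "min r (L - r) = L - r" using l by simp
    then show ?thesis using False by (simp add: y_def power_mult_distrib)
  qed
  have NN: "N = N - 2 + 2" using N2 by simp
  have ric: "y' r + (y r)\<^sup>2 / h r ^ N \<le> N * \<theta>\<^sup>2 * h r ^ (N - 2)" if r: "0 < r" "r < L" for r
  proof -
    have rL: "r \<in> {0..L}" using r by simp
    define H where "H = 1 + min r (L - r)"
    define z where "z = (yT (min r (L - r)))\<^sup>2"
    have H: "H > 0" "\<theta> * H \<le> h r" using r h\<theta>[OF rL] by (auto simp: H_def)
    have \<theta>H: "\<theta> * H > 0" using H \<theta> by simp
    have hr: "h r ^ N > 0" using h_pos[OF rL] by simp
    have le: "\<kappa> * H ^ N \<le> h r ^ N"
      unfolding \<kappa>_def power_mult_distrib[symmetric] using H \<theta>H by (intro power_mono) auto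
    have "\<kappa> / h r ^ N \<le> 1 / H ^ N" using le hr H by (simp add: field_simps)
    then have "\<kappa> * z * (\<kappa> / h r ^ N) \<le> \<kappa> * z * (1 / H ^ N)"
      using \<kappa> by (intro mult_left_mono) (auto simp: z_def)
    moreover have "y' r + (y r)\<^sup>2 / h r ^ N = \<kappa> * (N * H ^ (N - 2)) - \<kappa> * z * (1 / H ^ N) + \<kappa> * z * (\<kappa> / h r ^ N)"
      unfolding y_sq y'_def yT'_def H_def[symmetric] z_def[symmetric] by (simp add: algebra_simps power2_eq_square)
    ultimately have "y' r + (y r)\<^sup>2 / h r ^ N \<le> \<kappa> * (N * H ^ (N - 2))" by linarith
    also have "\<kappa> = \<theta> ^ (N - 2) * \<theta>\<^sup>2" unfolding \<kappa>_def by (subst NN) (rule power_add)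
    also have "\<theta> ^ (N - 2) * \<theta>\<^sup>2 * (N * H ^ (N - 2)) = N * \<theta>\<^sup>2 * (\<theta> * H) ^ (N - 2)"
      by (simp add: power_mult_distrib)
    also have "\<dots> \<le> N * \<theta>\<^sup>2 * h r ^ (N - 2)"
      using H \<theta>H by (intro mult_left_mono power_mono) auto
    finally show ?thesis .
  qed
  have yT0: "yT 0 = - A2"
  proof -
    have "real N + R ^ Suc N > 0" using R by (intro add_nonneg_pos) auto
    then show ?thesis
      by (simp add: yT_def tent_flux_def tent_mode_def A2_def field_simps)
  qed
  have y_ends: "y 0 = - (\<kappa> * A2)" "y L = \<kappa> * A2" using l by (simp_all add: y_def yT0)
  have cy: "continuous_on {0..L} y"
    by (rule DERIV_continuous_on) (rule has_field_derivative_at_within[OF yd]; simp)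
  have const: "\<exists>c. \<forall>x\<in>cyl L. u x = c" if u: "steklov_eigenfunction L g \<sigma> u" "\<sigma> < \<kappa> * min A1 A2" for \<sigma> u
  proof -
    have "\<kappa> * min A1 A2 \<le> \<kappa> * A1" "\<kappa> * min A1 A2 \<le> \<kappa> * A2" using \<kappa> by (auto intro: mult_left_mono)
    then have \<sigma>: "\<sigma> < \<kappa> * A1" "\<sigma> < \<kappa> * A2" using u(2) by linarith+
    show ?thesis
    proof (rule eigenfunction_constant[OF u(1) \<sigma>(2) cy, where y' = y' and \<Lambda> = "N * \<theta>\<^sup>2" and J = J])
      show "(y has_real_derivative y' r) (at r)" if "0 < r" "r < L" for r using that by (intro yd) auto
      show "y' r + (y r)\<^sup>2 / h r ^ N \<le> N * \<theta>\<^sup>2 * h r ^ (N - 2)" if "0 < r" "r < L" for r by (rule ric[OF that])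
      have "\<theta>\<^sup>2 < 1" using \<theta> by (simp add: power_less_one_iff)
      then show "N * \<theta>\<^sup>2 < N" using N2 by simp
      show "(J has_real_derivative 1 / h r ^ N) (at r within {0..L})" if "r \<in> {0..L}" for r by (rule J[OF that])
      show "\<sigma> * (J L - J 0) < 2"
      proof (cases "\<sigma> \<le> 0")
        case True
        then have "\<sigma> * (J L - J 0) \<le> 0" using J0L by (intro mult_nonpos_nonneg) auto
        then show ?thesis by simp
      next
        case False
        have "\<sigma> * (J L - J 0) \<le> \<sigma> * (2 * (1 / \<kappa> * I0))" using False I by (intro mult_left_mono) auto
        also have "\<dots> < \<kappa> * A1 * (2 * (1 / \<kappa> * I0))" using \<sigma>(1) \<kappa> I0 by (intro mult_strict_right_mono) auto
        also have "\<dots> = 2" using \<kappa> I0 by (simp add: A1)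
        finally show ?thesis .
      qed
    qed (simp_all add: y_ends)
  qed
  have "\<kappa> * min A1 A2 \<le> Inf S"
  proof (rule cInf_greatest[OF S])
    fix t assume "t \<in> S"
    then obtain F s where "lin_indep_on (cyl L) (Suc 1) F"
      "\<forall>i<Suc 1. s i \<le> t \<and> steklov_eigenfunction L g (s i) (F i)" unfolding S_def by blast
    with const show "\<kappa> * min A1 A2 \<le> t" by (rule eigenvalue_bound_from_constancy)
  qed
  then show ?thesis unfolding ev \<kappa>_def A1_def A2_def R_def l_def .
qed

end

text \<open>The tent profile \<open>1 + L/2 - \<bar>r - L/2\<bar>\<close> with its corner rounded off.\<close>

definition rounded_tent :: "real \<Rightarrow> real \<Rightarrow> real \<Rightarrow> real" where
  "rounded_tent L \<delta> r = 1 + sqrt ((L/2)\<^sup>2 + \<delta>\<^sup>2) - sqrt ((r - L/2)\<^sup>2 + \<delta>\<^sup>2)"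

lemma rounded_tent:
  assumes L: "L > 0" and \<delta>: "0 < \<delta>" "\<delta> < 1"
  shows "smooth_near {0..L} (rounded_tent L \<delta>)"
    and "\<And>r. (rounded_tent L \<delta> has_real_derivative deriv (rounded_tent L \<delta>) r) (at r)"
    and "\<And>r. \<bar>deriv (rounded_tent L \<delta>) r\<bar> \<le> 1"
    and "rounded_tent L \<delta> 0 = 1" "rounded_tent L \<delta> L = 1"
    and "\<And>r. r \<in> {0..L} \<Longrightarrow> (1 - \<delta>) * (1 + min r (L - r)) \<le> rounded_tent L \<delta> r"
proof -
  define q where "q r = (r + - (L/2))\<^sup>2 + \<delta>\<^sup>2" for r
  have q: "q r > 0" for r unfolding q_def using \<delta> by (intro add_nonneg_pos) auto
  have h: "rounded_tent L \<delta> = (\<lambda>r. (1 + sqrt ((L/2)\<^sup>2 + \<delta>\<^sup>2)) + (-1) * sqrt (q r))"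
    by (simp add: rounded_tent_def q_def fun_eq_iff)
  have Cq: "Ck_on k UNIV q" for k
    unfolding q_def
    by (intro Ck_on_add Ck_on_power Ck_on_const Ck_on_bounded_linear open_UNIV bounded_linear_ident)
  have "Ck_on k UNIV (\<lambda>r. sqrt (q r))" for k by (rule Ck_on_sqrt[OF open_UNIV q Cq])
  then have "Ck_on k UNIV (rounded_tent L \<delta>)" for k
    unfolding h by (intro Ck_on_add Ck_on_mult Ck_on_const open_UNIV)
  then show "smooth_near {0..L} (rounded_tent L \<delta>)" unfolding smooth_near_def by (intro exI[of _ UNIV]) simp
  have d: "(rounded_tent L \<delta> has_real_derivative - ((r - L/2) / sqrt (q r))) (at r)" for r
  proof -
    have "((\<lambda>r. (r + - (L/2))\<^sup>2 + \<delta>\<^sup>2) has_real_derivative of_nat 2 * ((1 + 0) * (r + - (L/2)) ^ (2 - Suc 0)) + 0) (at r)"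
      by (intro DERIV_add DERIV_power DERIV_ident DERIV_const)
    then have "(q has_real_derivative 2 * (r - L/2)) (at r)" unfolding q_def[abs_def] by simp
    from DERIV_add[OF DERIV_const DERIV_cmult[OF DERIV_chain2[OF DERIV_real_sqrt[OF q] this], of "-1"]]
    show ?thesis unfolding h by (rule DERIV_cong) (use q[of r] in \<open>simp add: field_simps\<close>)
  qed
  have dq: "deriv (rounded_tent L \<delta>) r = - ((r - L/2) / sqrt (q r))" for r by (rule DERIV_imp_deriv[OF d])
  show "(rounded_tent L \<delta> has_real_derivative deriv (rounded_tent L \<delta>) r) (at r)" for r
    unfolding dq by (rule d)
  show "\<bar>deriv (rounded_tent L \<delta>) r\<bar> \<le> 1" for r
  proof -
    have "\<bar>r - L/2\<bar> \<le> sqrt (q r)" by (rule real_le_rsqrt) (simp add: q_def)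
    then show ?thesis unfolding dq using q[of r] by (simp add: abs_divide divide_le_eq)
  qed
  show "rounded_tent L \<delta> 0 = 1" "rounded_tent L \<delta> L = 1" by (simp_all add: rounded_tent_def)
  fix r assume r: "r \<in> {0..L}"
  have "L/2 \<le> sqrt ((L/2)\<^sup>2 + \<delta>\<^sup>2)" by (rule real_le_rsqrt) simp
  moreover have "sqrt ((r - L/2)\<^sup>2 + \<delta>\<^sup>2) \<le> \<bar>r - L/2\<bar> + \<delta>"
    using sqrt_sum_squares_le_sum_abs[of "r - L/2" \<delta>] \<delta> by simp
  moreover have "min r (L - r) = L/2 - \<bar>r - L/2\<bar>" by (simp add: min_def abs_if)
  ultimately have 1: "1 + min r (L - r) - \<delta> \<le> rounded_tent L \<delta> r"
    unfolding rounded_tent_def by linarith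
  have "min r (L - r) \<ge> 0" using r by simp
  then have "\<delta> * min r (L - r) \<ge> 0" using \<delta> by simp
  then have "(1 - \<delta>) * (1 + min r (L - r)) \<le> 1 + min r (L - r) - \<delta>" by (simp add: algebra_simps)
  with 1 show "(1 - \<delta>) * (1 + min r (L - r)) \<le> rounded_tent L \<delta> r" by linarith
qed

theorem theorem3:
  fixes n :: nat and L :: real
  assumes "n = CARD('n::finite)" and "n \<ge> 3" and "L > 0"
  shows "(\<forall>g :: 'n form_field. metric_of_revolution L g \<longrightarrow>
            steklov_eigenvalue L g 1 < B_bound n L) \<and>
         (\<forall>\<epsilon>>0. \<exists>g :: 'n form_field. metric_of_revolution L g \<and>
            steklov_eigenvalue L g 1 > B_bound n L - \<epsilon>)"
proof (intro conjI allI impI)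
  define N where "N = CARD('n) - 1"
  have N: "N \<ge> 2" "n = Suc N" "n - 2 = N - 1" "real n - 2 = real (N - 1)" "real n - 1 = real N"
    using assms(1,2) by (auto simp: N_def)
  have B: "B_bound n L = min (real (N - 1) * (1 + L / 2) ^ (N - 1) / ((1 + L / 2) ^ (N - 1) - 1))
      (N * ((1 + L / 2) ^ Suc N - 1) / ((1 + L / 2) ^ Suc N + N))"
  proof -
    have "(1 + L / 2) ^ n + real n - 1 = (1 + L / 2) ^ Suc N + N" using N(5) unfolding N(2) by simp
    then show ?thesis unfolding B_bound_def N(3,4,5) by (simp only: N(2))
  qed
  {
    fix g :: "'n form_field" assume "metric_of_revolution L g"
    then obtain h where h: "smooth_near {0..L} h" "\<And>r. r \<in> {0..L} \<Longrightarrow> h r > 0"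
        "\<And>r. r \<in> {0..L} \<Longrightarrow> \<bar>deriv h r\<bar> \<le> 1" "h 0 = 1" "h L = 1"
        "\<And>x v w. x \<in> cyl L \<Longrightarrow> v \<in> tangent_cyl x \<Longrightarrow> w \<in> tangent_cyl x \<Longrightarrow>
           g x v w = fst v * fst w + (h (fst x))\<^sup>2 * (snd v \<bullet> snd w)"
      unfolding metric_of_revolution_def by blast
    obtain U where U: "open U" "{0..L} \<subseteq> U" "Ck_on (Suc 0) U h"
      using h(1) unfolding smooth_near_def by blast
    have d: "(h has_real_derivative deriv h r) (at r)" if "r \<in> {0..L}" for r
      using Ck_on_real_deriv(2)[OF U(1,3)] U(2) that by blast
    interpret revolution L h "deriv h" g N
    proof
      show "CARD('n) \<ge> 3" using assms by simp
    qed (use assms(3) h d in \<open>auto simp: N_def\<close>)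
    show "steklov_eigenvalue L g 1 < B_bound n L"
      unfolding B using steklov_eigenvalue_less[OF h(1,3)] by simp
  }
  fix \<epsilon> :: real assume \<epsilon>: "\<epsilon> > 0"
  have R: "1 + L / 2 > 1" using assms(3) by simp
  have R1: "(1 + L / 2) ^ (N - 1) > 1" "(1 + L / 2) ^ Suc N > 1"
    using R N(1) by (auto intro!: one_less_power simp del: power_Suc)
  have B0: "B_bound n L > 0"
    unfolding B min_less_iff_conj using R1 N(1) R by (auto intro!: divide_pos_pos mult_pos_pos add_pos_nonneg simp del: power_Suc)
  define \<delta> where "\<delta> = min (1/2) (\<epsilon> / (2 * (N * B_bound n L)))"
  have NB: "N * B_bound n L > 0" using N(1) B0 by simp
  have \<delta>: "0 < \<delta>" "\<delta> < 1" using \<epsilon> NB by (auto simp: \<delta>_def)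
  have "\<delta> * (2 * (N * B_bound n L)) \<le> \<epsilon>"
    using NB \<epsilon> by (simp add: \<delta>_def min_def field_simps)
  then have \<delta>\<epsilon>: "N * \<delta> * B_bound n L < \<epsilon>" using \<epsilon> by (simp add: mult_ac)
  note h = rounded_tent[OF assms(3) \<delta>]
  define g :: "'n form_field" where "g = (\<lambda>x v w. fst v * fst w + (rounded_tent L \<delta> (fst x))\<^sup>2 * (snd v \<bullet> snd w))"
  have hpos: "rounded_tent L \<delta> r > 0" if r: "r \<in> {0..L}" for r
  proof -
    have "(1 - \<delta>) * (1 + min r (L - r)) > 0" using \<delta> r by (intro mult_pos_pos) auto
    then show ?thesis using h(6)[OF r] by linarith
  qed
  interpret revolution L "rounded_tent L \<delta>" "deriv (rounded_tent L \<delta>)" g N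
  proof
    show "CARD('n) \<ge> 3" using assms by simp
    show "(rounded_tent L \<delta> has_real_derivative deriv (rounded_tent L \<delta>) r) (at r)" for r by (rule h(2))
  qed (use assms(3) h(4,5) hpos in \<open>auto simp: N_def g_def\<close>)
  have "metric_of_revolution L g"
    unfolding metric_of_revolution_def g_def
    by (intro exI[of _ "rounded_tent L \<delta>"]) (use h hpos in auto)
  moreover have "steklov_eigenvalue L g 1 > B_bound n L - \<epsilon>"
  proof -
    have "1 - N * \<delta> \<le> (1 - \<delta>) ^ N" using Bernoulli_inequality[of "- \<delta>" N] \<delta> by simp
    then have "(1 - N * \<delta>) * B_bound n L \<le> (1 - \<delta>) ^ N * B_bound n L"
      using B0 by (intro mult_right_mono) auto
    also have "\<dots> \<le> steklov_eigenvalue L g 1"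
      unfolding B by (rule steklov_eigenvalue_ge[OF h(1)]) (use \<delta> h(6) in auto)
    finally show ?thesis using \<delta>\<epsilon> by (simp add: algebra_simps)
  qed
  ultimately show "\<exists>g :: 'n form_field. metric_of_revolution L g \<and> steklov_eigenvalue L g 1 > B_bound n L - \<epsilon>"
    by blast
qed

end
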